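(* For $a\in\mathbb R$ with $\frac13<a<\frac12$, let $$K_a^+=\left[a,\tfrac12\right]\cup\left[1-a,2a\right]\cup\left[1,2(1-a)\right],\qquad K_a=K_a^+\cup(-K_a^+).$$ Then every $K_a$, $\frac13<a<\frac12$, is a symmetric wavelet set of $L^2(\mathbb R)$ belonging to the class $\mathcal M_3((1,-1,1),I_2)$, where $I_2$ is the identity permutation of $\{1,2\}$. Moreover, these wavelet sets are associated to MRA wavelets.
   Context: Fourier transform: $\widehat\psi(\xi)=\int_{\mathbb R}\psi(x)e^{-2\pi i x\xi}\,dx$. An orthonormal wavelet is a function $\psi\in L^2(\mathbb R)$ such that $\{2^{j/2}\psi(2^jx-k): j,k\in\mathbb Z\}$ is an orthonormal basis of $L^2(\mathbb R)$. A measurable set $K\subset\mathbb R$ is a wavelet set (of $L^2(\mathbb R)$) if there is an orthonormal wavelet $\psi$ with $|\widehat\psi|=\chi_K$ a.e. It is symmetric if $K\cap(-\infty,0]=-(K\cap[0,\infty))$; write $K^+=K\cap[0,\infty)$. The class $\mathcal M_n(\epsilon,\tau)$: for $n\in\mathbb N$, $\epsilon\in\{-1,1\}^n$ and $\tau$ a permutation of $\{1,\dots,n-1\}$, $\mathcal M_n(\epsilon,\tau)$ is the family of symmetric wavelet sets $K$ for which $K^+=I_1\cup\dots\cup I_n$ and there are reals $0=a_0<a_1<\dots<a_n=\frac12$, nonnegative integers $m_1,\dots,m_n$ and integers $\lambda_1,\dots,\lambda_{n-1}$ such that: (a) $I_j=\epsilon_j[a_{j-1},a_j]+m_j$ for $1\le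 j\le n$; (b) the intervals $H_k=[\alpha_k,\beta_k]$ defined by $H_{\tau(j)}=2^{-\lambda_j}I_j$ ($1\le j\le n-1$), $H_n=I_n$, satisfy $2\alpha_1=\beta_n$ and $\beta_k=\alpha_{k+1}$ for $1\le k\le n-1$; (c) if $\epsilon_j=\epsilon_{j+1}$ then $m_j\neq m_{j+1}$. MRA wavelets: a multiresolution analysis (MRA) is an increasing sequence $(V_j)_{j\in\mathbb Z}$ of closed subspaces of $L^2(\mathbb R)$ with $f\in V_j\iff f(2\cdot)\in V_{j+1}$, $\bigcap_jV_j=\{0\}$, $\overline{\bigcup_jV_j}=L^2(\mathbb R)$, and such that $V_0$ has an orthonormal basis $\{\varphi(\cdot-k):k\in\mathbb Z\}$ for some $\varphi\in V_0$. An orthonormal wavelet $\psi$ is an MRA wavelet if there is an MRA such that $\{\psi(\cdot-k):k\in\mathbb Z\}$ is an orthonormal basis of the orthogonal complement of $V_0$ in $V_1$. A wavelet set $K$ is associated to an MRA wavelet if the orthonormal wavelets $\psi$ with $|\widehat\psi|=\chi_K$ a.e. are MRA wavelets. *)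

theory Defs
  imports "HOL-Analysis.Analysis" "HOL-Combinatorics.Permutations"
begin

text \<open>
  Elements of the space are represented by functions, not by classes modulo null sets. Equality
  of elements is almost-everywhere equality, and the zero element is the set of all null functions.
\<close>

definition L2 :: "(real \<Rightarrow> complex) set" where
  "L2 = {f \<in> borel_measurable lebesgue. integrable lebesgue (\<lambda>x. (cmod (f x))\<^sup>2)}"

definition l2_inner :: "(real \<Rightarrow> complex) \<Rightarrow> (real \<Rightarrow> complex) \<Rightarrow> complex" where
  "l2_inner f g = (LINT x|lebesgue. f x * cnj (g x))"

definition l2_norm :: "(real \<Rightarrow> complex) \<Rightarrow> real" where
  "l2_norm f = sqrt (LINT x|lebesgue. (cmod (f x))\<^sup>2)"

definition l2_null :: "(real \<Rightarrow> complex) set" where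
  "l2_null = {f. AE x in lebesgue. f x = 0}"

definition l2_tendsto :: "(nat \<Rightarrow> real \<Rightarrow> complex) \<Rightarrow> (real \<Rightarrow> complex) \<Rightarrow> bool" where
  "l2_tendsto F g \<longleftrightarrow>
     (\<forall>n. F n \<in> L2) \<and> g \<in> L2 \<and> (\<lambda>n. l2_norm (\<lambda>x. F n x - g x)) \<longlonglongrightarrow> 0"

definition l2_closure :: "(real \<Rightarrow> complex) set \<Rightarrow> (real \<Rightarrow> complex) set" where
  "l2_closure S = {f \<in> L2. \<forall>e>0. \<exists>g\<in>S. l2_norm (\<lambda>x. f x - g x) < e}"

definition l2_span :: "('i \<Rightarrow> real \<Rightarrow> complex) \<Rightarrow> (real \<Rightarrow> complex) set" where
  "l2_span e = {f. \<exists>I c. finite I \<and> f = (\<lambda>x. \<Sum>i\<in>I. c i * e i x)}"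

definition l2_closed_subspace :: "(real \<Rightarrow> complex) set \<Rightarrow> bool" where
  "l2_closed_subspace V \<longleftrightarrow>
     V \<subseteq> L2 \<and> (\<lambda>x. 0) \<in> V \<and>
     (\<forall>f\<in>V. \<forall>g\<in>V. (\<lambda>x. f x + g x) \<in> V) \<and>
     (\<forall>c. \<forall>f\<in>V. (\<lambda>x. c * f x) \<in> V) \<and>
     l2_closure V \<subseteq> V"

definition l2_orthogonal_complement ::
    "(real \<Rightarrow> complex) set \<Rightarrow> (real \<Rightarrow> complex) set \<Rightarrow> (real \<Rightarrow> complex) set" where
  "l2_orthogonal_complement W V = {f \<in> W. \<forall>g\<in>V. l2_inner f g = 0}"

definition l2_orthonormal_basis ::
    "('i \<Rightarrow> real \<Rightarrow> complex) \<Rightarrow> (real \<Rightarrow> complex) set \<Rightarrow> bool" where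
  "l2_orthonormal_basis e V \<longleftrightarrow>
     (\<forall>i. e i \<in> L2) \<and>
     (\<forall>i j. l2_inner (e i) (e j) = (if i = j then 1 else 0)) \<and>
     l2_closure (l2_span e) = V"

text \<open>
  The Fourier transform of an \<open>L\<^sup>2\<close> function is the limit in the mean of the transforms of its
  truncations to \<open>[-n, n]\<close>, which are integrable. It is determined almost everywhere, hence
  a relation.
\<close>

definition truncated_fourier :: "(real \<Rightarrow> complex) \<Rightarrow> nat \<Rightarrow> real \<Rightarrow> complex" where
  "truncated_fourier f n \<xi> = (LINT x:{- real n..real n}|lebesgue. f x * cis (- 2 * pi * x * \<xi>))"

definition has_l2_fourier :: "(real \<Rightarrow> complex) \<Rightarrow> (real \<Rightarrow> complex) \<Rightarrow> bool" where
  "has_l2_fourier f g \<longleftrightarrow> f \<in> L2 \<and> l2_tendsto (truncated_fourier f) g"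

definition fourier_modulus_is_indicator :: "(real \<Rightarrow> complex) \<Rightarrow> real set \<Rightarrow> bool" where
  "fourier_modulus_is_indicator \<psi> K \<longleftrightarrow>
     (\<exists>g. has_l2_fourier \<psi> g \<and> (AE \<xi> in lebesgue. cmod (g \<xi>) = indicat_real K \<xi>))"

definition wavelet_family :: "(real \<Rightarrow> complex) \<Rightarrow> int \<times> int \<Rightarrow> real \<Rightarrow> complex" where
  "wavelet_family \<psi> = (\<lambda>(j, k) x.
     complex_of_real (2 powr (real_of_int j / 2)) * \<psi> (2 powi j * x - real_of_int k))"

definition integer_translates :: "(real \<Rightarrow> complex) \<Rightarrow> int \<Rightarrow> real \<Rightarrow> complex" where
  "integer_translates \<phi> k x = \<phi> (x - real_of_int k)"

definition orthonormal_wavelet :: "(real \<Rightarrow> complex) \<Rightarrow> bool" where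
  "orthonormal_wavelet \<psi> \<longleftrightarrow> \<psi> \<in> L2 \<and> l2_orthonormal_basis (wavelet_family \<psi>) L2"

definition wavelet_set :: "real set \<Rightarrow> bool" where
  "wavelet_set K \<longleftrightarrow>
     K \<in> sets lebesgue \<and> (\<exists>\<psi>. orthonormal_wavelet \<psi> \<and> fourier_modulus_is_indicator \<psi> K)"

definition symmetric_set :: "real set \<Rightarrow> bool" where
  "symmetric_set K \<longleftrightarrow> K \<inter> {..0} = uminus ` (K \<inter> {0..})"

definition multiresolution_analysis :: "(int \<Rightarrow> (real \<Rightarrow> complex) set) \<Rightarrow> bool" where
  "multiresolution_analysis V \<longleftrightarrow>
     (\<forall>j. l2_closed_subspace (V j)) \<and>
     (\<forall>j. V j \<subseteq> V (j + 1)) \<and>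
     (\<forall>j f. f \<in> V j \<longleftrightarrow> (\<lambda>x. f (2 * x)) \<in> V (j + 1)) \<and>
     (\<Inter>j. V j) = l2_null \<and>
     l2_closure (\<Union>j. V j) = L2 \<and>
     (\<exists>\<phi>\<in>V 0. l2_orthonormal_basis (integer_translates \<phi>) (V 0))"

definition mra_wavelet :: "(real \<Rightarrow> complex) \<Rightarrow> bool" where
  "mra_wavelet \<psi> \<longleftrightarrow>
     orthonormal_wavelet \<psi> \<and>
     (\<exists>V. multiresolution_analysis V \<and>
       l2_orthonormal_basis (integer_translates \<psi>) (l2_orthogonal_complement (V 1) (V 0)))"

definition associated_to_mra_wavelet :: "real set \<Rightarrow> bool" where
  "associated_to_mra_wavelet K \<longleftrightarrow>
     wavelet_set K \<and>
     (\<forall>\<psi>. orthonormal_wavelet \<psi> \<and> fourier_modulus_is_indicator \<psi> K \<longrightarrow> mra_wavelet \<psi>)"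

text \<open>
  Indices run from 1, so sign vectors and sequences are functions on \<open>nat\<close> of which only the
  values at \<open>1, \<dots>, n\<close> (for \<open>a\<close>: \<open>0, \<dots>, n\<close>; for \<open>l\<close>: \<open>1, \<dots>, n - 1\<close>) matter.
  The integers \<open>l j\<close> are the dilation exponents \<open>\<lambda>\<^sub>j\<close>.
\<close>

definition wavelet_class :: "nat \<Rightarrow> (nat \<Rightarrow> int) \<Rightarrow> (nat \<Rightarrow> nat) \<Rightarrow> real set set" where
  "wavelet_class n \<epsilon> \<tau> = {K.
     (\<forall>j\<in>{1..n}. \<epsilon> j \<in> {-1, 1}) \<and> \<tau> permutes {1..n - 1} \<and>
     wavelet_set K \<and> symmetric_set K \<and>
     (\<exists>(I :: nat \<Rightarrow> real set) (a :: nat \<Rightarrow> real) (m :: nat \<Rightarrow> nat) (l :: nat \<Rightarrow> int)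
        (\<alpha> :: nat \<Rightarrow> real) (\<beta> :: nat \<Rightarrow> real).
        K \<inter> {0..} = (\<Union>j\<in>{1..n}. I j) \<and>
        a 0 = 0 \<and> (\<forall>j<n. a j < a (Suc j)) \<and> a n = 1 / 2 \<and>
        (\<forall>j\<in>{1..n}. I j = (\<lambda>x. real_of_int (\<epsilon> j) * x + real (m j)) ` {a (j - 1)..a j}) \<and>
        (\<forall>j\<in>{1..n - 1}. {\<alpha> (\<tau> j)..\<beta> (\<tau> j)} = (\<lambda>x. 2 powi (- l j) * x) ` I j) \<and>
        {\<alpha> n..\<beta> n} = I n \<and>
        2 * \<alpha> 1 = \<beta> n \<and> (\<forall>k\<in>{1..n - 1}. \<beta> k = \<alpha> (k + 1)) \<and>
        (\<forall>j\<in>{1..n - 1}. \<epsilon> j = \<epsilon> (j + 1) \<longrightarrow> m j \<noteq> m (j + 1)))}"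

definition Ka_plus :: "real \<Rightarrow> real set" where
  "Ka_plus a = {a..1 / 2} \<union> {1 - a..2 * a} \<union> {1..2 * (1 - a)}"

definition Ka :: "real \<Rightarrow> real set" where
  "Ka a = Ka_plus a \<union> uminus ` Ka_plus a"

end

theory Submission
  imports Defs
begin

text \<open>
  The wavelet set comes from a scaling set. Put
  \<open>S = {\<xi>. \<bar>\<xi>\<bar> \<le> a \<or> 1/2 \<le> \<bar>\<xi>\<bar> \<le> 1 - a}\<close>. For \<open>1/3 < a < 1/2\<close> one has \<open>S \<subseteq> 2S\<close>, and up to finitely many
  points \<open>2S \<setminus> S\<close> is \<open>K\<^sub>a\<close>. Cutting \<open>S\<close> and \<open>K\<^sub>a\<close> at finitely many points and moving the pieces
  by integers gives the unit cell \<open>[-1/2, 1/2)\<close> in both cases. Hence the exponentials restricted to either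
  set are an orthonormal basis of its \<open>L\<^sup>2\<close> space, as they are on the unit cell, and multiplication by a
  function of modulus one does not change this.

  On the frequency side let \<open>V\<^sub>j\<close> be the functions living on \<open>2\<^sup>j S\<close>. These spaces increase because
  \<open>S \<subseteq> 2S\<close>; their union is dense because \<open>S\<close> contains a neighbourhood of \<open>0\<close>; their intersection is trivial
  because \<open>S\<close> is bounded; the translates of the function with transform \<open>indicator S\<close> are a basis of
  \<open>V\<^sub>0\<close>; and the orthogonal complement of \<open>V\<^sub>0\<close> in \<open>V\<^sub>1\<close> lives on \<open>2S \<setminus> S\<close>, with basis the translates of
  any \<open>\<psi>\<close> whose transform has modulus \<open>indicator (2S \<setminus> S)\<close>. Since the sets \<open>2\<^sup>j (2S \<setminus> S)\<close> are disjoint and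
  telescope to the whole line, the dilates of these bases make up a basis of \<open>L\<^sup>2\<close>. So every such \<open>\<psi>\<close> is an
  orthonormal wavelet and comes from this one multiresolution analysis (\<open>mra_multiresolution_analysis\<close>,
  \<open>mra_orthogonal_complement\<close>, \<open>scaled_K_span_dense\<close>).

  The passage between the two sides rests on Plancherel's theorem, which is derived here from Fourier
  series. If \<open>g\<close> lives on the unit cell, the values of its inverse transform on \<open>x + \<int>\<close> are Fourier
  coefficients, so Parseval's identity, integrated over \<open>x\<close>, gives the isometry
  (\<open>inv_fourier_isometry_cell\<close>); dilation extends it to every bounded support. The transform and its inverse
  are adjoint by Fubini, and two isometries that are adjoint to each other are inverse to each other in the
  mean (\<open>fourier_inversion\<close>). The transforms that occur below have bounded support, so an honest integral
  represents them, and the closed subspaces arise as closures of sets of such functions.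
\<close>

section \<open>Square-integrable functions as a pre-Hilbert space\<close>

lemma sigma_finite_lebesgue: "sigma_finite_measure (lebesgue :: real measure)"
proof
  obtain A :: "real set set" where A: "countable A" "A \<subseteq> sets lborel" "\<Union>A = space lborel"
      "\<forall>a\<in>A. emeasure lborel a \<noteq> \<infinity>"
    using lborel.sigma_finite_countable by blast
  then show "\<exists>A. countable A \<and> A \<subseteq> sets (lebesgue :: real measure) \<and> \<Union>A = space lebesgue \<and>
      (\<forall>a\<in>A. emeasure lebesgue a \<noteq> \<infinity>)"
    by (intro exI[of _ A]) (auto simp: subset_iff intro: sets_completionI_sets)
qed

interpretation lebesgue: sigma_finite_measure "lebesgue :: real measure"
  by (rule sigma_finite_lebesgue)

interpretation lebesgue_pair: pair_sigma_finite "lebesgue :: real measure" "lebesgue :: real measure" ..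

lemma borel_measurable_cnj [measurable (raw)]:
  "f \<in> borel_measurable M \<Longrightarrow> (\<lambda>x. cnj (f x)) \<in> borel_measurable M"
  by (rule borel_measurable_continuous_on) (auto intro!: continuous_intros)

lemma L2_measurable [measurable_dest]: "f \<in> L2 \<Longrightarrow> f \<in> borel_measurable lebesgue"
  by (simp add: L2_def)

lemma L2_integrable: "f \<in> L2 \<Longrightarrow> integrable lebesgue (\<lambda>x. (cmod (f x))\<^sup>2)"
  by (simp add: L2_def)

lemma L2_dominated:
  assumes [measurable]: "f \<in> borel_measurable lebesgue" and "integrable lebesgue w"
    and "AE x in lebesgue. (cmod (f x))\<^sup>2 \<le> w x"
  shows "f \<in> L2"
proof -
  have "integrable lebesgue (\<lambda>x. (cmod (f x))\<^sup>2)"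
    by (rule Bochner_Integration.integrable_bound[OF assms(2)]) (use assms(3) in auto)
  then show ?thesis by (simp add: L2_def)
qed

lemma L2_zero [simp]: "(\<lambda>x. 0) \<in> L2"
  by (simp add: L2_def)

lemma L2_add: assumes "f \<in> L2" "g \<in> L2" shows "(\<lambda>x. f x + g x) \<in> L2"
proof (rule L2_dominated)
  show "(\<lambda>x. f x + g x) \<in> borel_measurable lebesgue"
    using assms[THEN L2_measurable] by simp
  show "integrable lebesgue (\<lambda>x. 2 * (cmod (f x))\<^sup>2 + 2 * (cmod (g x))\<^sup>2)"
    using assms[THEN L2_integrable] by simp
  have "(cmod (f x + g x))\<^sup>2 \<le> 2 * (cmod (f x))\<^sup>2 + 2 * (cmod (g x))\<^sup>2" for x
  proof -
    have "(cmod (f x + g x))\<^sup>2 \<le> (cmod (f x) + cmod (g x))\<^sup>2"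
      by (intro power_mono norm_triangle_ineq) auto
    also have "\<dots> \<le> 2 * (cmod (f x))\<^sup>2 + 2 * (cmod (g x))\<^sup>2"
      using zero_le_power2[of "cmod (f x) - cmod (g x)"] by (simp add: power2_eq_square algebra_simps)
    finally show ?thesis .
  qed
  then show "AE x in lebesgue. (cmod (f x + g x))\<^sup>2 \<le> 2 * (cmod (f x))\<^sup>2 + 2 * (cmod (g x))\<^sup>2"
    by simp
qed

lemma L2_scale: assumes "f \<in> L2" shows "(\<lambda>x. c * f x) \<in> L2"
proof -
  have "integrable lebesgue (\<lambda>x. (cmod c)\<^sup>2 * (cmod (f x))\<^sup>2)"
    using L2_integrable[OF assms] by simp
  then show ?thesis
    using L2_measurable[OF assms] by (simp add: L2_def norm_mult power_mult_distrib)
qed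

lemma L2_diff: "f \<in> L2 \<Longrightarrow> g \<in> L2 \<Longrightarrow> (\<lambda>x. f x - g x) \<in> L2"
  using L2_add[of f "\<lambda>x. -1 * g x"] L2_scale[of g "-1"] by simp

lemma L2_sum: "finite I \<Longrightarrow> (\<And>i. i \<in> I \<Longrightarrow> f i \<in> L2) \<Longrightarrow> (\<lambda>x. \<Sum>i\<in>I. f i x) \<in> L2"
  by (induction I rule: finite_induct) (auto intro: L2_add)

lemma L2_mult_unimodular:
  assumes "f \<in> L2" and [measurable]: "u \<in> borel_measurable lebesgue" and "\<And>x. cmod (u x) \<le> 1"
  shows "(\<lambda>x. u x * f x) \<in> L2" "(\<lambda>x. f x * u x) \<in> L2"
proof -
  have [measurable]: "f \<in> borel_measurable lebesgue" using assms(1) by (rule L2_measurable)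
  have "(cmod (u x * f x))\<^sup>2 \<le> (cmod (f x))\<^sup>2" for x
    using assms(3)[of x] by (intro power_mono) (auto simp: norm_mult intro: mult_left_le_one_le)
  then show "(\<lambda>x. u x * f x) \<in> L2"
    by (intro L2_dominated[OF _ L2_integrable[OF assms(1)]]) auto
  then show "(\<lambda>x. f x * u x) \<in> L2" by (simp add: mult.commute)
qed

lemma L2_restrict:
  assumes "f \<in> L2" "E \<in> sets lebesgue"
  shows "(\<lambda>x. indicator E x * f x) \<in> L2"
  using assms by (intro L2_mult_unimodular) (auto simp: indicator_def)

lemma L2_mult_integrable:
  assumes "f \<in> L2" "g \<in> L2" shows "integrable lebesgue (\<lambda>x. f x * cnj (g x))"
proof (rule Bochner_Integration.integrable_bound)
  have [measurable]: "f \<in> borel_measurable lebesgue" "g \<in> borel_measurable lebesgue"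
    using assms by (auto intro: L2_measurable)
  show "integrable lebesgue (\<lambda>x. (cmod (f x))\<^sup>2 + (cmod (g x))\<^sup>2)"
    using assms[THEN L2_integrable] by simp
  show "(\<lambda>x. f x * cnj (g x)) \<in> borel_measurable lebesgue" by simp
  have "cmod (f x * cnj (g x)) \<le> (cmod (f x))\<^sup>2 + (cmod (g x))\<^sup>2" for x
  proof -
    have "2 * (cmod (f x) * cmod (g x)) \<le> (cmod (f x))\<^sup>2 + (cmod (g x))\<^sup>2"
      using zero_le_power2[of "cmod (f x) - cmod (g x)"] by (simp add: power2_eq_square algebra_simps)
    moreover have "0 \<le> cmod (f x) * cmod (g x)" by simp
    ultimately show ?thesis unfolding norm_mult complex_mod_cnj by linarith
  qed
  then show "AE x in lebesgue. cmod (f x * cnj (g x)) \<le> norm ((cmod (f x))\<^sup>2 + (cmod (g x))\<^sup>2)"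
    by simp
qed

lemma l2_inner_add_left:
  "f \<in> L2 \<Longrightarrow> g \<in> L2 \<Longrightarrow> h \<in> L2 \<Longrightarrow> l2_inner (\<lambda>x. f x + g x) h = l2_inner f h + l2_inner g h"
  unfolding l2_inner_def by (simp add: distrib_right L2_mult_integrable)

lemma l2_inner_scale_left: "l2_inner (\<lambda>x. c * f x) h = c * l2_inner f h"
  unfolding l2_inner_def by (simp add: mult.assoc)

lemma l2_inner_cnj: "l2_inner g f = cnj (l2_inner f g)"
  unfolding l2_inner_def by (simp flip: Bochner_Integration.integral_cnj add: mult.commute)

lemma l2_inner_add_right:
  "f \<in> L2 \<Longrightarrow> g \<in> L2 \<Longrightarrow> h \<in> L2 \<Longrightarrow> l2_inner h (\<lambda>x. f x + g x) = l2_inner h f + l2_inner h g"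
  by (subst (1 2 3) l2_inner_cnj) (simp add: l2_inner_add_left)

lemma l2_inner_scale_right: "l2_inner h (\<lambda>x. c * f x) = cnj c * l2_inner h f"
  by (subst (1 2) l2_inner_cnj) (simp add: l2_inner_scale_left)

lemma l2_inner_diff_left:
  "f \<in> L2 \<Longrightarrow> g \<in> L2 \<Longrightarrow> h \<in> L2 \<Longrightarrow> l2_inner (\<lambda>x. f x - g x) h = l2_inner f h - l2_inner g h"
  unfolding l2_inner_def by (simp add: left_diff_distrib L2_mult_integrable)

lemma l2_inner_diff_right:
  "f \<in> L2 \<Longrightarrow> g \<in> L2 \<Longrightarrow> h \<in> L2 \<Longrightarrow> l2_inner h (\<lambda>x. f x - g x) = l2_inner h f - l2_inner h g"
  by (subst (1 2 3) l2_inner_cnj) (simp add: l2_inner_diff_left)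

lemma l2_inner_sum_left:
  "finite I \<Longrightarrow> (\<And>i. i \<in> I \<Longrightarrow> f i \<in> L2) \<Longrightarrow> h \<in> L2 \<Longrightarrow>
    l2_inner (\<lambda>x. \<Sum>i\<in>I. f i x) h = (\<Sum>i\<in>I. l2_inner (f i) h)"
  by (induction I rule: finite_induct) (simp_all add: l2_inner_add_left L2_sum l2_inner_def[of "\<lambda>x. 0"])

lemma l2_inner_sum_right:
  "finite I \<Longrightarrow> (\<And>i. i \<in> I \<Longrightarrow> f i \<in> L2) \<Longrightarrow> h \<in> L2 \<Longrightarrow>
    l2_inner h (\<lambda>x. \<Sum>i\<in>I. f i x) = (\<Sum>i\<in>I. l2_inner h (f i))"
  by (subst l2_inner_cnj, subst l2_inner_sum_left) (auto simp: l2_inner_cnj[symmetric])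

lemma l2_inner_self: "l2_inner f f = complex_of_real ((l2_norm f)\<^sup>2)"
proof -
  have "l2_inner f f = (LINT x|lebesgue. complex_of_real ((cmod (f x))\<^sup>2))"
    unfolding l2_inner_def by (simp add: complex_norm_square[symmetric])
  also have "\<dots> = complex_of_real (LINT x|lebesgue. (cmod (f x))\<^sup>2)" by (rule integral_complex_of_real)
  finally show ?thesis by (simp add: l2_norm_def)
qed

lemma l2_norm_nonneg [simp]: "0 \<le> l2_norm f"
  by (simp add: l2_norm_def)

lemma l2_norm_sq: "(l2_norm f)\<^sup>2 = (LINT x|lebesgue. (cmod (f x))\<^sup>2)"
  by (simp add: l2_norm_def)

lemma l2_norm_zero [simp]: "l2_norm (\<lambda>x. 0) = 0"
  by (simp add: l2_norm_def)

lemma l2_inner_cong_AE: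
  assumes "f \<in> L2" "f' \<in> L2" "g \<in> L2" "g' \<in> L2"
    and "AE x in lebesgue. f x = f' x" "AE x in lebesgue. g x = g' x"
  shows "l2_inner f g = l2_inner f' g'"
proof -
  have [measurable]: "f \<in> borel_measurable lebesgue" "g \<in> borel_measurable lebesgue"
      "f' \<in> borel_measurable lebesgue" "g' \<in> borel_measurable lebesgue"
    using assms by (auto intro: L2_measurable)
  show ?thesis unfolding l2_inner_def
    by (rule integral_cong_AE) (use assms(5,6) in \<open>auto elim!: eventually_elim2\<close>)
qed

lemma l2_norm_cong_AE:
  assumes "f \<in> borel_measurable lebesgue" "f' \<in> borel_measurable lebesgue"
    and "AE x in lebesgue. f x = f' x"
  shows "l2_norm f = l2_norm f'"
proof -
  note [measurable] = assms(1,2)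
  have "(LINT x|lebesgue. (cmod (f x))\<^sup>2) = (LINT x|lebesgue. (cmod (f' x))\<^sup>2)"
    by (rule integral_cong_AE) (use assms(3) in \<open>auto elim!: eventually_mono\<close>)
  then show ?thesis by (simp add: l2_norm_def)
qed

lemma l2_norm_eq_0_AE:
  assumes "f \<in> L2" "l2_norm f = 0" shows "AE x in lebesgue. f x = 0"
proof -
  have "(LINT x|lebesgue. (cmod (f x))\<^sup>2) = 0"
    using l2_norm_sq[of f] assms(2) by simp
  then have "AE x in lebesgue. (cmod (f x))\<^sup>2 = 0"
    by (subst (asm) integral_nonneg_eq_0_iff_AE) (auto simp: L2_integrable assms)
  then show ?thesis by simp
qed

lemma L2_cong_AE:
  assumes "f \<in> L2" "AE x in lebesgue. f x = g x" shows "g \<in> L2"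
proof -
  have g: "g \<in> borel_measurable lebesgue"
    using L2_measurable[OF assms(1)] assms(2) by (rule borel_measurable_AE)
  then show ?thesis
    by (rule L2_dominated[OF _ L2_integrable[OF assms(1)]]) (use assms(2) in \<open>auto elim!: eventually_mono\<close>)
qed

lemma l2_norm_scale: "l2_norm (\<lambda>x. c * f x) = cmod c * l2_norm f"
  by (simp add: l2_norm_def norm_mult power_mult_distrib real_sqrt_mult)

lemma l2_norm_minus_commute: "l2_norm (\<lambda>x. f x - g x) = l2_norm (\<lambda>x. g x - f x)"
  by (simp add: l2_norm_def norm_minus_commute)

lemma l2_norm_add_sq:
  assumes "f \<in> L2" "g \<in> L2"
  shows "(l2_norm (\<lambda>x. f x + g x))\<^sup>2 = (l2_norm f)\<^sup>2 + 2 * Re (l2_inner f g) + (l2_norm g)\<^sup>2"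
proof -
  have "complex_of_real ((l2_norm (\<lambda>x. f x + g x))\<^sup>2) = l2_inner (\<lambda>x. f x + g x) (\<lambda>x. f x + g x)"
    by (simp only: l2_inner_self)
  also have "\<dots> = l2_inner f f + l2_inner f g + cnj (l2_inner f g) + l2_inner g g"
    using assms by (simp add: l2_inner_add_left l2_inner_add_right L2_add l2_inner_cnj[of g f])
  finally have "Re (complex_of_real ((l2_norm (\<lambda>x. f x + g x))\<^sup>2)) = Re \<dots>" by simp
  then show ?thesis by (simp add: l2_inner_self)
qed

lemma l2_norm_diff_sq:
  assumes "f \<in> L2" "g \<in> L2"
  shows "(l2_norm (\<lambda>x. f x - g x))\<^sup>2 = (l2_norm f)\<^sup>2 - 2 * Re (l2_inner f g) + (l2_norm g)\<^sup>2"
  using l2_norm_add_sq[OF assms(1) L2_scale[OF assms(2), of "-1"]]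
  by (simp add: l2_inner_scale_right[of f "-1", simplified] l2_norm_scale[of "-1", simplified])

lemma l2_Cauchy_Schwarz:
  assumes "f \<in> L2" "g \<in> L2" shows "cmod (l2_inner f g) \<le> l2_norm f * l2_norm g"
proof (cases "l2_norm g = 0")
  case True
  have "l2_inner f g = l2_inner f (\<lambda>x. 0)"
    using l2_norm_eq_0_AE[OF assms(2) True] assms by (intro l2_inner_cong_AE) auto
  then show ?thesis using True by (simp add: l2_inner_def)
next
  case False
  define N c where "N = (l2_norm g)\<^sup>2" and "c = l2_inner f g"
  have N: "N > 0" using False by (simp add: N_def)
  \<comment> \<open>Up to the factor \<open>N\<close>, the component of \<open>f\<close> orthogonal to \<open>g\<close>.\<close>
  have "0 \<le> (l2_norm (\<lambda>x. of_real N * f x - c * g x))\<^sup>2" by simp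
  also have "\<dots> = N\<^sup>2 * (l2_norm f)\<^sup>2 - 2 * N * (cmod c)\<^sup>2 + (cmod c)\<^sup>2 * N"
  proof -
    have "l2_inner (\<lambda>x. of_real N * f x) (\<lambda>x. c * g x) = of_real (N * (cmod c)\<^sup>2)"
      by (simp add: l2_inner_scale_left l2_inner_scale_right c_def[symmetric] complex_norm_square
          mult.commute del: of_real_power)
    then show ?thesis
      using assms by (subst l2_norm_diff_sq)
        (auto intro!: L2_scale simp: l2_norm_scale power_mult_distrib N_def[symmetric])
  qed
  finally have "N * (cmod c)\<^sup>2 \<le> N * (N * (l2_norm f)\<^sup>2)" by (simp add: power2_eq_square algebra_simps)
  then have "(cmod c)\<^sup>2 \<le> (l2_norm f * l2_norm g)\<^sup>2"
    using N by (simp add: N_def power_mult_distrib mult.commute)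
  then show ?thesis unfolding c_def by (rule power2_le_imp_le) simp
qed

lemma l2_norm_triangle:
  assumes "f \<in> L2" "g \<in> L2"
  shows "l2_norm (\<lambda>x. f x + g x) \<le> l2_norm f + l2_norm g"
proof (rule power2_le_imp_le)
  have "Re (l2_inner f g) \<le> l2_norm f * l2_norm g"
    using l2_Cauchy_Schwarz[OF assms] complex_Re_le_cmod order_trans by blast
  then show "(l2_norm (\<lambda>x. f x + g x))\<^sup>2 \<le> (l2_norm f + l2_norm g)\<^sup>2"
    by (simp add: l2_norm_add_sq[OF assms] power2_sum)
qed simp

lemma l2_norm_triangle_diff:
  assumes "f \<in> L2" "g \<in> L2" "h \<in> L2"
  shows "l2_norm (\<lambda>x. f x - h x) \<le> l2_norm (\<lambda>x. f x - g x) + l2_norm (\<lambda>x. g x - h x)"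
  using l2_norm_triangle[OF L2_diff[OF assms(1,2)] L2_diff[OF assms(2,3)]] by simp

lemma l2_norm_mono:
  assumes "g \<in> L2" and f: "f \<in> L2" and "\<And>x. cmod (f x) \<le> cmod (g x)" shows "l2_norm f \<le> l2_norm g"
  unfolding l2_norm_def using assms
  by (intro real_sqrt_le_mono integral_mono) (auto simp: L2_integrable intro: power_mono)

lemma l2_dominated_convergence:
  assumes f [measurable]: "f \<in> borel_measurable lebesgue" and F [measurable]: "\<And>n. F n \<in> borel_measurable lebesgue"
    and w: "integrable lebesgue w"
    and bound: "\<And>n. AE x in lebesgue. (cmod (F n x - f x))\<^sup>2 \<le> w x"
    and lim: "AE x in lebesgue. (\<lambda>n. F n x) \<longlonglongrightarrow> f x"
  shows "(\<lambda>n. l2_norm (\<lambda>x. F n x - f x)) \<longlonglongrightarrow> 0"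
proof -
  have "(\<lambda>n. LINT x|lebesgue. (cmod (F n x - f x))\<^sup>2) \<longlonglongrightarrow> (LINT x|(lebesgue::real measure). 0)"
  proof (rule integral_dominated_convergence[OF _ _ w])
    show "AE x in lebesgue. (\<lambda>n. (cmod (F n x - f x))\<^sup>2) \<longlonglongrightarrow> 0"
      using lim
    proof eventually_elim
      case (elim x)
      have "(\<lambda>n. (cmod (F n x - f x))\<^sup>2) \<longlonglongrightarrow> (cmod (f x - f x))\<^sup>2" by (intro tendsto_intros elim)
      then show ?case by simp
    qed
  qed (use bound in auto)
  then have "(\<lambda>n. sqrt (LINT x|lebesgue. (cmod (F n x - f x))\<^sup>2)) \<longlonglongrightarrow> sqrt 0"
    by (intro tendsto_real_sqrt) simp
  then show ?thesis by (simp add: l2_norm_def)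
qed

section \<open>Closures and spans\<close>

lemma l2_closure_subset_L2: "l2_closure S \<subseteq> L2"
  by (auto simp: l2_closure_def)

lemma l2_closureI: "f \<in> L2 \<Longrightarrow> (\<And>e. e > 0 \<Longrightarrow> \<exists>g\<in>S. l2_norm (\<lambda>x. f x - g x) < e) \<Longrightarrow> f \<in> l2_closure S"
  by (auto simp: l2_closure_def)

lemma l2_closureE: "f \<in> l2_closure S \<Longrightarrow> e > 0 \<Longrightarrow> \<exists>g\<in>S. l2_norm (\<lambda>x. f x - g x) < e"
  by (auto simp: l2_closure_def)

lemma l2_closure_superset: "S \<subseteq> L2 \<Longrightarrow> S \<subseteq> l2_closure S"
  by (force intro!: l2_closureI)

lemma l2_closure_mono: "S \<subseteq> T \<Longrightarrow> l2_closure S \<subseteq> l2_closure T"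
  by (fastforce simp: l2_closure_def)

lemma l2_closure_minimal:
  assumes "S \<subseteq> l2_closure T" "T \<subseteq> L2" shows "l2_closure S \<subseteq> l2_closure T"
proof
  fix f assume f: "f \<in> l2_closure S"
  then have fL: "f \<in> L2" using l2_closure_subset_L2 by blast
  show "f \<in> l2_closure T"
  proof (rule l2_closureI[OF fL])
    fix e :: real assume e: "e > 0"
    obtain g where g: "g \<in> S" "l2_norm (\<lambda>x. f x - g x) < e / 2"
      using l2_closureE[OF f, of "e/2"] e by auto
    then have gL: "g \<in> L2" using assms(1) l2_closure_subset_L2 by blast
    obtain h where h: "h \<in> T" "l2_norm (\<lambda>x. g x - h x) < e / 2"
      using l2_closureE[of g T "e/2"] g assms(1) e by auto
    have "l2_norm (\<lambda>x. f x - h x) < e"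
      using l2_norm_triangle_diff[OF fL gL, of h] h g assms(2) by auto
    then show "\<exists>g\<in>T. l2_norm (\<lambda>x. f x - g x) < e" using h by blast
  qed
qed

lemma l2_closure_limit:
  assumes "\<And>n. F n \<in> l2_closure S" "f \<in> L2" "(\<lambda>n. l2_norm (\<lambda>x. F n x - f x)) \<longlonglongrightarrow> 0" "S \<subseteq> L2"
  shows "f \<in> l2_closure S"
proof -
  have "f \<in> l2_closure (range F)"
  proof (rule l2_closureI[OF assms(2)])
    fix e :: real assume "e > 0"
    from order_tendstoD(2)[OF assms(3) this] obtain n where "l2_norm (\<lambda>x. F n x - f x) < e"
      by (auto simp: eventually_sequentially)
    then show "\<exists>g\<in>range F. l2_norm (\<lambda>x. f x - g x) < e" by (auto simp: l2_norm_minus_commute)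
  qed
  then show ?thesis using l2_closure_minimal[of "range F" S] assms by blast
qed

lemma l2_closure_AE:
  assumes "f \<in> l2_closure S" "S \<subseteq> L2" "AE x in lebesgue. f x = f' x"
  shows "f' \<in> l2_closure S"
proof -
  have f: "f \<in> L2" using assms l2_closure_subset_L2 by blast
  then have f': "f' \<in> L2" using assms(3) by (rule L2_cong_AE)
  show ?thesis
  proof (rule l2_closureI[OF f'])
    fix e :: real assume "e > 0"
    then obtain g where g: "g \<in> S" "l2_norm (\<lambda>x. f x - g x) < e" using l2_closureE assms(1) by blast
    have "l2_norm (\<lambda>x. f' x - g x) = l2_norm (\<lambda>x. f x - g x)"
      using f f' g assms by (intro l2_norm_cong_AE) (auto intro!: L2_measurable L2_diff elim!: eventually_mono)
    then show "\<exists>g\<in>S. l2_norm (\<lambda>x. f' x - g x) < e" using g by (intro bexI[of _ g]) simp_all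
  qed
qed

text \<open>
  Without the closedness demanded by \<open>l2_closed_subspace\<close>: spans and images of spaces under the transform
  are only seen to be subspaces before the closure is taken.
\<close>

definition l2_subspace :: "(real \<Rightarrow> complex) set \<Rightarrow> bool" where
  "l2_subspace V \<longleftrightarrow> V \<subseteq> L2 \<and> (\<lambda>x. 0) \<in> V \<and>
     (\<forall>f\<in>V. \<forall>g\<in>V. (\<lambda>x. f x + g x) \<in> V) \<and> (\<forall>c. \<forall>f\<in>V. (\<lambda>x. c * f x) \<in> V)"

lemma l2_closed_subspace_closure:
  assumes "l2_subspace V" shows "l2_closed_subspace (l2_closure V)"
proof -
  have VL: "V \<subseteq> L2" and V0: "(\<lambda>x. 0) \<in> V"
    and Va: "\<And>f g. f \<in> V \<Longrightarrow> g \<in> V \<Longrightarrow> (\<lambda>x. f x + g x) \<in> V"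
    and Vs: "\<And>c f. f \<in> V \<Longrightarrow> (\<lambda>x. c * f x) \<in> V"
    using assms by (auto simp: l2_subspace_def)
  have add: "(\<lambda>x. f x + g x) \<in> l2_closure V" if f: "f \<in> l2_closure V" and g: "g \<in> l2_closure V" for f g
  proof (rule l2_closureI)
    have L: "f \<in> L2" "g \<in> L2" using f g l2_closure_subset_L2 by auto
    then show "(\<lambda>x. f x + g x) \<in> L2" by (rule L2_add)
    fix e :: real assume e: "e > 0"
    obtain f' where f': "f' \<in> V" "l2_norm (\<lambda>x. f x - f' x) < e / 2"
      using l2_closureE[OF f, of "e/2"] e by auto
    obtain g' where g': "g' \<in> V" "l2_norm (\<lambda>x. g x - g' x) < e / 2"
      using l2_closureE[OF g, of "e/2"] e by auto
    have "l2_norm (\<lambda>x. (f x - f' x) + (g x - g' x)) < e"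
      using l2_norm_triangle[of "\<lambda>x. f x - f' x" "\<lambda>x. g x - g' x"] f' g' L VL L2_diff by fastforce
    then have "l2_norm (\<lambda>x. f x + g x - (f' x + g' x)) < e" by (simp add: algebra_simps)
    then show "\<exists>h\<in>V. l2_norm (\<lambda>x. f x + g x - h x) < e"
      using Va[OF f'(1) g'(1)] by (intro bexI[of _ "\<lambda>x. f' x + g' x"]) auto
  qed
  have scale: "(\<lambda>x. c * f x) \<in> l2_closure V" if f: "f \<in> l2_closure V" for f c
  proof (rule l2_closureI)
    show "(\<lambda>x. c * f x) \<in> L2" using f l2_closure_subset_L2 by (auto intro: L2_scale)
    fix e :: real assume e: "e > 0"
    obtain f' where f': "f' \<in> V" "l2_norm (\<lambda>x. f x - f' x) < e / (cmod c + 1)"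
      using l2_closureE[OF f, of "e / (cmod c + 1)"] e by (auto simp: add_nonneg_pos)
    have "l2_norm (\<lambda>x. c * (f x - f' x)) = cmod c * l2_norm (\<lambda>x. f x - f' x)"
      by (rule l2_norm_scale)
    also have "\<dots> \<le> cmod c * (e / (cmod c + 1))" using f' by (intro mult_left_mono) auto
    also have "\<dots> < e" using e by (simp add: divide_simps add_nonneg_pos)
    finally have "l2_norm (\<lambda>x. c * f x - c * f' x) < e" by (simp add: algebra_simps)
    then show "\<exists>h\<in>V. l2_norm (\<lambda>x. c * f x - h x) < e"
      using Vs[OF f'(1)] by (intro bexI[of _ "\<lambda>x. c * f' x"]) auto
  qed
  have sup: "V \<subseteq> l2_closure V" using VL by (rule l2_closure_superset)
  have "l2_closure (l2_closure V) \<subseteq> l2_closure V" by (rule l2_closure_minimal[OF _ VL]) simp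
  then show ?thesis
    unfolding l2_closed_subspace_def using add scale sup V0 l2_closure_subset_L2 by blast
qed

lemma l2_span_base: "e i \<in> l2_span e"
  unfolding l2_span_def by (intro CollectI exI[of _ "{i}"] exI[of _ "\<lambda>_. 1"]) auto

lemma l2_span_zero: "(\<lambda>x. 0) \<in> l2_span e"
  unfolding l2_span_def by (intro CollectI exI[of _ "{}"]) auto

lemma l2_span_add:
  assumes "f \<in> l2_span e" "g \<in> l2_span e" shows "(\<lambda>x. f x + g x) \<in> l2_span e"
proof -
  obtain I c where f: "finite I" "f = (\<lambda>x. \<Sum>i\<in>I. c i * e i x)" using assms by (auto simp: l2_span_def)
  obtain J d where g: "finite J" "g = (\<lambda>x. \<Sum>i\<in>J. d i * e i x)" using assms by (auto simp: l2_span_def)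
  define a where "a i = (if i \<in> I then c i else 0) + (if i \<in> J then d i else 0)" for i
  have "f x + g x = (\<Sum>i\<in>I \<union> J. a i * e i x)" for x
  proof -
    have "f x = (\<Sum>i\<in>I \<union> J. (if i \<in> I then c i else 0) * e i x)"
      unfolding f by (rule sum.mono_neutral_cong_left) (use f g in auto)
    moreover have "g x = (\<Sum>i\<in>I \<union> J. (if i \<in> J then d i else 0) * e i x)"
      unfolding g by (rule sum.mono_neutral_cong_left) (use f g in auto)
    ultimately show ?thesis by (simp add: a_def distrib_right sum.distrib)
  qed
  then show ?thesis unfolding l2_span_def using f(1) g(1) by (intro CollectI exI[of _ "I \<union> J"] exI[of _ a]) auto
qed

lemma l2_span_scale: assumes "f \<in> l2_span e" shows "(\<lambda>x. c * f x) \<in> l2_span e"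
proof -
  obtain I d where f: "finite I" "f = (\<lambda>x. \<Sum>i\<in>I. d i * e i x)" using assms by (auto simp: l2_span_def)
  then show ?thesis unfolding l2_span_def
    by (intro CollectI exI[of _ I] exI[of _ "\<lambda>i. c * d i"]) (simp add: sum_distrib_left mult.assoc)
qed

lemma l2_span_induct [consumes 1, case_names zero add scale]:
  assumes "f \<in> l2_span e" "P (\<lambda>x. 0)" "\<And>f g. P f \<Longrightarrow> P g \<Longrightarrow> P (\<lambda>x. f x + g x)"
    "\<And>c i. P (\<lambda>x. c * e i x)"
  shows "P f"
proof -
  obtain I c where f: "finite I" "f = (\<lambda>x. \<Sum>i\<in>I. c i * e i x)" using assms by (auto simp: l2_span_def)
  have "P (\<lambda>x. \<Sum>i\<in>I. c i * e i x)" using f(1)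
    by (induction I rule: finite_induct) (auto intro: assms)
  then show ?thesis using f by simp
qed

lemma l2_span_subspace: assumes "\<And>i. e i \<in> L2" shows "l2_subspace (l2_span e)"
proof -
  have "f \<in> L2" if "f \<in> l2_span e" for f
    using that assms by (induction rule: l2_span_induct) (auto intro: L2_add L2_scale)
  then show ?thesis by (auto simp: l2_subspace_def l2_span_zero l2_span_add l2_span_scale)
qed

section \<open>Fourier series on the unit cell\<close>

definition unit_cell :: "real set" where
  "unit_cell = {-1/2..<1/2}"

definition trig :: "int \<Rightarrow> real \<Rightarrow> complex" where
  "trig k x = cis (2 * pi * of_int k * x)"

definition cell_trig :: "int \<Rightarrow> real \<Rightarrow> complex" where
  "cell_trig k x = indicator unit_cell x * trig k x"

lemma unit_cell_sets [measurable, simp]: "unit_cell \<in> sets lebesgue"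
  by (simp add: unit_cell_def)

lemma continuous_on_trig [continuous_intros]: "continuous_on A (trig k)"
  unfolding trig_def cis_conv_exp by (intro continuous_intros)

lemma borel_measurable_cis [measurable (raw)]:
  "f \<in> borel_measurable M \<Longrightarrow> (\<lambda>x. cis (f x)) \<in> borel_measurable M"
  by (rule borel_measurable_continuous_on[of cis]) (auto intro!: continuous_intros simp: cis_conv_exp)

lemma ident_measurable_lebesgue [measurable]: "(\<lambda>x::real. x) \<in> borel_measurable lebesgue"
  by (simp add: measurable_completion)

lemma trig_measurable [measurable]: "trig k \<in> borel_measurable lebesgue"
  unfolding trig_def by measurable

lemma norm_trig [simp]: "cmod (trig k x) = 1"
  by (simp add: trig_def)

lemma trig_add: "trig (j + k) x = trig j x * trig k x"
  by (simp add: trig_def cis_mult algebra_simps)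

lemma trig_periodic: "trig k (x + of_int m) = trig k x"
proof -
  have "trig k (x + of_int m) = trig k x * cis (2 * pi * of_int (k * m))"
    by (simp add: trig_def cis_mult algebra_simps)
  also have "cis (2 * pi * of_int (k * m)) = 1" by (rule cis_multiple_2pi) simp
  finally show ?thesis by simp
qed

lemma L2_bounded_support:
  assumes f [measurable]: "f \<in> borel_measurable lebesgue"
    and "\<And>x. cmod (f x) \<le> B" and "\<And>x. x \<notin> {-M..M} \<Longrightarrow> f x = 0"
  shows "f \<in> L2"
proof (rule L2_dominated[OF f])
  show "integrable lebesgue (\<lambda>x. indicator {-M..M} x * B\<^sup>2)"
    by (intro integrable_mult_left integrable_real_indicator) (auto simp: emeasure_lborel_Icc_eq)
  have "(cmod (f x))\<^sup>2 \<le> indicator {-M..M} x * B\<^sup>2" for x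
    using power_mono[OF assms(2)[of x], of 2] assms(3)[of x] by (auto simp: indicator_def)
  then show "AE x in lebesgue. (cmod (f x))\<^sup>2 \<le> indicator {-M..M} x * B\<^sup>2" by simp
qed

lemma cell_trig_L2 [simp]: "cell_trig k \<in> L2"
  by (rule L2_bounded_support[where B=1 and M=1])
    (auto simp: cell_trig_def[abs_def] indicator_def norm_mult unit_cell_def)

lemma l2_norm_cell_bound:
  assumes f: "f \<in> L2" and "\<And>x. x \<in> unit_cell \<Longrightarrow> cmod (f x) \<le> e"
    and "\<And>x. x \<notin> unit_cell \<Longrightarrow> f x = 0" and e: "0 \<le> e"
  shows "l2_norm f \<le> e"
proof -
  have ind: "(\<lambda>x. complex_of_real (indicator unit_cell x)) \<in> L2"
  proof -
    have "(\<lambda>x. complex_of_real (indicator unit_cell x)) = cell_trig 0"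
      by (auto simp: cell_trig_def trig_def indicator_def)
    then show ?thesis by simp
  qed
  have "l2_norm f \<le> l2_norm (\<lambda>x. of_real e * complex_of_real (indicator unit_cell x))"
    by (rule l2_norm_mono[OF L2_scale[OF ind] f]) (use assms in \<open>auto simp: indicator_def\<close>)
  also have "\<dots> = e * l2_norm (\<lambda>x. complex_of_real (indicator unit_cell x))"
    using e by (subst l2_norm_scale) simp
  also have "l2_norm (\<lambda>x. complex_of_real (indicator unit_cell x)) = 1"
  proof -
    have "(cmod (complex_of_real (indicator unit_cell x)))\<^sup>2 = indicator unit_cell x" for x
      by (simp add: indicator_def)
    then show ?thesis by (simp add: l2_norm_def unit_cell_def)
  qed
  finally show ?thesis by simp
qed

lemma trig_poly_mult:
  assumes "p \<in> l2_span trig" "q \<in> l2_span trig" shows "(\<lambda>x. p x * q x) \<in> l2_span trig"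
  using assms(1)
proof (induction rule: l2_span_induct)
  case (scale c i)
  show ?case using assms(2)
  proof (induction rule: l2_span_induct)
    case (scale d j)
    have "(\<lambda>x. c * trig i x * (d * trig j x)) = (\<lambda>x. (c * d) * trig (i + j) x)"
      by (simp add: trig_add fun_eq_iff)
    then show ?case by (simp add: l2_span_base l2_span_scale)
  qed (auto simp: distrib_left intro: l2_span_zero l2_span_add)
qed (auto simp: distrib_right intro: l2_span_zero l2_span_add)

lemma trig_poly_const: "(\<lambda>x. c) \<in> l2_span trig"
proof -
  have "(\<lambda>x. c * trig 0 x) \<in> l2_span trig" by (intro l2_span_base l2_span_scale)
  then show ?thesis by (simp add: trig_def)
qed

text \<open>
  On the circle the coordinates are combinations of \<open>trig 1\<close> and \<open>trig (-1)\<close>, and trigonometric polynomials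
  are closed under products.
\<close>

lemma real_polynomial_trig:
  assumes "real_polynomial_function (q :: complex \<Rightarrow> real)"
  shows "(\<lambda>x. complex_of_real (q (cis (2 * pi * x)))) \<in> l2_span trig"
  using assms
proof (induction rule: real_polynomial_function.induct)
  case (linear f)
  interpret bounded_linear f by fact
  have "complex_of_real (f (cis (2 * pi * x))) =
      ((of_real (f 1) - \<i> * of_real (f \<i>)) / 2) * trig 1 x + ((of_real (f 1) + \<i> * of_real (f \<i>)) / 2) * trig (-1) x" for x
  proof -
    have c: "cis (2 * pi * x) = cos (2 * pi * x) *\<^sub>R 1 + sin (2 * pi * x) *\<^sub>R \<i>"
      by (simp add: complex_eq_iff)
    have "f (cis (2 * pi * x)) = cos (2 * pi * x) * f 1 + sin (2 * pi * x) * f \<i>"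
      unfolding c by (simp only: add scaleR real_scaleR_def)
    then show ?thesis by (simp add: complex_eq_iff trig_def field_simps)
  qed
  then show ?case
    by (simp only:) (intro l2_span_add l2_span_scale l2_span_base)
next
  case (const c)
  then show ?case by (rule trig_poly_const)
next
  case (add f g)
  then show ?case by (simp add: l2_span_add)
next
  case (mult f g)
  then show ?case by (simp add: trig_poly_mult)
qed

text \<open>
  A function with equal values at both ends is a function on the unit circle, a compact subset of the
  plane, where the Stone-Weierstrass theorem supplies polynomials in the two real coordinates.
\<close>

lemma trig_uniform_approximation:
  fixes g :: "real \<Rightarrow> complex"
  assumes g: "continuous_on {-1/2..1/2} g" and g_end: "g (-1/2) = g (1/2)" and e: "e > 0"
  shows "\<exists>p\<in>l2_span trig. \<forall>x\<in>{-1/2..1/2}. cmod (g x - p x) < e"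
proof -
  define F where "F z = g (Arg z / (2 * pi))" for z
  define circle where "circle x = cis (2 * pi * x)" for x
  have F: "F (circle x) = g x" if x: "x \<in> {-1/2..1/2}" for x
  proof (cases "x = -1/2")
    case True
    have "circle x = cis pi" unfolding circle_def True by (simp add: complex_eq_iff)
    then have "Arg (circle x) = pi" using Arg_cis[of pi] by simp
    then show ?thesis using True g_end by (simp add: F_def)
  next
    case False
    then have "- 1 < 2 * x" "2 * x \<le> 1" using x by auto
    then have "pi * (-1) < pi * (2 * x)" "pi * (2 * x) \<le> pi * 1"
      by (intro mult_strict_left_mono mult_left_mono; simp)+
    then have "Arg (circle x) = 2 * pi * x" unfolding circle_def
      by (intro Arg_cis) (auto simp: mult_ac)
    then show ?thesis by (simp add: F_def)
  qed
  have circ: "sphere 0 1 = circle ` {-1/2..1/2}"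
  proof (intro equalityI subsetI)
    fix z :: complex assume z: "z \<in> sphere 0 1"
    then have "cis (Arg z) = sgn z" by (intro cis_Arg) auto
    also have "sgn z = z" using z by (simp add: sgn_div_norm)
    finally have "z = circle (Arg z / (2 * pi))" by (simp add: circle_def)
    moreover have "Arg z / (2 * pi) \<in> {-1/2..1/2}"
      using Arg_bounded[of z] by (auto simp: field_simps)
    ultimately show "z \<in> circle ` {-1/2..1/2}" by blast
  qed (auto simp: circle_def)
  have cc: "continuous_on A circle" for A
    unfolding circle_def cis_conv_exp by (intro continuous_intros)
  \<comment> \<open>The parametrisation of the circle is a closed map, so continuity descends along it.\<close>
  have "continuous_on (sphere 0 1) F"
    unfolding continuous_on_closed_vimage[OF closed_sphere]
  proof (intro allI impI)
    fix B :: "complex set" assume "closed B"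
    then have "closed (g -` B \<inter> {-1/2..1/2})"
      using g continuous_on_closed_vimage[of "{-1/2..1/2}" g] by auto
    then have "compact (g -` B \<inter> {-1/2..1/2})"
      by (metis compact_Icc closed_Int_compact Int_assoc Int_absorb)
    then have "compact (circle ` (g -` B \<inter> {-1/2..1/2}))"
      by (intro compact_continuous_image cc)
    moreover have "F -` B \<inter> sphere 0 1 = circle ` (g -` B \<inter> {-1/2..1/2})"
      unfolding circ using F by auto
    ultimately show "closed (F -` B \<inter> sphere 0 1)" by (simp add: compact_imp_closed)
  qed
  then obtain q where q: "polynomial_function q" "\<forall>z\<in>sphere 0 1. cmod (F z - q z) < e"
    using Stone_Weierstrass_polynomial_function[of "sphere 0 1" F e] e by auto
  have "real_polynomial_function (Re \<circ> q)" "real_polynomial_function (Im \<circ> q)"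
    using q(1) bounded_linear_Re bounded_linear_Im unfolding polynomial_function_def by blast+
  from this[THEN real_polynomial_trig]
  have "(\<lambda>x. of_real (Re (q (circle x))) + \<i> * of_real (Im (q (circle x)))) \<in> l2_span trig"
    unfolding circle_def comp_def by (intro l2_span_add l2_span_scale)
  then have "(\<lambda>x. q (circle x)) \<in> l2_span trig" by (simp flip: complex_eq)
  moreover have "cmod (g x - q (circle x)) < e" if "x \<in> {-1/2..1/2}" for x
    using q(2) F[OF that] circ that by force
  ultimately show ?thesis by (intro bexI[of _ "\<lambda>x. q (circle x)"] ballI)
qed

lemma cell_trig_span:
  assumes "p \<in> l2_span trig" shows "(\<lambda>x. indicator unit_cell x * p x) \<in> l2_span cell_trig"
  using assms
proof (induction rule: l2_span_induct)
  case (scale c i)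
  have "(\<lambda>x. indicator unit_cell x * (c * trig i x)) = (\<lambda>x. c * cell_trig i x)"
    by (simp add: cell_trig_def fun_eq_iff)
  then show ?case by (simp add: l2_span_base l2_span_scale)
qed (auto simp: distrib_left intro: l2_span_zero l2_span_add)

lemma cell_trig_span_L2: "l2_span cell_trig \<subseteq> L2"
  using l2_span_subspace[of cell_trig] by (simp add: l2_subspace_def)

lemma cell_bounded_L2:
  assumes [measurable]: "h \<in> borel_measurable lebesgue" and "\<And>x. cmod (h x) \<le> B"
  shows "(\<lambda>x. indicator unit_cell x * h x) \<in> L2"
  by (rule L2_bounded_support[where B=B and M=1])
    (use assms order_trans[OF norm_ge_zero assms(2)] in \<open>auto simp: indicator_def unit_cell_def\<close>)

lemma cell_dominated_convergence:
  assumes [measurable]: "h \<in> borel_measurable lebesgue" "\<And>n. F n \<in> borel_measurable lebesgue"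
    and "\<And>x. cmod (h x) \<le> B" "\<And>n x. cmod (F n x) \<le> B"
    and lim: "AE x in lebesgue. x \<in> unit_cell \<longrightarrow> (\<lambda>n. F n x) \<longlonglongrightarrow> h x"
  shows "(\<lambda>n. l2_norm (\<lambda>x. indicator unit_cell x * F n x - indicator unit_cell x * h x)) \<longlonglongrightarrow> 0"
proof (rule l2_dominated_convergence[where w="\<lambda>x. indicator unit_cell x * (2 * B)\<^sup>2"])
  show "integrable lebesgue (\<lambda>x. indicator unit_cell x * (2 * B)\<^sup>2)"
    by (intro integrable_mult_left integrable_real_indicator) (auto simp: unit_cell_def)
  have "cmod (F n x - h x) \<le> 2 * B" for n x
    using norm_triangle_ineq4[of "F n x" "h x"] assms(3)[of x] assms(4)[of n x] by linarith
  then show "AE x in lebesgue. (cmod (indicator unit_cell x * F n x - indicator unit_cell x * h x))\<^sup>2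
      \<le> indicator unit_cell x * (2 * B)\<^sup>2" for n
    using power_mono[OF _ norm_ge_zero, of "F n x - h x" "2 * B" 2 for x]
    by (intro AE_I2) (auto simp: indicator_def)
  show "AE x in lebesgue. (\<lambda>n. indicator unit_cell x * F n x) \<longlonglongrightarrow> indicator unit_cell x * h x"
    using lim by eventually_elim (auto simp: indicator_def)
qed simp_all

text \<open>
  Agreement at the two ends of the cell can be forced at small cost in the mean, by multiplying with a
  cutoff that vanishes at both ends.
\<close>

lemma continuous_in_trig_closure:
  fixes g :: "real \<Rightarrow> complex"
  assumes g: "continuous_on UNIV g" and B: "\<And>x. cmod (g x) \<le> B"
  shows "(\<lambda>x. indicator unit_cell x * g x) \<in> l2_closure (l2_span cell_trig)"
proof -
  define c :: "nat \<Rightarrow> real \<Rightarrow> real" where "c n x = max 0 (min 1 (real n * (1/2 - \<bar>x\<bar>)))" for n x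
  have [measurable]: "g \<in> borel_measurable lebesgue"
    using g by (simp add: borel_measurable_continuous_onI measurable_completion)
  have cn: "continuous_on UNIV (c n)" for n unfolding c_def by (intro continuous_intros)
  have [measurable]: "c n \<in> borel_measurable lebesgue" for n
    using cn by (simp add: borel_measurable_continuous_onI measurable_completion)
  have bnd: "cmod (of_real (c n x) * g x) \<le> B" for n x
  proof -
    have "cmod (of_real (c n x) * g x) \<le> 1 * cmod (g x)"
      unfolding norm_mult by (intro mult_right_mono) (auto simp: c_def)
    then show ?thesis using B[of x] by simp
  qed
  have in_closure: "(\<lambda>x. indicator unit_cell x * (of_real (c n x) * g x)) \<in> l2_closure (l2_span cell_trig)" for n
  proof (rule l2_closureI)
    show L: "(\<lambda>x. indicator unit_cell x * (of_real (c n x) * g x)) \<in> L2"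
      by (rule cell_bounded_L2[OF _ bnd]) measurable
    fix e :: real assume e: "e > 0"
    have "continuous_on {-1/2..1/2} (\<lambda>x. of_real (c n x) * g x)"
      using g cn by (intro continuous_intros) (auto intro: continuous_on_subset)
    from trig_uniform_approximation[OF this, of "e/2"] e
    obtain p where p: "p \<in> l2_span trig"
        "\<And>x. x \<in> {-1/2..1/2} \<Longrightarrow> cmod (of_real (c n x) * g x - p x) < e / 2"
      by (auto simp: c_def)
    define P where "P x = indicator unit_cell x * p x" for x
    have P: "P \<in> l2_span cell_trig" unfolding P_def[abs_def] using p(1) by (rule cell_trig_span)
    have "l2_norm (\<lambda>x. indicator unit_cell x * (of_real (c n x) * g x) - P x) \<le> e / 2"
    proof (rule l2_norm_cell_bound)
      show "(\<lambda>x. indicator unit_cell x * (of_real (c n x) * g x) - P x) \<in> L2"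
        using P cell_trig_span_L2 L by (intro L2_diff) auto
      show "cmod (indicator unit_cell x * (of_real (c n x) * g x) - P x) \<le> e / 2" if "x \<in> unit_cell" for x
        using p(2)[of x] that by (auto simp: P_def unit_cell_def)
    qed (use e in \<open>auto simp: P_def\<close>)
    then show "\<exists>g'\<in>l2_span cell_trig. l2_norm (\<lambda>x. indicator unit_cell x * (of_real (c n x) * g x) - g' x) < e"
      using P e by (intro bexI[of _ P]) auto
  qed
  have lim: "(\<lambda>n. of_real (c n x) * g x) \<longlonglongrightarrow> g x" if "x \<in> unit_cell" "x \<noteq> -1/2" for x
  proof -
    have x: "1/2 - \<bar>x\<bar> > 0" using that by (auto simp: unit_cell_def)
    obtain N :: nat where N: "1 < real N * (1/2 - \<bar>x\<bar>)" using x reals_Archimedean3 by blast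
    have "c n x = 1" if "n \<ge> N" for n
    proof -
      have "real N * (1/2 - \<bar>x\<bar>) \<le> real n * (1/2 - \<bar>x\<bar>)" using that x by (intro mult_right_mono) auto
      then show ?thesis using N by (simp add: c_def)
    qed
    then have "\<forall>\<^sub>F n in sequentially. of_real (c n x) * g x = g x"
      by (auto simp: eventually_sequentially intro!: exI[of _ N])
    then show ?thesis by (rule tendsto_eventually)
  qed
  show ?thesis
  proof (rule l2_closure_limit[OF in_closure])
    show "(\<lambda>x. indicator unit_cell x * g x) \<in> L2" by (rule cell_bounded_L2[OF _ B]) simp
    show "(\<lambda>n. l2_norm (\<lambda>x. indicator unit_cell x * (of_real (c n x) * g x) - indicator unit_cell x * g x)) \<longlonglongrightarrow> 0"
    proof (rule cell_dominated_convergence[OF _ _ B bnd])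
      have "AE x in lebesgue. x \<noteq> (-1/2::real)"
        by (rule AE_completion) (rule AE_lborel_singleton)
      then show "AE x in lebesgue. x \<in> unit_cell \<longrightarrow> (\<lambda>n. of_real (c n x) * g x) \<longlonglongrightarrow> g x"
        by eventually_elim (use lim in auto)
    qed measurable
  qed (rule cell_trig_span_L2)
qed

text \<open>
  A bounded measurable function is the almost everywhere limit of equally bounded continuous
  functions, and a square-integrable function is the limit of its truncations in modulus. Both
  limits hold in the mean by dominated convergence.
\<close>

lemma cell_trig_dense:
  assumes h: "h \<in> L2" and supp: "\<And>x. x \<notin> unit_cell \<Longrightarrow> h x = 0"
  shows "h \<in> l2_closure (l2_span cell_trig)"
proof -
  define clip :: "real \<Rightarrow> complex \<Rightarrow> complex" where "clip B z = closest_point (cball 0 B) z" for B z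
  have clip_cont: "continuous_on UNIV (clip B)" if "B \<ge> 0" for B
    unfolding clip_def[abs_def] using that by (intro continuous_on_closest_point) auto
  have clip_le: "cmod (clip B z) \<le> B" if "B \<ge> 0" for B z
    using closest_point_in_set[of "cball 0 B" z] that by (simp add: clip_def)
  have clip_id: "clip B z = z" if "cmod z \<le> B" for B z
    using that by (simp add: clip_def closest_point_self)
  have clip_dist: "cmod (clip B z - z) \<le> cmod z" if "B \<ge> 0" for B z
    using closest_point_le[of "cball 0 B" 0 z] that by (simp add: clip_def dist_norm norm_minus_commute)
  have [measurable]: "h \<in> borel_measurable lebesgue" using h by (rule L2_measurable)
  have hn [measurable]: "(\<lambda>x. clip (real n) (h x)) \<in> borel_measurable lebesgue" for n
    by (rule borel_measurable_continuous_on[OF clip_cont]) auto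
  have in_closure: "(\<lambda>x. indicator unit_cell x * clip (real n) (h x)) \<in> l2_closure (l2_span cell_trig)" for n
  proof -
    have "(\<lambda>x. clip (real n) (h x)) measurable_on UNIV"
      by (rule lebesgue_measurable_imp_measurable_on) auto
    then obtain N g where N: "negligible N" and g: "\<And>k. continuous_on UNIV (g k)"
      and lim: "\<And>x. x \<notin> N \<Longrightarrow> (\<lambda>k. g k x) \<longlonglongrightarrow> clip (real n) (h x)"
      unfolding measurable_on_def by auto
    have gc: "continuous_on UNIV (\<lambda>x. clip (real n) (g k x))" for k
      using continuous_on_compose2[OF clip_cont g] by simp
    show ?thesis
    proof (rule l2_closure_limit)
      show "(\<lambda>x. indicator unit_cell x * clip (real n) (g k x)) \<in> l2_closure (l2_span cell_trig)" for k
        by (rule continuous_in_trig_closure[OF gc clip_le]) simp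
      show "(\<lambda>x. indicator unit_cell x * clip (real n) (h x)) \<in> L2"
        by (rule cell_bounded_L2[OF hn clip_le]) simp
      show "(\<lambda>k. l2_norm (\<lambda>x. indicator unit_cell x * clip (real n) (g k x)
          - indicator unit_cell x * clip (real n) (h x))) \<longlonglongrightarrow> 0"
      proof (rule cell_dominated_convergence[where B="real n"])
        show "(\<lambda>x. clip (real n) (g k x)) \<in> borel_measurable lebesgue" for k
          using gc by (simp add: borel_measurable_continuous_onI measurable_completion)
        have "AE x in lebesgue. x \<notin> N"
          using N by (auto simp: negligible_iff_null_sets intro: AE_not_in)
        then show "AE x in lebesgue. x \<in> unit_cell \<longrightarrow>
            (\<lambda>k. clip (real n) (g k x)) \<longlonglongrightarrow> clip (real n) (h x)"
        proof eventually_elim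
          case (elim x)
          have "isCont (clip (real n)) (clip (real n) (h x))"
            using clip_cont[of "real n"] by (simp add: continuous_on_eq_continuous_at)
          from isCont_tendsto_compose[OF this lim[OF elim]]
          show ?case by (simp add: clip_id clip_le)
        qed
      qed (auto simp: clip_le)
    qed (rule cell_trig_span_L2)
  qed
  show ?thesis
  proof (rule l2_closure_limit[OF in_closure h _ cell_trig_span_L2])
    show "(\<lambda>n. l2_norm (\<lambda>x. indicator unit_cell x * clip (real n) (h x) - h x)) \<longlonglongrightarrow> 0"
    proof (rule l2_dominated_convergence[OF _ _ L2_integrable[OF h]])
      have "cmod (indicator unit_cell x * clip (real n) (h x) - h x) \<le> cmod (h x)" for n x
        using clip_dist[of "real n" "h x"] supp[of x] by (auto simp: indicator_def)
      then show "AE x in lebesgue. (cmod (indicator unit_cell x * clip (real n) (h x) - h x))\<^sup>2 \<le> (cmod (h x))\<^sup>2" for n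
        by (intro AE_I2 power_mono) auto
      show "AE x in lebesgue. (\<lambda>n. indicator unit_cell x * clip (real n) (h x)) \<longlonglongrightarrow> h x"
      proof (rule AE_I2)
        fix x
        obtain N :: nat where "cmod (h x) \<le> real N" using real_arch_simple by blast
        then have "indicator unit_cell x * clip (real n) (h x) = h x" if "n \<ge> N" for n
          using that supp[of x] by (auto simp: indicator_def clip_id)
        then have "\<forall>\<^sub>F n in sequentially. indicator unit_cell x * clip (real n) (h x) = h x"
          by (auto simp: eventually_sequentially intro!: exI[of _ N])
        then show "(\<lambda>n. indicator unit_cell x * clip (real n) (h x)) \<longlonglongrightarrow> h x"
          by (rule tendsto_eventually)
      qed
    qed auto
  qed
qed

lemma integral_cell_trig: "(LINT x|lebesgue. cell_trig k x) = (if k = 0 then 1 else 0)"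
proof -
  have "(LINT x|lebesgue. cell_trig k x) = (LINT x|lebesgue. indicator {-1/2..1/2} x *\<^sub>R trig k x)"
  proof (rule integral_cong_AE)
    have "AE x in lebesgue. x \<noteq> (1/2::real)" by (rule AE_completion) (rule AE_lborel_singleton)
    then show "AE x in lebesgue. cell_trig k x = indicator {-1/2..1/2} x *\<^sub>R trig k x"
      by eventually_elim (auto simp: cell_trig_def unit_cell_def indicator_def)
    show "(\<lambda>x. indicator {-1/2..1/2} x *\<^sub>R trig k x) \<in> borel_measurable lebesgue" by measurable
  qed (simp add: L2_measurable)
  also have "\<dots> = (LINT x|lborel. indicator {-1/2..1/2} x *\<^sub>R trig k x)"
  proof (rule integral_completion)
    have "trig k \<in> borel_measurable borel"
      by (intro borel_measurable_continuous_onI continuous_intros)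
    then show "(\<lambda>x. indicator {-1/2..1/2} x *\<^sub>R trig k x) \<in> borel_measurable lborel"
      by (intro borel_measurable_scaleR borel_measurable_indicator) auto
  qed
  also have "\<dots> = (if k = 0 then 1 else 0)"
  proof (cases "k = 0")
    case True
    then show ?thesis by (simp add: trig_def)
  next
    case False
    define c where "c = 2 * pi * of_int k * \<i>"
    define G where "G x = trig k x / c" for x
    have c: "c \<noteq> 0" using False by (simp add: c_def)
    have trig_exp: "trig k = (\<lambda>x. exp (c * of_real x))"
      unfolding trig_def cis_conv_exp c_def by (intro ext arg_cong[where f=exp]) (simp add: mult_ac)
    have "has_bochner_integral lborel (\<lambda>x. indicator {-1/2..1/2} x *\<^sub>R trig k x) (G (1/2) - G (-1/2))"
    proof (rule has_bochner_integral_FTC_Icc)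
      have "((\<lambda>z. exp (c * z) / c) has_field_derivative exp (c * of_real x)) (at (of_real x))" for x :: real
        by (rule derivative_eq_intros refl c | simp add: c)+
      then have "((\<lambda>x. exp (c * of_real x) / c) has_vector_derivative exp (c * of_real x)) (at x within {-1/2..1/2})" for x
        by (rule has_vector_derivative_real_field)
      then show "(G has_vector_derivative trig k x) (at x within {-1/2..1/2})" for x
        by (simp only: G_def[abs_def] trig_exp)
    qed (auto intro!: continuous_intros)
    moreover have "G (1/2) = G (-1/2)" using trig_periodic[of k "-1/2" 1] by (simp add: G_def)
    ultimately show ?thesis using False by (simp add: has_bochner_integral_iff)
  qed
  finally show ?thesis .
qed

lemma trig_cnj: "cnj (trig k x) = trig (- k) x"
  by (simp add: trig_def cis_cnj)

lemma cell_trig_orthonormal: "l2_inner (cell_trig j) (cell_trig k) = (if j = k then 1 else 0)"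
proof -
  have "cell_trig j x * cnj (cell_trig k x) = cell_trig (j - k) x" for x
    using trig_add[of j "-k" x] by (auto simp: cell_trig_def indicator_def trig_cnj)
  then show ?thesis by (simp add: l2_inner_def integral_cell_trig)
qed

text \<open>
  Only the last term on the right involves the coefficients \<open>d\<close>. Choosing them so that it vanishes gives
  Bessel's inequality; estimating it below by \<open>0\<close> gives the best approximation property.
\<close>

lemma orthonormal_expansion_distance:
  assumes e: "\<And>i. i \<in> I \<Longrightarrow> e i \<in> L2" and I: "finite I" and f: "f \<in> L2"
    and on: "\<And>i j. i \<in> I \<Longrightarrow> j \<in> I \<Longrightarrow> l2_inner (e i) (e j) = (if i = j then 1 else 0)"
  shows "(l2_norm (\<lambda>x. f x - (\<Sum>i\<in>I. d i * e i x)))\<^sup>2 =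
    (l2_norm f)\<^sup>2 - (\<Sum>i\<in>I. (cmod (l2_inner f (e i)))\<^sup>2) + (\<Sum>i\<in>I. (cmod (d i - l2_inner f (e i)))\<^sup>2)"
proof -
  define p where "p x = (\<Sum>i\<in>I. d i * e i x)" for x
  have pL: "p \<in> L2" unfolding p_def[abs_def] using I e by (intro L2_sum L2_scale)
  have pe: "l2_inner p (e j) = d j" if "j \<in> I" for j
  proof -
    have "l2_inner p (e j) = (\<Sum>i\<in>I. d i * l2_inner (e i) (e j))"
      unfolding p_def[abs_def] using I e that
      by (subst l2_inner_sum_left) (auto intro: L2_scale simp: l2_inner_scale_left)
    also have "\<dots> = (\<Sum>i\<in>I. if i = j then d i else 0)" using on that by (intro sum.cong) auto
    finally show ?thesis using that I by simp
  qed
  have inner_p: "l2_inner g p = (\<Sum>i\<in>I. cnj (d i) * l2_inner g (e i))" if "g \<in> L2" for g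
    unfolding p_def[abs_def] using I e that
    by (subst l2_inner_sum_right) (auto intro: L2_scale simp: l2_inner_scale_right)
  have "complex_of_real ((l2_norm p)\<^sup>2) = (\<Sum>i\<in>I. cnj (d i) * d i)"
    unfolding l2_inner_self[symmetric] inner_p[OF pL] using pe by simp
  also have "\<dots> = of_real (\<Sum>i\<in>I. (cmod (d i))\<^sup>2)"
    by (simp add: complex_norm_square mult.commute del: of_real_power)
  finally have np: "(l2_norm p)\<^sup>2 = (\<Sum>i\<in>I. (cmod (d i))\<^sup>2)" by (simp only: of_real_eq_iff)
  have "(l2_norm (\<lambda>x. f x - p x))\<^sup>2 = (l2_norm f)\<^sup>2
      + (\<Sum>i\<in>I. (cmod (d i))\<^sup>2 - 2 * Re (cnj (d i) * l2_inner f (e i)))"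
    unfolding l2_norm_diff_sq[OF f pL] np inner_p[OF f]
    by (simp add: sum_subtractf sum_distrib_left)
  also have "(\<Sum>i\<in>I. (cmod (d i))\<^sup>2 - 2 * Re (cnj (d i) * l2_inner f (e i)))
      = (\<Sum>i\<in>I. (cmod (d i - l2_inner f (e i)))\<^sup>2 - (cmod (l2_inner f (e i)))\<^sup>2)"
    by (intro sum.cong refl) (simp only: cmod_power2, simp add: power2_eq_square algebra_simps)
  finally show ?thesis by (simp add: p_def sum_subtractf)
qed

lemma Bessel_cell: assumes "h \<in> L2" "finite I"
  shows "(\<Sum>k\<in>I. (cmod (l2_inner h (cell_trig k)))\<^sup>2) \<le> (l2_norm h)\<^sup>2"
  using orthonormal_expansion_distance[of I cell_trig h "\<lambda>k. l2_inner h (cell_trig k)"] assms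
    zero_le_power2[of "l2_norm (\<lambda>x. h x - (\<Sum>k\<in>I. l2_inner h (cell_trig k) * cell_trig k x))"]
  by (simp add: cell_trig_orthonormal)

text \<open>
  The partial sums are bounded by Bessel's inequality. From below, an approximating trigonometric
  polynomial is eventually a competitor of the partial Fourier sum, which is at least as close to \<open>h\<close>.
\<close>

lemma Parseval_cell:
  assumes h: "h \<in> L2" and supp: "\<And>x. x \<notin> unit_cell \<Longrightarrow> h x = 0"
  shows "(\<lambda>N. \<Sum>k\<in>{- int N..int N}. (cmod (l2_inner h (cell_trig k)))\<^sup>2) \<longlonglongrightarrow> (l2_norm h)\<^sup>2"
proof (rule LIMSEQ_I)
  fix r :: real assume r: "r > 0"
  obtain p where p: "p \<in> l2_span cell_trig" "l2_norm (\<lambda>x. h x - p x) < sqrt r"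
    using l2_closureE[OF cell_trig_dense[OF assms], of "sqrt r"] r by auto
  obtain I c where I: "finite I" "p = (\<lambda>x. \<Sum>i\<in>I. c i * cell_trig i x)"
    using p(1) by (auto simp: l2_span_def)
  obtain M where M: "I \<subseteq> {- int M..int M}"
  proof -
    have "finite ((\<lambda>i. nat \<bar>i\<bar>) ` I)" using I by simp
    then obtain M where "\<forall>m\<in>(\<lambda>i. nat \<bar>i\<bar>) ` I. m \<le> M" using finite_nat_set_iff_bounded_le by blast
    then have "I \<subseteq> {- int M..int M}" by force
    then show thesis by (rule that)
  qed
  have "norm ((\<Sum>k\<in>{- int N..int N}. (cmod (l2_inner h (cell_trig k)))\<^sup>2) - (l2_norm h)\<^sup>2) < r" if N: "N \<ge> M" for N
  proof -
    let ?J = "{- int N..int N}" and ?c = "\<lambda>i. if i \<in> I then c i else 0"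
    have "p x = (\<Sum>i\<in>?J. ?c i * cell_trig i x)" for x
      unfolding I(2) by (rule sum.mono_neutral_cong_left) (use M N in auto)
    then have "(l2_norm h)\<^sup>2 - (\<Sum>k\<in>?J. (cmod (l2_inner h (cell_trig k)))\<^sup>2)
        + (\<Sum>i\<in>?J. (cmod (?c i - l2_inner h (cell_trig i)))\<^sup>2) = (l2_norm (\<lambda>x. h x - p x))\<^sup>2"
      using orthonormal_expansion_distance[of ?J cell_trig h ?c] h by (simp add: cell_trig_orthonormal)
    moreover have "0 \<le> (\<Sum>i\<in>?J. (cmod (?c i - l2_inner h (cell_trig i)))\<^sup>2)" by (intro sum_nonneg) auto
    moreover have "(l2_norm (\<lambda>x. h x - p x))\<^sup>2 < r"
      using p(2) r power_strict_mono[OF p(2), of 2] by simp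
    ultimately show ?thesis using Bessel_cell[OF h, of ?J] by simp
  qed
  then show "\<exists>M. \<forall>N\<ge>M. norm ((\<Sum>k\<in>{- int N..int N}. (cmod (l2_inner h (cell_trig k)))\<^sup>2) - (l2_norm h)\<^sup>2) < r"
    by blast
qed

section \<open>The inverse Fourier transform on functions of bounded support\<close>

text \<open>
  On these functions the inverse transform is an absolutely convergent integral. They are dense in \<open>L\<^sup>2\<close>, and
  all transforms needed for a bounded wavelet set belong to them.
\<close>

definition L2c :: "(real \<Rightarrow> complex) set" where
  "L2c = {h \<in> L2. \<exists>M. \<forall>\<xi>. h \<xi> \<noteq> 0 \<longrightarrow> \<bar>\<xi>\<bar> \<le> M}"

definition inv_fourier :: "(real \<Rightarrow> complex) \<Rightarrow> real \<Rightarrow> complex" where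
  "inv_fourier h x = (LINT \<xi>|lebesgue. h \<xi> * cis (2 * pi * x * \<xi>))"

lemma L2c_L2: "h \<in> L2c \<Longrightarrow> h \<in> L2"
  by (simp add: L2c_def)

lemma L2cI: "h \<in> L2 \<Longrightarrow> (\<And>\<xi>. h \<xi> \<noteq> 0 \<Longrightarrow> \<bar>\<xi>\<bar> \<le> M) \<Longrightarrow> h \<in> L2c"
  by (auto simp: L2c_def)

lemma L2cE:
  assumes "h \<in> L2c" obtains M where "M > 0" "\<And>\<xi>. h \<xi> \<noteq> 0 \<Longrightarrow> \<bar>\<xi>\<bar> \<le> M"
proof -
  obtain M where "\<And>\<xi>. h \<xi> \<noteq> 0 \<Longrightarrow> \<bar>\<xi>\<bar> \<le> M" using assms by (auto simp: L2c_def)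
  then show thesis by (intro that[of "max M 1"]) fastforce+
qed

lemma L2c_zero: "(\<lambda>x. 0) \<in> L2c"
  by (simp add: L2c_def)

lemma L2c_add: assumes "f \<in> L2c" "g \<in> L2c" shows "(\<lambda>x. f x + g x) \<in> L2c"
proof -
  obtain M where M: "\<And>\<xi>. f \<xi> \<noteq> 0 \<Longrightarrow> \<bar>\<xi>\<bar> \<le> M" using L2cE[OF assms(1)] by metis
  obtain M' where M': "\<And>\<xi>. g \<xi> \<noteq> 0 \<Longrightarrow> \<bar>\<xi>\<bar> \<le> M'" using L2cE[OF assms(2)] by metis
  have "\<bar>\<xi>\<bar> \<le> max M M'" if "f \<xi> + g \<xi> \<noteq> 0" for \<xi>
    using M[of \<xi>] M'[of \<xi>] that by (cases "f \<xi> = 0") auto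
  then show ?thesis using assms by (intro L2cI L2_add) (auto dest: L2c_L2)
qed

lemma L2c_subset:
  assumes "f \<in> L2c" "g \<in> L2" "\<And>x. g x \<noteq> 0 \<Longrightarrow> f x \<noteq> 0" shows "g \<in> L2c"
  using assms unfolding L2c_def by blast

lemma L2c_scale: "f \<in> L2c \<Longrightarrow> (\<lambda>x. c * f x) \<in> L2c"
  by (rule L2c_subset) (auto intro: L2_scale L2c_L2)

lemma L2c_diff: "f \<in> L2c \<Longrightarrow> g \<in> L2c \<Longrightarrow> (\<lambda>x. f x - g x) \<in> L2c"
  using L2c_add[of f "\<lambda>x. -1 * g x"] L2c_scale[of g "-1"] by simp

lemma L2c_integrable: assumes "h \<in> L2c" shows "integrable lebesgue h"
proof -
  obtain M where M: "\<And>\<xi>. h \<xi> \<noteq> 0 \<Longrightarrow> \<bar>\<xi>\<bar> \<le> M" using L2cE[OF assms] by metis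
  have [measurable]: "h \<in> borel_measurable lebesgue" using assms by (auto intro: L2_measurable L2c_L2)
  show ?thesis
  proof (rule Bochner_Integration.integrable_bound)
    show "integrable lebesgue (\<lambda>x. indicator {-M..M} x + (cmod (h x))\<^sup>2)"
      using L2_integrable[OF L2c_L2[OF assms]]
      by (intro Bochner_Integration.integrable_add integrable_real_indicator) (auto simp: emeasure_lborel_Icc_eq)
    have "cmod (h x) \<le> indicator {-M..M} x + (cmod (h x))\<^sup>2" for x
    proof (cases "h x = 0")
      case False
      have "2 * cmod (h x) \<le> 1 + (cmod (h x))\<^sup>2"
        using zero_le_power2[of "cmod (h x) - 1"] by (simp add: power2_eq_square algebra_simps)
      then have "cmod (h x) \<le> 1 + (cmod (h x))\<^sup>2" using norm_ge_zero[of "h x"] by linarith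
      then show ?thesis using M[OF False] by (auto simp: indicator_def abs_le_iff)
    qed simp
    then show "AE x in lebesgue. cmod (h x) \<le> norm (indicator {-M..M} x + (cmod (h x))\<^sup>2)"
      by (intro AE_I2) (simp add: indicator_def)
  qed simp
qed

lemma inv_fourier_integrable:
  assumes "h \<in> L2c" shows "integrable lebesgue (\<lambda>\<xi>. h \<xi> * cis (2 * pi * x * \<xi>))"
proof (rule Bochner_Integration.integrable_bound[OF integrable_norm[OF L2c_integrable[OF assms]]])
  have [measurable]: "h \<in> borel_measurable lebesgue" using assms by (auto intro: L2_measurable L2c_L2)
  show "(\<lambda>\<xi>. h \<xi> * cis (2 * pi * x * \<xi>)) \<in> borel_measurable lebesgue" by measurable
qed (simp add: norm_mult)

lemma inv_fourier_add:
  "f \<in> L2c \<Longrightarrow> g \<in> L2c \<Longrightarrow> inv_fourier (\<lambda>\<xi>. f \<xi> + g \<xi>) x = inv_fourier f x + inv_fourier g x"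
  unfolding inv_fourier_def by (simp add: distrib_right inv_fourier_integrable)

lemma inv_fourier_diff:
  "f \<in> L2c \<Longrightarrow> g \<in> L2c \<Longrightarrow> inv_fourier (\<lambda>\<xi>. f \<xi> - g \<xi>) x = inv_fourier f x - inv_fourier g x"
  unfolding inv_fourier_def by (simp add: left_diff_distrib inv_fourier_integrable)

lemma inv_fourier_scale: "inv_fourier (\<lambda>\<xi>. c * f \<xi>) x = c * inv_fourier f x"
  unfolding inv_fourier_def by (simp add: mult.assoc)

lemma inv_fourier_zero: "inv_fourier (\<lambda>\<xi>. 0) x = 0"
  by (simp add: inv_fourier_def)

lemma inv_fourier_translate:
  "inv_fourier (\<lambda>\<xi>. cis (2 * pi * s * \<xi>) * h \<xi>) x = inv_fourier h (x + s)"
  unfolding inv_fourier_def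
  by (intro Bochner_Integration.integral_cong refl) (simp add: cis_mult[symmetric] distrib_left distrib_right mult_ac)

lemma inv_fourier_dilate:
  assumes "c > 0" shows "inv_fourier (\<lambda>\<xi>. h (c * \<xi>)) x = inv_fourier h (x / c) / of_real c"
proof -
  have "inv_fourier h (x / c) = \<bar>c\<bar> *\<^sub>R (LINT \<xi>|lebesgue. h (0 + c * \<xi>) * cis (2 * pi * (x / c) * (0 + c * \<xi>)))"
    unfolding inv_fourier_def using assms by (intro lebesgue_integral_real_affine) simp
  also have "(\<lambda>\<xi>. h (0 + c * \<xi>) * cis (2 * pi * (x / c) * (0 + c * \<xi>))) = (\<lambda>\<xi>. h (c * \<xi>) * cis (2 * pi * x * \<xi>))"
    using assms by (simp add: fun_eq_iff mult_ac)
  finally show ?thesis using assms by (simp add: inv_fourier_def scaleR_conv_of_real)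
qed

lemma inv_fourier_measurable:
  assumes "h \<in> L2c" shows "inv_fourier h \<in> borel_measurable lebesgue"
proof -
  have [measurable]: "h \<in> borel_measurable lebesgue" using assms by (auto intro: L2_measurable L2c_L2)
  show ?thesis unfolding inv_fourier_def[abs_def] by measurable
qed

lemma inv_fourier_bound: "cmod (inv_fourier h x) \<le> (LINT \<xi>|lebesgue. cmod (h \<xi>))"
  unfolding inv_fourier_def by (rule order_trans[OF integral_norm_bound]) (simp add: norm_mult)

lemma L2_affine:
  assumes "f \<in> L2" "c \<noteq> 0" shows "(\<lambda>x. f (t + c * x)) \<in> L2"
  using borel_measurable_affine[OF L2_measurable[OF assms(1)] assms(2), of t]
    lebesgue_integrable_real_affine[OF L2_integrable[OF assms(1)] assms(2), of t]
  by (simp add: L2_def)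

lemma l2_inner_affine:
  assumes "c \<noteq> 0"
  shows "l2_inner (\<lambda>x. f (t + c * x)) (\<lambda>x. g (t + c * x)) = l2_inner f g / of_real \<bar>c\<bar>"
  using lebesgue_integral_real_affine[OF assms, of "\<lambda>x. f x * cnj (g x)" t] assms
  by (simp add: l2_inner_def scaleR_conv_of_real)

lemma l2_norm_affine:
  assumes "c \<noteq> 0" shows "l2_norm (\<lambda>x. f (t + c * x)) = l2_norm f / sqrt \<bar>c\<bar>"
  using lebesgue_integral_real_affine[OF assms, of "\<lambda>x. (cmod (f x))\<^sup>2" t] assms
  by (simp add: l2_norm_def real_sqrt_mult)

lemma AE_affine:
  assumes "AE x in lebesgue. P x" "c \<noteq> (0::real)" shows "AE x in lebesgue. P (t + c * x)"
proof -
  obtain N where N: "N \<in> null_sets lebesgue" "\<And>x. x \<notin> N \<Longrightarrow> P x"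
    using assms(1) unfolding completion.AE_iff_null_sets by auto
  have [measurable]: "indicator N \<in> borel_measurable (lebesgue :: real measure)" using N by auto
  have "(\<integral>\<^sup>+x. indicator N x \<partial>lebesgue) = ennreal \<bar>c\<bar> * (\<integral>\<^sup>+x. indicator N (t + c * x) \<partial>lebesgue)"
    by (rule nn_integral_real_affine_lebesgue) (use assms in auto)
  moreover have "(\<integral>\<^sup>+x. indicator N x \<partial>lebesgue) = 0" using N by (subst nn_integral_indicator) auto
  ultimately have "(\<integral>\<^sup>+x. indicator N (t + c * x) \<partial>lebesgue) = 0" using assms by simp
  moreover have "(\<lambda>x. indicator N (t + c * x) :: real) \<in> borel_measurable lebesgue"
    using borel_measurable_affine[of "indicator N :: real \<Rightarrow> real" c t] N assms by simp
  then have "(\<lambda>x. ennreal (indicator N (t + c * x))) \<in> borel_measurable lebesgue" by measurable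
  then have "(\<lambda>x. indicator N (t + c * x) :: ennreal) \<in> borel_measurable lebesgue"
    by (simp add: ennreal_indicator)
  ultimately have "AE x in lebesgue. (indicator N (t + c * x) :: ennreal) = 0"
    by (subst (asm) nn_integral_0_iff_AE) auto
  then show ?thesis by eventually_elim (use N(2) in \<open>auto simp: indicator_def split: if_splits\<close>)
qed

section \<open>Plancherel's theorem\<close>

text \<open>
  The interval has odd integer length, so whole translates of the half-open cell tile it and nothing is left
  over at its ends.
\<close>

lemma integral_fold_cell:
  fixes u :: "real \<Rightarrow> 'b::euclidean_space"
  assumes u: "integrable lebesgue u" and supp: "\<And>x. x \<notin> {-real N - 1/2..<real N + 1/2} \<Longrightarrow> u x = 0"
  shows "(LINT x|lebesgue. u x) =
    (\<Sum>k\<in>{-int N..int N}. LINT x|lebesgue. indicator unit_cell x *\<^sub>R u (x + of_int k))"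
proof -
  let ?K = "{-int N..int N}"
  have "u x = (\<Sum>k\<in>?K. indicator unit_cell (x - of_int k) *\<^sub>R u x)" for x
  proof (cases "x \<in> {-real N - 1/2..<real N + 1/2}")
    case True
    define m where "m = \<lfloor>x + 1/2\<rfloor>"
    have m: "x - of_int k \<in> unit_cell \<longleftrightarrow> k = m" for k
      unfolding unit_cell_def m_def by (auto simp: eq_commute[of k] floor_eq_iff)
    have "m \<in> ?K" using True unfolding m_def by (auto simp: le_floor_iff floor_le_iff)
    then have "(\<Sum>k\<in>?K. indicator unit_cell (x - of_int k) *\<^sub>R u x)
        = (\<Sum>k\<in>?K. if k = m then u x else 0)"
      by (intro sum.cong) (auto simp: m indicator_def)
    then show ?thesis using \<open>m \<in> ?K\<close> by simp
  next
    case False then show ?thesis using supp by simp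
  qed
  then have "(LINT x|lebesgue. u x) = (LINT x|lebesgue. (\<Sum>k\<in>?K. indicator unit_cell (x - of_int k) *\<^sub>R u x))"
    by simp
  also have "\<dots> = (\<Sum>k\<in>?K. LINT x|lebesgue. indicator unit_cell (x - of_int k) *\<^sub>R u x)"
  proof (rule Bochner_Integration.integral_sum)
    fix k
    have "{x. x - of_int k \<in> unit_cell} = {of_int k - 1/2..<of_int k + 1/2}"
      by (auto simp: unit_cell_def)
    then have "integrable lebesgue (\<lambda>x. indicator {x. x - of_int k \<in> unit_cell} x *\<^sub>R u x)"
      by (intro integrable_mult_indicator u) simp
    then show "integrable lebesgue (\<lambda>x. indicator unit_cell (x - of_int k) *\<^sub>R u x)"
      by (simp add: indicator_def)
  qed
  also have "\<dots> = (\<Sum>k\<in>?K. LINT x|lebesgue. indicator unit_cell x *\<^sub>R u (x + of_int k))"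
  proof (rule sum.cong[OF refl])
    fix k :: int
    show "(LINT x|lebesgue. indicator unit_cell (x - of_int k) *\<^sub>R u x)
      = (LINT x|lebesgue. indicator unit_cell x *\<^sub>R u (x + of_int k))"
      by (subst lebesgue_integral_real_affine[of 1 _ "of_int k"]) (simp_all add: add.commute)
  qed
  finally show ?thesis .
qed

text \<open>
  If the frequencies lie in the unit cell, the values of the transform on \<open>x + \<int>\<close> are the Fourier
  coefficients of a modulation of \<open>g\<close>. By Parseval the sum of their squares is the squared
  norm of \<open>g\<close> for every \<open>x\<close>, and integrating over \<open>x\<close> in the unit cell gives the isometry.
\<close>

lemma inv_fourier_isometry_cell:
  assumes g: "g \<in> L2" and supp: "\<And>\<xi>. \<xi> \<notin> unit_cell \<Longrightarrow> g \<xi> = 0"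
  shows "inv_fourier g \<in> L2" "l2_norm (inv_fourier g) = l2_norm g"
proof -
  have gc: "g \<in> L2c"
    by (rule L2cI[OF g, of 1]) (use supp in \<open>force simp: unit_cell_def\<close>)
  have [measurable]: "g \<in> borel_measurable lebesgue" using g by (rule L2_measurable)
  have [measurable]: "inv_fourier g \<in> borel_measurable lebesgue" using gc by (rule inv_fourier_measurable)
  define S where "S N x = (\<Sum>k\<in>{-int N..int N}. (cmod (inv_fourier g (x + of_int k)))\<^sup>2)" for N x
  define Q where "Q N = {-real N - 1/2..<real N + 1/2}" for N
  define B where "B = (LINT \<xi>|lebesgue. cmod (g \<xi>))"
  define gx where "gx x \<xi> = cis (2 * pi * x * \<xi>) * g \<xi>" for x \<xi>
  have gx: "gx x \<in> L2" for x
    unfolding gx_def by (rule L2_mult_unimodular[OF g]) auto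
  have gx_norm: "l2_norm (gx x) = l2_norm g" for x
    by (simp add: l2_norm_def gx_def norm_mult)
  have S_eq: "S N x = (\<Sum>k\<in>{-int N..int N}. (cmod (l2_inner (gx x) (cell_trig k)))\<^sup>2)" for N x
  proof -
    have "inv_fourier g (x + of_int k) = l2_inner (gx x) (cell_trig (- k))" for k
      unfolding inv_fourier_translate[symmetric] unfolding l2_inner_def inv_fourier_def gx_def
      by (intro Bochner_Integration.integral_cong refl)
        (use supp in \<open>auto simp: cell_trig_def trig_cnj indicator_def trig_def cis_cnj mult_ac\<close>)
    then show ?thesis unfolding S_def
      by (intro sum.reindex_bij_witness[of _ uminus uminus]) auto
  qed
  have S_lim: "(\<lambda>N. S N x) \<longlonglongrightarrow> (l2_norm g)\<^sup>2" for x
    unfolding S_eq using Parseval_cell[OF gx, of x] supp by (simp add: gx_norm) (simp add: gx_def)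
  have S_le: "S N x \<le> (l2_norm g)\<^sup>2" for N x
    unfolding S_eq using Bessel_cell[OF gx, of "{-int N..int N}" x] by (simp add: gx_norm)
  have S_nonneg: "0 \<le> S N x" for N x unfolding S_def by (intro sum_nonneg) auto
  have shift: "(\<lambda>x. inv_fourier g (x + t)) \<in> borel_measurable lebesgue" for t
    using borel_measurable_affine[of "inv_fourier g" 1 t] by (simp add: add.commute)
  have S_meas [measurable]: "S N \<in> borel_measurable lebesgue" for N
    unfolding S_def[abs_def] using shift by measurable
  define u where "u N x = indicator (Q N) x * (cmod (inv_fourier g x))\<^sup>2" for N x
  have Q_meas [measurable]: "Q N \<in> sets lebesgue" for N by (simp add: Q_def)
  have sq: "(cmod (inv_fourier g x))\<^sup>2 \<le> B\<^sup>2" for x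
    using inv_fourier_bound[of g x] by (intro power_mono) (auto simp: B_def)
  have u_int: "integrable lebesgue (u N)" for N
  proof (rule Bochner_Integration.integrable_bound)
    show "integrable lebesgue (\<lambda>x. indicator (Q N) x * B\<^sup>2)"
      by (intro integrable_mult_left integrable_real_indicator) (auto simp: Q_def)
    show "u N \<in> borel_measurable lebesgue" unfolding u_def[abs_def] by measurable
    show "AE x in lebesgue. norm (u N x) \<le> norm (indicator (Q N) x * B\<^sup>2)"
      using sq by (auto simp: u_def indicator_def)
  qed
  have u_S: "(LINT x|lebesgue. u N x) = (LINT x|lebesgue. indicator unit_cell x * S N x)" for N
  proof -
    have "(LINT x|lebesgue. u N x) =
        (\<Sum>k\<in>{-int N..int N}. LINT x|lebesgue. indicator unit_cell x *\<^sub>R u N (x + of_int k))"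
      by (rule integral_fold_cell[OF u_int]) (simp add: u_def Q_def)
    also have "\<dots> = (LINT x|lebesgue. (\<Sum>k\<in>{-int N..int N}. indicator unit_cell x *\<^sub>R u N (x + of_int k)))"
    proof (rule Bochner_Integration.integral_sum[symmetric])
      show "integrable lebesgue (\<lambda>x. indicator unit_cell x *\<^sub>R u N (x + of_int k))" for k
        using lebesgue_integrable_real_affine[OF u_int, of 1 N "of_int k"]
        by (intro integrable_mult_indicator) (auto simp: add.commute)
    qed
    also have "\<dots> = (LINT x|lebesgue. indicator unit_cell x * S N x)"
    proof (intro Bochner_Integration.integral_cong refl)
      fix x
      have "x + of_int k \<in> Q N" if "x \<in> unit_cell" "k \<in> {-int N..int N}" for k
      proof -
        have "- real N \<le> real_of_int k" "real_of_int k \<le> real N" using that(2) by auto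
        then show ?thesis using that(1) by (auto simp: Q_def unit_cell_def)
      qed
      then show "(\<Sum>k\<in>{-int N..int N}. indicator unit_cell x *\<^sub>R u N (x + of_int k))
          = indicator unit_cell x * S N x"
        by (auto simp: S_def u_def indicator_def intro!: sum.cong)
    qed
    finally show ?thesis .
  qed
  have cell_int: "integrable lebesgue (\<lambda>x. indicator unit_cell x * c :: real)" for c
    by (intro integrable_mult_left integrable_real_indicator) (auto simp: unit_cell_def)
  have "(\<lambda>N. LINT x|lebesgue. indicator unit_cell x * S N x) \<longlonglongrightarrow>
      (LINT x|lebesgue. indicator unit_cell x * (l2_norm g)\<^sup>2)"
  proof (rule integral_dominated_convergence[OF _ _ cell_int])
    show "AE x in lebesgue. norm (indicator unit_cell x * S N x) \<le> indicator unit_cell x * (l2_norm g)\<^sup>2" for N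
      using S_le S_nonneg by (auto simp: indicator_def)
    show "AE x in lebesgue. (\<lambda>N. indicator unit_cell x * S N x) \<longlonglongrightarrow> indicator unit_cell x * (l2_norm g)\<^sup>2"
      using S_lim by (intro AE_I2 tendsto_intros)
  qed measurable
  also have "(LINT x|lebesgue. indicator unit_cell x * (l2_norm g)\<^sup>2) = (l2_norm g)\<^sup>2"
    by (simp add: unit_cell_def)
  finally have lim: "(\<lambda>N. LINT x|lebesgue. u N x) \<longlonglongrightarrow> (l2_norm g)\<^sup>2" by (simp add: u_S)
  have mono: "mono (\<lambda>N. u N x)" for x
    by (auto simp: mono_def u_def Q_def indicator_def)
  have ulim: "(\<lambda>N. u N x) \<longlonglongrightarrow> (cmod (inv_fourier g x))\<^sup>2" for x
  proof -
    obtain N :: nat where N: "\<bar>x\<bar> \<le> real N" using real_arch_simple by blast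
    have "u n x = (cmod (inv_fourier g x))\<^sup>2" if "n \<ge> N" for n
    proof -
      have "real N \<le> real n" using that by simp
      then have "x \<in> Q n" using N by (auto simp: Q_def abs_le_iff)
      then show ?thesis by (simp add: u_def)
    qed
    then have "\<forall>\<^sub>F n in sequentially. u n x = (cmod (inv_fourier g x))\<^sup>2"
      by (auto simp: eventually_sequentially intro!: exI[of _ N])
    then show ?thesis by (rule tendsto_eventually)
  qed
  note mc = integral_monotone_convergence_nonneg[OF u_int _ _ _ lim, of "\<lambda>x. (cmod (inv_fourier g x))\<^sup>2"]
  have "integrable lebesgue (\<lambda>x. (cmod (inv_fourier g x))\<^sup>2)"
    by (rule mc(1)) (use mono ulim in \<open>auto simp: u_def\<close>)
  then show "inv_fourier g \<in> L2" by (simp add: L2_def)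
  have "(LINT x|lebesgue. (cmod (inv_fourier g x))\<^sup>2) = (l2_norm g)\<^sup>2"
    by (rule mc(2)) (use mono ulim in \<open>auto simp: u_def\<close>)
  then show "l2_norm (inv_fourier g) = l2_norm g" by (simp add: l2_norm_def)
qed

text \<open>
  A dilation by more than twice the size of the support moves the frequencies into the unit cell; the
  transform is then dilated inversely, and both norms change by compatible factors.
\<close>

lemma
  assumes "g \<in> L2c"
  shows inv_fourier_L2: "inv_fourier g \<in> L2"
    and inv_fourier_norm: "l2_norm (inv_fourier g) = l2_norm g"
proof -
  obtain M where M: "M > 0" "\<And>\<xi>. g \<xi> \<noteq> 0 \<Longrightarrow> \<bar>\<xi>\<bar> \<le> M" using L2cE[OF assms] by metis
  \<comment> \<open>More than \<open>2 M\<close>, so that the half-open cell contains the dilated support.\<close>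
  define c where "c = 2 * M + 1"
  have c: "c > 0" using M by (simp add: c_def)
  define g' where "g' \<xi> = g (c * \<xi>)" for \<xi>
  have g': "g' \<in> L2" unfolding g'_def[abs_def] using L2_affine[OF L2c_L2[OF assms], of c 0] c by simp
  have supp: "g' \<xi> = 0" if "\<xi> \<notin> unit_cell" for \<xi>
  proof (rule ccontr)
    assume "g' \<xi> \<noteq> 0"
    then have "\<bar>c * \<xi>\<bar> \<le> M" using M by (simp add: g'_def)
    then have "c * \<bar>\<xi>\<bar> \<le> M" using c by (simp add: abs_mult)
    also have "M < c * (1/2)" by (simp add: c_def)
    finally have "c * \<bar>\<xi>\<bar> < c * (1/2)" .
    then have "\<bar>\<xi>\<bar> < 1/2" using c by (subst (asm) mult_less_cancel_left_pos) auto
    then show False using that by (auto simp: unit_cell_def)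
  qed
  have eq: "inv_fourier g = (\<lambda>y. of_real c * inv_fourier g' (0 + c * y))"
    using c by (simp add: fun_eq_iff g'_def[abs_def] inv_fourier_dilate)
  show "inv_fourier g \<in> L2"
    unfolding eq using c by (intro L2_scale L2_affine inv_fourier_isometry_cell(1)[OF g' supp]) auto
  have ng': "l2_norm g' = l2_norm g / sqrt c"
    unfolding g'_def[abs_def] using l2_norm_affine[of c g 0] c by simp
  have "l2_norm (inv_fourier g) = c * (l2_norm (inv_fourier g') / sqrt c)"
    unfolding eq l2_norm_scale using c by (subst l2_norm_affine) auto
  also have "\<dots> = l2_norm g"
  proof -
    have "l2_norm (inv_fourier g') = l2_norm g / sqrt c"
      using inv_fourier_isometry_cell(2)[OF g' supp] ng' by simp
    moreover have "c * (l2_norm g / sqrt c / sqrt c) = l2_norm g"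
      using c unfolding divide_divide_eq_left by simp
    ultimately show ?thesis by simp
  qed
  finally show "l2_norm (inv_fourier g) = l2_norm g" .
qed

lemma Re_l2_inner_polarization:
  assumes "f \<in> L2" "g \<in> L2"
  shows "2 * Re (l2_inner f g) = (l2_norm (\<lambda>x. f x + g x))\<^sup>2 - (l2_norm f)\<^sup>2 - (l2_norm g)\<^sup>2"
  using l2_norm_add_sq[OF assms] by simp

text \<open>
  A linear isometry preserves inner products: polarization gives the real part, and replacing \<open>g\<close> by
  \<open>\<i> g\<close> gives the imaginary part.
\<close>

lemma inv_fourier_inner:
  assumes f: "f \<in> L2c" and g: "g \<in> L2c"
  shows "l2_inner (inv_fourier f) (inv_fourier g) = l2_inner f g"
proof -
  have re: "Re (l2_inner (inv_fourier f) (inv_fourier h)) = Re (l2_inner f h)" if h: "h \<in> L2c" for h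
  proof -
    have "(\<lambda>x. inv_fourier f x + inv_fourier h x) = inv_fourier (\<lambda>\<xi>. f \<xi> + h \<xi>)"
      using f h by (simp add: inv_fourier_add fun_eq_iff)
    then have "2 * Re (l2_inner (inv_fourier f) (inv_fourier h)) = 2 * Re (l2_inner f h)"
      using f h by (subst (1 2) Re_l2_inner_polarization)
        (simp_all add: inv_fourier_L2 inv_fourier_norm L2c_add L2c_L2)
    then show ?thesis by simp
  qed
  have "(\<lambda>x. \<i> * inv_fourier g x) = inv_fourier (\<lambda>\<xi>. \<i> * g \<xi>)"
    by (simp add: inv_fourier_scale fun_eq_iff)
  then have "Re (l2_inner (inv_fourier f) (\<lambda>x. \<i> * inv_fourier g x)) = Re (l2_inner f (\<lambda>\<xi>. \<i> * g \<xi>))"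
    using re[OF L2c_scale[OF g, of \<i>]] by simp
  then have "Im (l2_inner (inv_fourier f) (inv_fourier g)) = Im (l2_inner f g)"
    by (simp add: l2_inner_scale_right)
  then show ?thesis using re[OF g] by (simp add: complex_eq_iff)
qed

section \<open>Fourier inversion in the mean\<close>

definition fourier :: "(real \<Rightarrow> complex) \<Rightarrow> real \<Rightarrow> complex" where
  "fourier f \<xi> = inv_fourier f (- \<xi>)"

lemma fourier_L2: "f \<in> L2c \<Longrightarrow> fourier f \<in> L2"
  unfolding fourier_def[abs_def] using L2_affine[OF inv_fourier_L2, of f "-1" 0] by simp

lemma fourier_norm: "f \<in> L2c \<Longrightarrow> l2_norm (fourier f) = l2_norm f"
  unfolding fourier_def[abs_def] using l2_norm_affine[of "-1" "inv_fourier f" 0] by (simp add: inv_fourier_norm)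

lemma inv_fourier_adjoint:
  assumes h: "h \<in> L2c" and f: "f \<in> L2c"
  shows "l2_inner (inv_fourier h) f = l2_inner h (fourier f)"
proof -
  have [measurable]: "h \<in> borel_measurable lebesgue" "f \<in> borel_measurable lebesgue"
    using assms by (auto intro: L2_measurable L2c_L2)
  define k where "k x \<xi> = h \<xi> * cis (2 * pi * x * \<xi>) * cnj (f x)" for x \<xi>
  have "integrable (lebesgue \<Otimes>\<^sub>M lebesgue) (case_prod k)"
  proof (rule lebesgue_pair.Fubini_integrable)
    show "case_prod k \<in> borel_measurable (lebesgue \<Otimes>\<^sub>M lebesgue)"
      unfolding k_def[abs_def] by measurable
    have "integrable lebesgue (\<lambda>x. (LINT \<xi>|lebesgue. cmod (h \<xi>)) * cmod (f x))"
      using L2c_integrable[OF f] by simp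
    then show "integrable lebesgue (\<lambda>x. LINT \<xi>|lebesgue. norm (case_prod k (x, \<xi>)))"
      by (simp add: k_def norm_mult)
    show "AE x in lebesgue. integrable lebesgue (\<lambda>\<xi>. case_prod k (x, \<xi>))"
      using inv_fourier_integrable[OF h] by (simp add: k_def)
  qed
  from lebesgue_pair.Fubini_integral[OF this]
  have "(LINT x|lebesgue. LINT \<xi>|lebesgue. k x \<xi>) = (LINT \<xi>|lebesgue. LINT x|lebesgue. k x \<xi>)" by simp
  moreover have "(LINT \<xi>|lebesgue. k x \<xi>) = inv_fourier h x * cnj (f x)" for x
    unfolding k_def inv_fourier_def by simp
  moreover have "(LINT x|lebesgue. k x \<xi>) = h \<xi> * cnj (fourier f \<xi>)" for \<xi>
  proof -
    have "k x \<xi> = h \<xi> * cnj (f x * cis (2 * pi * (- \<xi>) * x))" for x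
      unfolding k_def by (simp add: cis_cnj mult_ac)
    then have "(LINT x|lebesgue. k x \<xi>) = h \<xi> * (LINT x|lebesgue. cnj (f x * cis (2 * pi * (- \<xi>) * x)))"
      by (simp only: integral_mult_right_zero)
    also have "(LINT x|lebesgue. cnj (f x * cis (2 * pi * (- \<xi>) * x))) = cnj (fourier f \<xi>)"
      unfolding fourier_def inv_fourier_def by (rule Bochner_Integration.integral_cnj)
    finally show ?thesis .
  qed
  ultimately show ?thesis by (simp add: l2_inner_def)
qed

definition truncate :: "nat \<Rightarrow> (real \<Rightarrow> complex) \<Rightarrow> real \<Rightarrow> complex" where
  "truncate n f x = indicator {- real n..real n} x * f x"

lemma truncate_L2c: assumes "f \<in> L2" shows "truncate n f \<in> L2c"
proof (rule L2cI[where M="real n"])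
  show "truncate n f \<in> L2" unfolding truncate_def[abs_def] by (rule L2_restrict[OF assms]) auto
qed (auto simp: truncate_def indicator_def split: if_splits)

lemma truncate_tendsto:
  assumes "f \<in> L2" shows "(\<lambda>n. l2_norm (\<lambda>x. truncate n f x - f x)) \<longlonglongrightarrow> 0"
proof (rule l2_dominated_convergence[OF _ _ L2_integrable[OF assms]])
  show "f \<in> borel_measurable lebesgue" using assms by (rule L2_measurable)
  show "truncate n f \<in> borel_measurable lebesgue" for n
    using truncate_L2c[OF assms] by (auto intro: L2_measurable L2c_L2)
  show "AE x in lebesgue. (cmod (truncate n f x - f x))\<^sup>2 \<le> (cmod (f x))\<^sup>2" for n
    by (auto simp: truncate_def indicator_def)
  show "AE x in lebesgue. (\<lambda>n. truncate n f x) \<longlonglongrightarrow> f x"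
  proof (rule AE_I2)
    fix x
    obtain N :: nat where N: "\<bar>x\<bar> \<le> real N" using real_arch_simple by blast
    have "truncate n f x = f x" if "n \<ge> N" for n
      using N order_trans[OF N, of "real n"] that by (simp add: truncate_def indicator_def abs_le_iff)
    then have "\<forall>\<^sub>F n in sequentially. truncate n f x = f x"
      by (auto simp: eventually_sequentially intro!: exI[of _ N])
    then show "(\<lambda>n. truncate n f x) \<longlonglongrightarrow> f x" by (rule tendsto_eventually)
  qed
qed

text \<open>
  Both squared distances \<open>\<parallel>F\<^sup>* u - f\<parallel>\<^sup>2\<close> and \<open>\<parallel>u - F f\<parallel>\<^sup>2\<close>, where \<open>u\<close> truncates \<open>F f\<close>, equal
  \<open>\<parallel>f\<parallel>\<^sup>2 - \<parallel>u\<parallel>\<^sup>2\<close>: expand and use that \<open>F\<close> and \<open>F\<^sup>*\<close> are adjoint isometries. So inversion follows from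
  isometry alone.
\<close>

lemma fourier_inversion:
  assumes f: "f \<in> L2c"
  shows "(\<lambda>n. l2_norm (\<lambda>x. inv_fourier (truncate n (fourier f)) x - f x)) \<longlonglongrightarrow> 0"
proof -
  have "l2_norm (\<lambda>x. inv_fourier (truncate n (fourier f)) x - f x)
      = l2_norm (\<lambda>\<xi>. truncate n (fourier f) \<xi> - fourier f \<xi>)" for n
  proof (rule power2_eq_imp_eq)
    let ?u = "truncate n (fourier f)"
    have u: "?u \<in> L2c" using f by (intro truncate_L2c fourier_L2)
    have "l2_inner ?u (fourier f) = l2_inner ?u ?u"
      unfolding l2_inner_def truncate_def by (intro Bochner_Integration.integral_cong refl) (simp add: indicator_def)
    then have "l2_inner (inv_fourier ?u) f = l2_inner ?u (fourier f)"
      "l2_inner ?u (fourier f) = of_real ((l2_norm ?u)\<^sup>2)"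
      using inv_fourier_adjoint[OF u f] by (simp_all add: l2_inner_self)
    then show "(l2_norm (\<lambda>x. inv_fourier ?u x - f x))\<^sup>2 = (l2_norm (\<lambda>\<xi>. ?u \<xi> - fourier f \<xi>))\<^sup>2"
      using f u by (subst (1 2) l2_norm_diff_sq)
        (simp_all add: inv_fourier_L2 fourier_L2 L2c_L2 inv_fourier_norm fourier_norm)
  qed simp_all
  then show ?thesis using truncate_tendsto[OF fourier_L2[OF f]] by simp
qed

lemma inv_fourier_range_L2: "inv_fourier ` L2c \<subseteq> L2"
  by (auto intro: inv_fourier_L2)

lemma inv_fourier_range_dense: "l2_closure (inv_fourier ` L2c) = L2"
proof (intro equalityI subsetI)
  fix f assume f: "f \<in> L2"
  have in_closure: "truncate m f \<in> l2_closure (inv_fourier ` L2c)" for m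
  proof (rule l2_closure_limit[OF _ _ fourier_inversion[OF truncate_L2c[OF f]] inv_fourier_range_L2])
    show "inv_fourier (truncate n (fourier (truncate m f))) \<in> l2_closure (inv_fourier ` L2c)" for n
      using l2_closure_superset[OF inv_fourier_range_L2] truncate_L2c[OF fourier_L2[OF truncate_L2c[OF f]]]
      by blast
  qed (use f in \<open>auto intro: L2c_L2 truncate_L2c\<close>)
  show "f \<in> l2_closure (inv_fourier ` L2c)"
    by (rule l2_closure_limit[OF in_closure f truncate_tendsto[OF f] inv_fourier_range_L2])
qed (use l2_closure_subset_L2 in blast)

lemma truncated_fourier_eq: "truncated_fourier f n = fourier (truncate n f)"
  unfolding truncated_fourier_def[abs_def] fourier_def[abs_def] inv_fourier_def truncate_def set_lebesgue_integral_def
  by (intro ext Bochner_Integration.integral_cong refl) (simp add: indicator_def mult_ac)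

text \<open>
  Reflection exchanges the transform with its inverse, so inversion in one order yields inversion in the other.
\<close>

lemma has_l2_fourier_inv_fourier:
  assumes g: "g \<in> L2c" shows "has_l2_fourier (inv_fourier g) g"
proof -
  define g' where "g' x = g (- x)" for x
  have "g' \<in> L2" unfolding g'_def[abs_def] using L2_affine[OF L2c_L2[OF g], of "-1" 0] by simp
  then have g': "g' \<in> L2c" using g unfolding L2c_def g'_def[abs_def] by (auto, metis abs_minus_cancel minus_minus)
  have F: "fourier g' = inv_fourier g"
  proof
    fix x
    have "inv_fourier g x = (LINT \<xi>|lebesgue. g (0 + -1 * \<xi>) * cis (2 * pi * x * (0 + -1 * \<xi>)))"
      unfolding inv_fourier_def by (subst lebesgue_integral_real_affine[of "-1" _ 0]) simp_all
    then show "fourier g' x = inv_fourier g x" by (simp add: fourier_def inv_fourier_def g'_def)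
  qed
  have "l2_norm (\<lambda>x. truncated_fourier (inv_fourier g) n x - g x)
      = l2_norm (\<lambda>x. inv_fourier (truncate n (inv_fourier g)) x - g' x)" for n
    using l2_norm_affine[of "-1" "\<lambda>x. inv_fourier (truncate n (inv_fourier g)) x - g' x" 0]
    by (simp add: truncated_fourier_eq fourier_def g'_def)
  then have "(\<lambda>n. l2_norm (\<lambda>x. truncated_fourier (inv_fourier g) n x - g x)) \<longlonglongrightarrow> 0"
    using fourier_inversion[OF g'] by (simp add: F)
  then show ?thesis using g unfolding has_l2_fourier_def l2_tendsto_def truncated_fourier_eq
    by (auto intro: inv_fourier_L2 fourier_L2 truncate_L2c L2c_L2)
qed

lemma l2_inner_tendsto:
  assumes "\<And>n. F n \<in> L2" "f \<in> L2" "u \<in> L2" "(\<lambda>n. l2_norm (\<lambda>x. F n x - f x)) \<longlonglongrightarrow> 0"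
  shows "(\<lambda>n. l2_inner (F n) u) \<longlonglongrightarrow> l2_inner f u"
proof -
  have "(\<lambda>n. l2_inner (F n) u - l2_inner f u) \<longlonglongrightarrow> 0"
  proof (rule Lim_null_comparison)
    show "\<forall>\<^sub>F n in sequentially. norm (l2_inner (F n) u - l2_inner f u) \<le> l2_norm (\<lambda>x. F n x - f x) * l2_norm u"
      using assms l2_Cauchy_Schwarz[OF L2_diff] by (intro always_eventually allI) (simp flip: l2_inner_diff_left)
    show "(\<lambda>n. l2_norm (\<lambda>x. F n x - f x) * l2_norm u) \<longlonglongrightarrow> 0"
      using tendsto_mult_right[OF assms(4), of "l2_norm u"] by simp
  qed
  then show ?thesis by (rule LIM_zero_cancel)
qed

lemma orthogonal_to_closure_zero:
  assumes w: "w \<in> l2_closure S" and S: "S \<subseteq> L2" and orth: "\<And>s. s \<in> S \<Longrightarrow> l2_inner w s = 0"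
  shows "AE x in lebesgue. w x = 0"
proof (rule l2_norm_eq_0_AE)
  show wL: "w \<in> L2" using w l2_closure_subset_L2 by blast
  show "l2_norm w = 0"
  proof (rule ccontr)
    assume "l2_norm w \<noteq> 0"
    then have pos: "l2_norm w > 0" using l2_norm_nonneg[of w] by linarith
    obtain s where s: "s \<in> S" "l2_norm (\<lambda>x. w x - s x) < l2_norm w" using l2_closureE[OF w pos] by blast
    have "complex_of_real ((l2_norm w)\<^sup>2) = l2_inner w (\<lambda>x. w x - s x)"
      using s S wL orth by (subst l2_inner_diff_right) (auto simp: l2_inner_self)
    then have "(l2_norm w)\<^sup>2 = cmod (l2_inner w (\<lambda>x. w x - s x))"
      by (metis norm_of_real abs_of_nonneg zero_le_power2)
    also have "\<dots> \<le> l2_norm w * l2_norm (\<lambda>x. w x - s x)"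
      using s S wL by (intro l2_Cauchy_Schwarz L2_diff) auto
    also have "\<dots> < l2_norm w * l2_norm w" using s pos by simp
    finally show False by (simp add: power2_eq_square)
  qed
qed

text \<open>
  By adjointness the \<open>L\<^sup>2\<close> transform of \<open>f\<close> determines the inner products of \<open>f\<close> with all inverse transforms
  of functions in \<open>L2c\<close>, and these are dense.
\<close>

lemma has_l2_fourier_unique:
  assumes fg: "has_l2_fourier f g" and g': "g' \<in> L2c" and ae: "AE \<xi> in lebesgue. g \<xi> = g' \<xi>"
  shows "AE x in lebesgue. f x = inv_fourier g' x"
proof -
  have f: "f \<in> L2" and g: "g \<in> L2" and lim: "(\<lambda>n. l2_norm (\<lambda>x. fourier (truncate n f) x - g x)) \<longlonglongrightarrow> 0"
    using fg by (auto simp: has_l2_fourier_def l2_tendsto_def truncated_fourier_eq)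
  note tc = truncate_L2c[OF f]
  have eq: "l2_inner f (inv_fourier u) = l2_inner (inv_fourier g') (inv_fourier u)" if u: "u \<in> L2c" for u
  proof -
    have "(\<lambda>n. l2_inner (truncate n f) (inv_fourier u)) \<longlonglongrightarrow> l2_inner f (inv_fourier u)"
      by (rule l2_inner_tendsto) (use f u truncate_tendsto[OF f] in \<open>auto intro: L2c_L2 tc inv_fourier_L2\<close>)
    moreover have "(\<lambda>n. l2_inner (fourier (truncate n f)) u) \<longlonglongrightarrow> l2_inner g u"
      by (rule l2_inner_tendsto) (use g u lim in \<open>auto intro: L2c_L2 tc fourier_L2\<close>)
    moreover have "l2_inner (truncate n f) (inv_fourier u) = l2_inner (fourier (truncate n f)) u" for n
      using inv_fourier_adjoint[OF u tc, of n] l2_inner_cnj by metis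
    ultimately have "l2_inner f (inv_fourier u) = l2_inner g u" by (simp add: LIMSEQ_unique)
    also have "\<dots> = l2_inner g' u" using g g' u ae by (intro l2_inner_cong_AE) (auto intro: L2c_L2)
    finally show ?thesis by (simp add: inv_fourier_inner g' u)
  qed
  have "AE x in lebesgue. f x - inv_fourier g' x = 0"
  proof (rule orthogonal_to_closure_zero[OF _ inv_fourier_range_L2])
    show "(\<lambda>x. f x - inv_fourier g' x) \<in> l2_closure (inv_fourier ` L2c)"
      unfolding inv_fourier_range_dense using f g' by (intro L2_diff inv_fourier_L2)
    show "l2_inner (\<lambda>x. f x - inv_fourier g' x) s = 0" if "s \<in> inv_fourier ` L2c" for s
      using that eq f g' by (auto simp: l2_inner_diff_left inv_fourier_L2)
  qed
  then show ?thesis by simp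
qed

section \<open>Band-limited functions\<close>

definition L2on :: "real set \<Rightarrow> (real \<Rightarrow> complex) set" where
  "L2on E = {h \<in> L2. \<forall>\<xi>. \<xi> \<notin> E \<longrightarrow> h \<xi> = 0}"

text \<open>
  For bounded \<open>E\<close>, taking the closure saturates the set of inverse transforms under almost everywhere
  equality, which closedness entails.
\<close>

definition bandlimited :: "real set \<Rightarrow> (real \<Rightarrow> complex) set" where
  "bandlimited E = l2_closure (inv_fourier ` L2on E)"

lemma L2on_L2: "h \<in> L2on E \<Longrightarrow> h \<in> L2" by (simp add: L2on_def)

lemma L2on_L2c: "bounded E \<Longrightarrow> L2on E \<subseteq> L2c"
  by (fastforce simp: L2on_def L2c_def bounded_real)

lemma L2on_subspace: "l2_subspace (L2on E)"
  by (auto simp: l2_subspace_def L2on_def intro: L2_add L2_scale)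

lemma L2on_mono: "E \<subseteq> F \<Longrightarrow> L2on E \<subseteq> L2on F"
  by (auto simp: L2on_def)

lemma L2on_restrict: "h \<in> L2 \<Longrightarrow> E \<in> sets lebesgue \<Longrightarrow> (\<lambda>\<xi>. indicator E \<xi> * h \<xi>) \<in> L2on E"
  by (simp add: L2on_def L2_restrict)

lemma L2c_subspace: "l2_subspace L2c"
  by (auto simp: l2_subspace_def L2c_zero intro: L2c_add L2c_scale L2c_L2)

lemma inv_fourier_image_subspace:
  assumes "l2_subspace X" "X \<subseteq> L2c" shows "l2_subspace (inv_fourier ` X)"
  unfolding l2_subspace_def
proof (intro conjI ballI allI)
  show "inv_fourier ` X \<subseteq> L2" using assms inv_fourier_L2 by blast
  have "(\<lambda>x. 0) = inv_fourier (\<lambda>\<xi>. 0)" by (simp add: inv_fourier_zero fun_eq_iff)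
  then show "(\<lambda>x. 0) \<in> inv_fourier ` X" using assms(1) by (auto simp: l2_subspace_def)
next
  fix f g assume "f \<in> inv_fourier ` X" "g \<in> inv_fourier ` X"
  then obtain h k where h: "h \<in> X" "f = inv_fourier h" and k: "k \<in> X" "g = inv_fourier k" by blast
  have "(\<lambda>x. f x + g x) = inv_fourier (\<lambda>\<xi>. h \<xi> + k \<xi>)"
    using h k assms(2) by (simp add: inv_fourier_add subset_iff fun_eq_iff)
  then show "(\<lambda>x. f x + g x) \<in> inv_fourier ` X" using assms(1) h k by (auto simp: l2_subspace_def)
next
  fix c f assume "f \<in> inv_fourier ` X"
  then obtain h where h: "h \<in> X" "f = inv_fourier h" by blast
  have "(\<lambda>x. c * f x) = inv_fourier (\<lambda>\<xi>. c * h \<xi>)" using h by (auto simp: inv_fourier_scale)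
  then show "(\<lambda>x. c * f x) \<in> inv_fourier ` X" using assms(1) h by (auto simp: l2_subspace_def)
qed

lemma bandlimited_closed_subspace: "bounded E \<Longrightarrow> l2_closed_subspace (bandlimited E)"
  unfolding bandlimited_def
  by (intro l2_closed_subspace_closure inv_fourier_image_subspace L2on_subspace L2on_L2c)

lemma bandlimited_mono: "E \<subseteq> F \<Longrightarrow> bandlimited E \<subseteq> bandlimited F"
  unfolding bandlimited_def by (intro l2_closure_mono image_mono L2on_mono)

lemma bandlimited_L2: "bandlimited E \<subseteq> L2"
  unfolding bandlimited_def by (rule l2_closure_subset_L2)

lemma inv_fourier_bandlimited:
  assumes "bounded E" "h \<in> L2on E" shows "inv_fourier h \<in> bandlimited E"
proof -
  have "inv_fourier ` L2on E \<subseteq> L2" using L2on_L2c[OF assms(1)] inv_fourier_L2 by blast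
  from l2_closure_superset[OF this] show ?thesis using assms(2) by (auto simp: bandlimited_def)
qed

lemma inv_fourier_dist:
  assumes "f \<in> L2c" "g \<in> L2c"
  shows "l2_norm (\<lambda>x. inv_fourier f x - inv_fourier g x) = l2_norm (\<lambda>\<xi>. f \<xi> - g \<xi>)"
proof -
  have "(\<lambda>x. inv_fourier f x - inv_fourier g x) = inv_fourier (\<lambda>\<xi>. f \<xi> - g \<xi>)"
    using assms by (simp add: inv_fourier_diff fun_eq_iff)
  then show ?thesis using inv_fourier_norm[OF L2c_diff[OF assms]] by simp
qed

lemma l2_span_subset:
  assumes "l2_subspace V" "\<And>i. e i \<in> V" shows "l2_span e \<subseteq> V"
proof
  fix f assume "f \<in> l2_span e"
  then show "f \<in> V" by (induction rule: l2_span_induct) (use assms in \<open>auto simp: l2_subspace_def\<close>)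
qed

lemma l2_subspace_closure: "l2_subspace V \<Longrightarrow> l2_subspace (l2_closure V)"
  using l2_closed_subspace_closure[of V] by (simp add: l2_closed_subspace_def l2_subspace_def)

text \<open>
  A family that spans a dense subspace on the frequency side is carried to one that does so on the
  space side. Only the almost everywhere classes of its members matter.
\<close>

lemma closure_span_inv_fourier:
  assumes X: "l2_subspace X" "X \<subseteq> L2c" and u: "\<And>i. u i \<in> X" and e: "\<And>i. e i \<in> L2"
    and ae: "\<And>i. AE x in lebesgue. e i x = inv_fourier (u i) x"
    and dense: "X \<subseteq> l2_closure (l2_span u)"
  shows "l2_closure (l2_span e) = l2_closure (inv_fourier ` X)"
proof
  have TX: "inv_fourier ` X \<subseteq> L2" using X inv_fourier_L2 by blast
  have eL: "l2_span e \<subseteq> L2" using l2_span_subspace[of e] e by (simp add: l2_subspace_def)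
  have "e i \<in> l2_closure (inv_fourier ` X)" for i
  proof (rule l2_closure_AE[OF _ TX])
    show "inv_fourier (u i) \<in> l2_closure (inv_fourier ` X)" using l2_closure_superset[OF TX] u by blast
    show "AE x in lebesgue. inv_fourier (u i) x = e i x" using ae[of i] by eventually_elim simp
  qed
  then have "l2_span e \<subseteq> l2_closure (inv_fourier ` X)"
    by (intro l2_span_subset l2_subspace_closure inv_fourier_image_subspace X)
  then show "l2_closure (l2_span e) \<subseteq> l2_closure (inv_fourier ` X)"
    using TX by (rule l2_closure_minimal)
  have lift: "v \<in> X \<and> (\<exists>w\<in>l2_span e. AE x in lebesgue. w x = inv_fourier v x)" if "v \<in> l2_span u" for v
    using that
  proof (induction rule: l2_span_induct)
    case zero
    show ?case using X l2_span_zero[of e] by (auto simp: l2_subspace_def inv_fourier_zero intro!: bexI[of _ "\<lambda>x. 0"])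
  next
    case (add f g)
    then obtain w w' where w: "w \<in> l2_span e" "AE x in lebesgue. w x = inv_fourier f x"
      and w': "w' \<in> l2_span e" "AE x in lebesgue. w' x = inv_fourier g x" by blast
    have fg: "f \<in> L2c" "g \<in> L2c" using add X by auto
    have "AE x in lebesgue. w x + w' x = inv_fourier (\<lambda>x. f x + g x) x"
      using w(2) w'(2) by eventually_elim (simp add: inv_fourier_add fg)
    moreover have "(\<lambda>x. f x + g x) \<in> X" using add X(1) by (auto simp: l2_subspace_def)
    ultimately show ?case using l2_span_add[OF w(1) w'(1)] by (intro conjI bexI[of _ "\<lambda>x. w x + w' x"])
  next
    case (scale c i)
    have "AE x in lebesgue. c * e i x = inv_fourier (\<lambda>x. c * u i x) x"
      using ae[of i] by eventually_elim (simp add: inv_fourier_scale)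
    moreover have "(\<lambda>x. c * u i x) \<in> X" using u[of i] X(1) by (auto simp: l2_subspace_def)
    ultimately show ?case using l2_span_scale[OF l2_span_base[of e i], of c]
      by (intro conjI bexI[of _ "\<lambda>x. c * e i x"])
  qed
  have "inv_fourier ` X \<subseteq> l2_closure (l2_span e)"
  proof
    fix f assume "f \<in> inv_fourier ` X"
    then obtain h where h: "h \<in> X" "f = inv_fourier h" by blast
    have hc: "h \<in> L2c" using h X by blast
    show "f \<in> l2_closure (l2_span e)"
    proof (rule l2_closureI)
      show fL: "f \<in> L2" using h hc inv_fourier_L2 by simp
      fix r :: real assume "r > 0"
      then obtain v where v: "v \<in> l2_span u" "l2_norm (\<lambda>x. h x - v x) < r" using l2_closureE dense h by blast
      obtain w where w: "w \<in> l2_span e" "AE x in lebesgue. w x = inv_fourier v x" using lift[OF v(1)] by blast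
      have vc: "v \<in> L2c" using lift[OF v(1)] X by blast
      have "l2_norm (\<lambda>x. f x - w x) = l2_norm (\<lambda>x. f x - inv_fourier v x)"
        by (rule l2_norm_cong_AE)
          (use w eL fL vc in \<open>auto intro!: L2_measurable L2_diff inv_fourier_L2 elim!: eventually_mono\<close>)
      also have "\<dots> = l2_norm (\<lambda>x. h x - v x)" unfolding h(2) by (rule inv_fourier_dist[OF hc vc])
      finally have "l2_norm (\<lambda>x. f x - w x) < r" using v(2) by simp
      then show "\<exists>g\<in>l2_span e. l2_norm (\<lambda>x. f x - g x) < r" using w(1) by (intro bexI[of _ w])
    qed
  qed
  then show "l2_closure (inv_fourier ` X) \<subseteq> l2_closure (l2_span e)" using eL by (rule l2_closure_minimal)
qed

section \<open>Tilings by integer translations\<close>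

text \<open>
  The last condition, stated on a fundamental domain, makes the integer translates of \<open>E\<close> a partition of the
  line up to a null set.
\<close>

definition integer_tile :: "real set \<Rightarrow> bool" where
  "integer_tile E \<longleftrightarrow> E \<in> sets lebesgue \<and> bounded E \<and>
     (AE \<xi> in lebesgue. \<xi> \<in> unit_cell \<longrightarrow> (\<exists>!k. \<xi> + of_int k \<in> E))"

lemma integer_tileD:
  assumes "integer_tile E" shows "E \<in> sets lebesgue" "bounded E"
    "AE \<xi> in lebesgue. \<xi> \<in> unit_cell \<longrightarrow> (\<exists>!k. \<xi> + of_int k \<in> E)"
  using assms by (auto simp: integer_tile_def)

lemma integer_tile_bound:
  assumes "integer_tile E"
  obtains N :: nat where "E \<subseteq> {-real N..real N}"
    "\<And>\<xi> k. \<xi> \<in> unit_cell \<Longrightarrow> \<xi> + of_int k \<in> E \<Longrightarrow> k \<in> {-int N..int N}"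
proof -
  obtain B where B: "\<forall>x\<in>E. \<bar>x\<bar> \<le> B" using integer_tileD(2)[OF assms] by (auto simp: bounded_real)
  obtain N :: nat where "B \<le> real N" using real_arch_simple by blast
  with B have sub: "E \<subseteq> {-real N..real N}" by (force simp: abs_le_iff)
  have "k \<in> {-int N..int N}" if "\<xi> \<in> unit_cell" "\<xi> + of_int k \<in> E" for \<xi> k
  proof -
    have "-real N \<le> \<xi> + of_int k" "\<xi> + of_int k \<le> real N" using sub that(2) by auto
    then have "- real N - 1 < of_int k" "of_int k < real N + 1" using that(1) by (auto simp: unit_cell_def)
    then show ?thesis by auto
  qed
  with sub show thesis by (rule that)
qed

text \<open>
  The change of variables that cuts a tile into pieces and moves them onto the unit cell. The function
  \<open>G\<close> is what \<open>u\<close> becomes there; outside the tile it is \<open>u = 0\<close> that makes the other translates drop out.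
\<close>

lemma integral_integer_tile:
  fixes u :: "real \<Rightarrow> 'b::euclidean_space"
  assumes E: "integer_tile E" and u: "integrable lebesgue u" and supp: "\<And>x. x \<notin> E \<Longrightarrow> u x = 0"
    and G: "AE \<xi> in lebesgue. \<xi> \<in> unit_cell \<longrightarrow> (\<forall>k. \<xi> + of_int k \<in> E \<longrightarrow> u (\<xi> + of_int k) = G \<xi>)"
  shows "(LINT x|lebesgue. u x) = (LINT x|lebesgue. indicator unit_cell x *\<^sub>R G x)"
proof -
  obtain N :: nat where N: "E \<subseteq> {-real N..real N}"
    "\<And>\<xi> k. \<xi> \<in> unit_cell \<Longrightarrow> \<xi> + of_int k \<in> E \<Longrightarrow> k \<in> {-int N..int N}"
    using integer_tile_bound[OF E] by metis
  let ?K = "{-int N..int N}"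
  define s where "s x = (\<Sum>k\<in>?K. indicator unit_cell x *\<^sub>R u (x + of_int k))" for x
  have int: "integrable lebesgue (\<lambda>x. indicator unit_cell x *\<^sub>R u (x + of_int k))" for k
    using lebesgue_integrable_real_affine[OF u, of 1 "of_int k"]
    by (intro integrable_mult_indicator) (auto simp: add.commute)
  have s_int: "integrable lebesgue s" unfolding s_def[abs_def] by (intro Bochner_Integration.integrable_sum int)
  have "(LINT x|lebesgue. u x) = (\<Sum>k\<in>?K. LINT x|lebesgue. indicator unit_cell x *\<^sub>R u (x + of_int k))"
  proof (rule integral_fold_cell[OF u])
    fix x assume "x \<notin> {- real N - 1 / 2..<real N + 1 / 2}"
    then have "x \<notin> E" using N(1) by force
    then show "u x = 0" by (rule supp)
  qed
  also have "\<dots> = (LINT x|lebesgue. s x)"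
    unfolding s_def by (rule Bochner_Integration.integral_sum[symmetric]) (rule int)
  also have "\<dots> = (LINT x|lebesgue. indicator unit_cell x *\<^sub>R G x)"
  proof -
    have ae: "AE x in lebesgue. s x = indicator unit_cell x *\<^sub>R G x"
      using integer_tileD(3)[OF E] G
    proof eventually_elim
      case (elim x)
      show ?case
      proof (cases "x \<in> unit_cell")
        case True
        then obtain m where m: "x + of_int m \<in> E" "\<And>k. x + of_int k \<in> E \<Longrightarrow> k = m" using elim(1) by blast
        have "s x = (\<Sum>k\<in>?K. if k = m then G x else 0)"
          unfolding s_def
        proof (intro sum.cong refl)
          fix k
          show "indicator unit_cell x *\<^sub>R u (x + of_int k) = (if k = m then G x else 0)"
          proof (cases "k = m")
            case True
            then show ?thesis using elim(2) m(1) \<open>x \<in> unit_cell\<close> by simp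
          next
            case False
            then have "x + of_int k \<notin> E" using m(2) by blast
            then show ?thesis using supp False by simp
          qed
        qed
        then show ?thesis using True N(2)[OF True m(1)] by simp
      qed (simp add: s_def)
    qed
    have sm: "s \<in> borel_measurable lebesgue" using s_int by (rule borel_measurable_integrable)
    show ?thesis by (rule integral_cong_AE[OF sm borel_measurable_AE[OF sm ae] ae])
  qed
  finally show ?thesis .
qed

text \<open>
  Folding a function supported in a tile onto the unit cell preserves the distance to every trigonometric
  polynomial, so completeness is inherited from the unit cell.
\<close>

lemma integer_tile_trig_dense:
  assumes E: "integer_tile E" and h: "h \<in> L2on E"
  shows "h \<in> l2_closure (l2_span (\<lambda>k \<xi>. indicator E \<xi> * trig k \<xi>))" (is "h \<in> l2_closure (l2_span ?e)")
proof (rule l2_closureI)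
  note [measurable] = integer_tileD(1)[OF E]
  show hL: "h \<in> L2" using h by (rule L2on_L2)
  have h0: "h \<xi> = 0" if "\<xi> \<notin> E" for \<xi> using h that by (simp add: L2on_def)
  obtain N :: nat where N: "E \<subseteq> {-real N..real N}"
    "\<And>\<xi> k. \<xi> \<in> unit_cell \<Longrightarrow> \<xi> + of_int k \<in> E \<Longrightarrow> k \<in> {-int N..int N}"
    using integer_tile_bound[OF E] by metis
  define H where "H \<xi> = indicator unit_cell \<xi> * (\<Sum>k\<in>{-int N..int N}. h (\<xi> + of_int k))" for \<xi>
  have H: "H \<in> L2" unfolding H_def[abs_def]
  proof (intro L2_restrict L2_sum)
    show "(\<lambda>\<xi>. h (\<xi> + of_int k)) \<in> L2" for k
      using L2_affine[OF hL, of 1 "of_int k"] by (simp add: add.commute)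
  qed auto
  fix r :: real assume "r > 0"
  then obtain p where p: "p \<in> l2_span cell_trig" "l2_norm (\<lambda>x. H x - p x) < r"
    using l2_closureE[OF cell_trig_dense[OF H]] by (auto simp: H_def)
  then obtain I c where I: "finite I" "p = (\<lambda>x. \<Sum>i\<in>I. c i * cell_trig i x)" by (auto simp: l2_span_def)
  define P where "P x = (\<Sum>i\<in>I. c i * trig i x)" for x
  define v where "v x = (\<Sum>i\<in>I. c i * ?e i x)" for x
  have v: "v \<in> l2_span ?e" unfolding v_def[abs_def] l2_span_def using I(1) by blast
  have vP: "v x = indicator E x * P x" for x by (simp add: v_def P_def sum_distrib_left mult_ac)
  have pP: "p x = indicator unit_cell x * P x" for x
    by (simp add: I(2) P_def cell_trig_def sum_distrib_left mult_ac)
  have P_per: "P (x + of_int k) = P x" for x k by (simp add: P_def trig_periodic)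
  have vL: "v \<in> L2" unfolding v_def[abs_def]
  proof (intro L2_sum L2_scale I(1))
    show "?e i \<in> L2" for i
    proof (rule L2_bounded_support[where B=1 and M="real N"])
      show "indicator E x * trig i x = 0" if "x \<notin> {- real N..real N}" for x
        using subset_iff[THEN iffD1, OF N(1), rule_format, of x] that by (auto simp: indicator_def)
    qed (auto simp: norm_mult indicator_def)
  qed
  have "(l2_norm (\<lambda>x. h x - v x))\<^sup>2 = (LINT x|lebesgue. (cmod (h x - v x))\<^sup>2)" by (rule l2_norm_sq)
  also have "\<dots> = (LINT x|lebesgue. indicator unit_cell x *\<^sub>R (cmod (H x - p x))\<^sup>2)"
  proof (rule integral_integer_tile[OF E])
    show "integrable lebesgue (\<lambda>x. (cmod (h x - v x))\<^sup>2)" using L2_integrable[OF L2_diff[OF hL vL]] .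
    show "(cmod (h x - v x))\<^sup>2 = 0" if "x \<notin> E" for x using that h0 by (simp add: vP)
    show "AE \<xi> in lebesgue. \<xi> \<in> unit_cell \<longrightarrow> (\<forall>k. \<xi> + of_int k \<in> E \<longrightarrow>
        (cmod (h (\<xi> + of_int k) - v (\<xi> + of_int k)))\<^sup>2 = (cmod (H \<xi> - p \<xi>))\<^sup>2)"
      using integer_tileD(3)[OF E]
    proof eventually_elim
      case (elim x)
      show ?case
      proof (intro impI allI)
        fix m assume x: "x \<in> unit_cell" and m: "x + of_int m \<in> E"
        have "h (x + of_int k) = 0" if "k \<noteq> m" for k using elim x m that h0 by blast
        then have "(\<Sum>k\<in>{-int N..int N}. h (x + of_int k)) = (\<Sum>k\<in>{-int N..int N}. if k = m then h (x + of_int m) else 0)"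
          by (intro sum.cong) auto
        then have "H x = h (x + of_int m)" using N(2)[OF x m] x by (simp add: H_def)
        then show "(cmod (h (x + of_int m) - v (x + of_int m)))\<^sup>2 = (cmod (H x - p x))\<^sup>2"
          using m x by (simp add: vP pP P_per)
      qed
    qed
  qed
  also have "\<dots> = (LINT x|lebesgue. (cmod (H x - p x))\<^sup>2)"
    by (intro Bochner_Integration.integral_cong refl) (auto simp: indicator_def H_def pP)
  also have "\<dots> = (l2_norm (\<lambda>x. H x - p x))\<^sup>2" by (rule l2_norm_sq[symmetric])
  finally have "l2_norm (\<lambda>x. h x - v x) = l2_norm (\<lambda>x. H x - p x)" by (simp add: power2_eq_iff_nonneg)
  then show "\<exists>g\<in>l2_span ?e. l2_norm (\<lambda>x. h x - g x) < r" using v p by (intro bexI[of _ v]) auto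
qed

definition modulation :: "(real \<Rightarrow> complex) \<Rightarrow> int \<Rightarrow> real \<Rightarrow> complex" where
  "modulation g k \<xi> = trig (- k) \<xi> * g \<xi>"

text \<open>
  The transform of a wavelet or of a scaling function: its modulus is prescribed, its phase is arbitrary.
\<close>

locale unimodular_on_tile =
  fixes E :: "real set" and g :: "real \<Rightarrow> complex"
  assumes tile: "integer_tile E" and g_measurable: "g \<in> borel_measurable lebesgue"
    and g_modulus: "\<And>\<xi>. cmod (g \<xi>) = indicator E \<xi>"
begin

lemma g_zero: "\<xi> \<notin> E \<Longrightarrow> g \<xi> = 0"
  using g_modulus[of \<xi>] by simp

lemma modulation_in: "modulation g k \<in> L2on E"
proof -
  note [measurable] = g_measurable
  obtain N :: nat where N: "E \<subseteq> {-real N..real N}" using integer_tile_bound[OF tile] by metis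
  have "modulation g k \<in> L2" unfolding modulation_def[abs_def]
  proof (rule L2_bounded_support[where B=1 and M="real N"])
    show "cmod (trig (- k) x * g x) \<le> 1" for x by (simp add: norm_mult g_modulus indicator_def)
    show "trig (- k) x * g x = 0" if "x \<notin> {- real N..real N}" for x
      using subset_iff[THEN iffD1, OF N, rule_format, of x] that g_zero[of x] by auto
  qed measurable
  then show ?thesis by (simp add: L2on_def modulation_def g_zero)
qed

lemma g_in: "g \<in> L2on E"
  using modulation_in[of 0] by (simp add: modulation_def[abs_def] trig_def)

lemma modulation_orthonormal: "l2_inner (modulation g j) (modulation g k) = (if j = k then 1 else 0)"
proof -
  have eq: "modulation g j \<xi> * cnj (modulation g k \<xi>) = indicator E \<xi> * trig (k - j) \<xi>" for \<xi>
  proof -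
    have "g \<xi> * cnj (g \<xi>) = indicator E \<xi>"
      by (simp add: complex_norm_square[symmetric] g_modulus indicator_def)
    moreover have "modulation g j \<xi> * cnj (modulation g k \<xi>) = (g \<xi> * cnj (g \<xi>)) * trig (k - j) \<xi>"
      using trig_add[of k "-j" \<xi>] by (simp add: modulation_def trig_cnj)
    ultimately show ?thesis by simp
  qed
  have "l2_inner (modulation g j) (modulation g k) = (LINT \<xi>|lebesgue. indicator unit_cell \<xi> *\<^sub>R trig (k - j) \<xi>)"
    unfolding l2_inner_def
  proof (rule integral_integer_tile[OF tile])
    show "integrable lebesgue (\<lambda>x. modulation g j x * cnj (modulation g k x))"
      using modulation_in by (intro L2_mult_integrable) (auto intro: L2on_L2)
  qed (auto simp: eq trig_periodic)
  also have "\<dots> = (LINT \<xi>|lebesgue. cell_trig (k - j) \<xi>)"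
    by (intro Bochner_Integration.integral_cong refl) (simp add: cell_trig_def indicator_def)
  finally show ?thesis by (simp add: integral_cell_trig)
qed

text \<open>
  Multiplication by \<open>cnj g\<close> is an isometry of the functions on \<open>E\<close>, inverted by multiplication with \<open>g\<close>.
  So the phase of \<open>g\<close> can be removed before approximating by exponentials.
\<close>

lemma modulation_dense: "L2on E \<subseteq> l2_closure (l2_span (modulation g))"
proof
  fix h assume h: "h \<in> L2on E"
  note [measurable] = g_measurable
  have h0: "h \<xi> = 0" if "\<xi> \<notin> E" for \<xi> using h that by (simp add: L2on_def)
  have hg: "(\<lambda>\<xi>. h \<xi> * cnj (g \<xi>)) \<in> L2on E"
    unfolding L2on_def
  proof (intro CollectI conjI allI impI)
    show "(\<lambda>\<xi>. h \<xi> * cnj (g \<xi>)) \<in> L2"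
      by (rule L2_mult_unimodular(2)[OF L2on_L2[OF h]]) (auto simp: g_modulus indicator_def)
  qed (simp add: g_zero)
  show "h \<in> l2_closure (l2_span (modulation g))"
  proof (rule l2_closureI)
    show "h \<in> L2" using h by (rule L2on_L2)
    fix r :: real assume "r > 0"
    then obtain v where v: "v \<in> l2_span (\<lambda>k \<xi>. indicator E \<xi> * trig k \<xi>)"
        "l2_norm (\<lambda>\<xi>. h \<xi> * cnj (g \<xi>) - v \<xi>) < r"
      using l2_closureE[OF integer_tile_trig_dense[OF tile hg]] by blast
    have v': "(\<lambda>\<xi>. v \<xi> * g \<xi>) \<in> l2_span (modulation g) \<and> (\<forall>\<xi>. \<xi> \<notin> E \<longrightarrow> v \<xi> = 0)"
      using v(1)
    proof (induction rule: l2_span_induct)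
      case (scale c k)
      have "(\<lambda>\<xi>. c * (indicator E \<xi> * trig k \<xi>) * g \<xi>) = (\<lambda>\<xi>. c * modulation g (- k) \<xi>)"
        using g_zero by (auto simp: modulation_def indicator_def fun_eq_iff)
      then show ?case by (simp add: l2_span_scale l2_span_base indicator_def)
    qed (auto simp: distrib_right intro: l2_span_zero l2_span_add)
    have "cmod (h \<xi> - v \<xi> * g \<xi>) = cmod (h \<xi> * cnj (g \<xi>) - v \<xi>)" for \<xi>
    proof (cases "\<xi> \<in> E")
      case True
      then have 1: "g \<xi> * cnj (g \<xi>) = 1" by (simp add: complex_norm_square[symmetric] g_modulus)
      have "cmod (h \<xi> - v \<xi> * g \<xi>) = cmod ((h \<xi> - v \<xi> * g \<xi>) * cnj (g \<xi>))"
        using True by (simp add: norm_mult g_modulus)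
      also have "(h \<xi> - v \<xi> * g \<xi>) * cnj (g \<xi>) = h \<xi> * cnj (g \<xi>) - v \<xi> * (g \<xi> * cnj (g \<xi>))"
        by (simp add: algebra_simps)
      finally show ?thesis by (simp add: 1)
    qed (use h0 v' in \<open>simp add: g_zero\<close>)
    then have "l2_norm (\<lambda>\<xi>. h \<xi> - v \<xi> * g \<xi>) < r" using v(2) by (simp add: l2_norm_def)
    then show "\<exists>w\<in>l2_span (modulation g). l2_norm (\<lambda>\<xi>. h \<xi> - w \<xi>) < r"
      by (rule bexI[where x="\<lambda>\<xi>. v \<xi> * g \<xi>"]) (rule v'[THEN conjunct1])
  qed
qed

lemma inv_fourier_modulation: "inv_fourier (modulation g k) x = inv_fourier g (x - of_int k)"
  using inv_fourier_translate[of "- of_int k" g x] by (simp add: modulation_def[abs_def] trig_def mult_ac)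

text \<open>
  Modulation by an exponential on the frequency side is translation by an integer on the space side.
\<close>

lemma translates_basis:
  assumes \<phi>: "\<phi> \<in> L2" and ae: "AE x in lebesgue. \<phi> x = inv_fourier g x"
  shows "l2_orthonormal_basis (integer_translates \<phi>) (bandlimited E)"
proof -
  have E_c: "L2on E \<subseteq> L2c" using tile by (intro L2on_L2c integer_tileD)
  have L: "integer_translates \<phi> k \<in> L2" for k
    using L2_affine[OF \<phi>, of 1 "- of_int k"] by (simp add: integer_translates_def[abs_def])
  have ae': "AE x in lebesgue. integer_translates \<phi> k x = inv_fourier (modulation g k) x" for k
    using AE_affine[OF ae, of 1 "- of_int k"] by (simp add: integer_translates_def inv_fourier_modulation)
  have "l2_inner (integer_translates \<phi> j) (integer_translates \<phi> k) = l2_inner (modulation g j) (modulation g k)" for j k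
  proof -
    have mc: "modulation g i \<in> L2c" for i using E_c modulation_in by blast
    have "l2_inner (integer_translates \<phi> j) (integer_translates \<phi> k)
        = l2_inner (inv_fourier (modulation g j)) (inv_fourier (modulation g k))"
      by (rule l2_inner_cong_AE) (auto intro: L ae' mc inv_fourier_L2)
    then show ?thesis by (simp add: inv_fourier_inner mc)
  qed
  moreover have "l2_closure (l2_span (integer_translates \<phi>)) = bandlimited E"
    unfolding bandlimited_def
    by (rule closure_span_inv_fourier[OF L2on_subspace E_c modulation_in L ae' modulation_dense])
  ultimately show ?thesis unfolding l2_orthonormal_basis_def using L modulation_orthonormal by simp
qed

end

section \<open>Dyadic dilations\<close>

definition scaled :: "int \<Rightarrow> real set \<Rightarrow> real set" where
  "scaled j E = {\<xi>. 2 powi (- j) * \<xi> \<in> E}"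

text \<open>
  Normalized to be unitary. It is the frequency side of the dilation \<open>f \<mapsto> 2\<^bsup>j/2\<^esup> f (2\<^sup>j \<cdot>)\<close>.
\<close>

definition dilate :: "int \<Rightarrow> (real \<Rightarrow> complex) \<Rightarrow> real \<Rightarrow> complex" where
  "dilate j h \<xi> = complex_of_real (2 powr (- real_of_int j / 2)) * h (2 powi (- j) * \<xi>)"

lemma powr_half_square: "2 powr (real_of_int j / 2) * 2 powr (real_of_int j / 2) = (2::real) powi j"
  by (simp add: powr_add[symmetric] powr_real_of_int')

lemma powr_minus_half_square: "2 powr (- real_of_int j / 2) * 2 powr (- real_of_int j / 2) = (2::real) powi (- j)"
  using powr_half_square[of "- j"] by simp

lemma powi_minus_Suc: "(2::real) powi (- (j + 1)) = 2 powi (- j) / 2"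
  using power_int_diff[of "2::real" "- j" 1] by simp

lemma powi_cancel: "(2::real) powi (- j) * (2 powi j * x) = x" "(2::real) powi j * (2 powi (- j) * x) = x"
  by (simp_all add: power_int_minus)

lemma scaled_0 [simp]: "scaled 0 E = E"
  by (simp add: scaled_def)

lemma scaled_minus_scaled: "scaled (- j) (scaled j E) = E"
  using powi_cancel(1)[of j] by (simp only: scaled_def mem_Collect_eq minus_minus) simp

lemma scaled_Suc_iff: "\<xi> \<in> scaled (j + 1) E \<longleftrightarrow> 2 powi (- j) * \<xi> / 2 \<in> E"
  unfolding scaled_def powi_minus_Suc by simp

lemma scaled_sets: assumes "E \<in> sets lebesgue" shows "scaled j E \<in> sets lebesgue"
proof -
  have "(\<lambda>x. indicator E (0 + 2 powi (- j) *\<^sub>R x) :: real) \<in> borel_measurable lebesgue"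
    using assms by (intro borel_measurable_affine) auto
  moreover have "(\<lambda>x. indicator E (0 + 2 powi (- j) *\<^sub>R x) :: real) = indicator (scaled j E)"
    by (simp add: scaled_def indicator_def fun_eq_iff)
  ultimately show ?thesis by (simp add: borel_measurable_indicator_iff)
qed

lemma scaled_bounded: assumes "bounded E" shows "bounded (scaled j E)"
proof -
  obtain B where B: "\<forall>x\<in>E. \<bar>x\<bar> \<le> B" using assms by (auto simp: bounded_real)
  have "\<bar>\<xi>\<bar> \<le> 2 powi j * B" if "\<xi> \<in> scaled j E" for \<xi>
  proof -
    have "2 powi (- j) * \<bar>\<xi>\<bar> \<le> B" using B that by (auto simp: scaled_def abs_mult)
    then have "2 powi j * (2 powi (- j) * \<bar>\<xi>\<bar>) \<le> 2 powi j * B" by (intro mult_left_mono) auto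
    then show ?thesis by (simp add: powi_cancel)
  qed
  then show ?thesis by (auto simp: bounded_real)
qed

lemma dilate_L2: "h \<in> L2 \<Longrightarrow> dilate j h \<in> L2"
  unfolding dilate_def[abs_def] using L2_affine[of h "2 powi (- j)" 0] by (intro L2_scale) simp

lemma dilate_L2on: "h \<in> L2on E \<Longrightarrow> dilate j h \<in> L2on (scaled j E)"
  by (auto simp: L2on_def dilate_L2) (simp add: dilate_def scaled_def)

lemma dilate_dilate_minus: "dilate j (dilate (- j) h) = h"
proof
  fix \<xi>
  have "2 powr (- real_of_int j / 2) * 2 powr (real_of_int j / 2) = (1::real)"
    by (simp add: powr_add[symmetric])
  then have "complex_of_real (2 powr (- real_of_int j / 2)) * complex_of_real (2 powr (real_of_int j / 2)) = 1"
    unfolding of_real_mult[symmetric] by simp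
  then show "dilate j (dilate (- j) h) \<xi> = h \<xi>"
    unfolding dilate_def minus_minus powi_cancel(2) of_int_minus by (simp add: mult.assoc[symmetric])
qed

lemma dilate_inner: "l2_inner (dilate j f) (dilate j g) = l2_inner f g"
proof -
  let ?s = "2 powr (- real_of_int j / 2)" and ?c = "2 powi (- j) :: real"
  have "l2_inner (dilate j f) (dilate j g)
      = complex_of_real ?s * (complex_of_real ?s * l2_inner (\<lambda>\<xi>. f (0 + ?c * \<xi>)) (\<lambda>\<xi>. g (0 + ?c * \<xi>)))"
    unfolding dilate_def[abs_def] by (simp only: l2_inner_scale_left l2_inner_scale_right complex_cnj_complex_of_real add_0)
  also have "\<dots> = complex_of_real (?s * ?s) * (l2_inner f g / complex_of_real \<bar>?c\<bar>)"
    by (subst l2_inner_affine) simp_all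
  also have "\<dots> = l2_inner f g" unfolding powr_minus_half_square by simp
  finally show ?thesis .
qed

lemma dilate_norm: "l2_norm (dilate j f) = l2_norm f"
proof -
  have "complex_of_real ((l2_norm (dilate j f))\<^sup>2) = complex_of_real ((l2_norm f)\<^sup>2)"
    unfolding l2_inner_self[symmetric] by (rule dilate_inner)
  then show ?thesis by (simp only: of_real_eq_iff power2_eq_iff_nonneg[OF l2_norm_nonneg l2_norm_nonneg])
qed

lemma dilate_diff: "dilate j (\<lambda>\<xi>. f \<xi> - g \<xi>) = (\<lambda>\<xi>. dilate j f \<xi> - dilate j g \<xi>)"
  by (simp add: dilate_def right_diff_distrib fun_eq_iff)

lemma inv_fourier_dilate_dyadic:
  "inv_fourier (dilate j h) x = complex_of_real (2 powr (real_of_int j / 2)) * inv_fourier h (2 powi j * x)"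
proof -
  let ?s = "2 powr (- real_of_int j / 2)" and ?c = "2 powi (- j) :: real"
  have "inv_fourier (dilate j h) x = complex_of_real ?s * (inv_fourier h (x / ?c) / complex_of_real ?c)"
    unfolding dilate_def[abs_def] inv_fourier_scale by (subst inv_fourier_dilate) simp_all
  also have "x / ?c = 2 powi j * x" by (simp add: power_int_minus field_simps)
  also have "complex_of_real ?s * (inv_fourier h (2 powi j * x) / complex_of_real ?c)
      = complex_of_real (?s / ?c) * inv_fourier h (2 powi j * x)" by simp
  also have "?s / ?c = 2 powr (real_of_int j / 2)"
  proof -
    have "2 powr (real_of_int j / 2) * ?c = (2 powr (real_of_int j / 2) * ?s) * ?s"
      unfolding powr_minus_half_square[symmetric] by simp
    also have "2 powr (real_of_int j / 2) * ?s = 1" by (simp add: powr_add[symmetric])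
    finally show ?thesis by (simp add: field_simps)
  qed
  finally show ?thesis .
qed

lemma dilate_dense:
  assumes dense: "L2on E \<subseteq> l2_closure (l2_span u)"
  shows "L2on (scaled j E) \<subseteq> l2_closure (l2_span (\<lambda>k. dilate j (u k)))"
proof
  fix h assume h: "h \<in> L2on (scaled j E)"
  have h': "dilate (- j) h \<in> L2on E" using dilate_L2on[OF h, of "- j"] by (simp only: scaled_minus_scaled)
  show "h \<in> l2_closure (l2_span (\<lambda>k. dilate j (u k)))"
  proof (rule l2_closureI[OF L2on_L2[OF h]])
    fix r :: real assume "r > 0"
    then obtain v where v: "v \<in> l2_span u" "l2_norm (\<lambda>\<xi>. dilate (- j) h \<xi> - v \<xi>) < r"
      using l2_closureE dense h' by blast
    have "dilate j v \<in> l2_span (\<lambda>k. dilate j (u k))" using v(1)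
    proof (induction rule: l2_span_induct)
      case zero
      show ?case using l2_span_zero by (simp add: dilate_def[abs_def])
    next
      case (add f g)
      have "dilate j (\<lambda>x. f x + g x) = (\<lambda>x. dilate j f x + dilate j g x)"
        by (simp add: dilate_def distrib_left fun_eq_iff)
      then show ?case using add by (simp add: l2_span_add)
    next
      case (scale c k)
      have "dilate j (\<lambda>x. c * u k x) = (\<lambda>x. c * dilate j (u k) x)" by (simp add: dilate_def fun_eq_iff)
      then show ?case using l2_span_scale[OF l2_span_base[of "\<lambda>k. dilate j (u k)" k], of c] by simp
    qed
    moreover have "l2_norm (\<lambda>\<xi>. h \<xi> - dilate j v \<xi>) < r"
      using v(2) dilate_norm[of j "\<lambda>\<xi>. dilate (- j) h \<xi> - v \<xi>"] by (simp add: dilate_diff dilate_dilate_minus)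
    ultimately show "\<exists>g\<in>l2_span (\<lambda>k. dilate j (u k)). l2_norm (\<lambda>x. h x - g x) < r"
      by (intro bexI[of _ "dilate j v"])
  qed
qed

lemma bandlimited_dilate:
  assumes f: "f \<in> bandlimited E" and E: "bounded E" and c: "c > 0"
  shows "(\<lambda>x. f (c * x)) \<in> bandlimited {\<xi>. \<xi> / c \<in> E}"
  unfolding bandlimited_def
proof (rule l2_closureI)
  have fL: "f \<in> L2" using f bandlimited_L2 by blast
  show "(\<lambda>x. f (c * x)) \<in> L2" using L2_affine[OF fL, of c 0] c by simp
  fix r :: real assume "r > 0"
  then obtain h where h: "h \<in> L2on E" "l2_norm (\<lambda>x. f x - inv_fourier h x) < r * sqrt c"
    using l2_closureE[OF f[unfolded bandlimited_def], of "r * sqrt c"] c by auto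
  define k where "k \<xi> = complex_of_real (1 / c) * h (\<xi> / c)" for \<xi>
  have "(\<lambda>\<xi>. h (0 + 1 / c * \<xi>)) \<in> L2" using c by (intro L2_affine L2on_L2[OF h(1)]) simp
  then have "k \<in> L2" unfolding k_def[abs_def] by (intro L2_scale) simp
  then have k: "k \<in> L2on {\<xi>. \<xi> / c \<in> E}" using h(1) by (auto simp: L2on_def k_def)
  have "inv_fourier k x = inv_fourier h (c * x)" for x
    unfolding k_def[abs_def] inv_fourier_scale
    using inv_fourier_dilate[of "1 / c" h x] c by (simp add: mult.commute)
  then have "l2_norm (\<lambda>x. f (c * x) - inv_fourier k x) = l2_norm (\<lambda>x. f x - inv_fourier h x) / sqrt c"
    using l2_norm_affine[of c "\<lambda>x. f x - inv_fourier h x" 0] c by simp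
  also have "\<dots> < r" using h(2) c by (simp add: pos_divide_less_eq)
  finally show "\<exists>g\<in>inv_fourier ` L2on {\<xi>. \<xi> / c \<in> E}. l2_norm (\<lambda>x. f (c * x) - g x) < r"
    using k by (intro bexI[of _ "inv_fourier k"]) auto
qed

lemma orthogonal_to_closure:
  assumes f: "f \<in> l2_closure A" and A: "A \<subseteq> L2" and t: "t \<in> L2" and orth: "\<And>s. s \<in> A \<Longrightarrow> l2_inner s t = 0"
  shows "l2_inner f t = 0"
proof (rule ccontr)
  assume nz: "l2_inner f t \<noteq> 0"
  have fL: "f \<in> L2" using f l2_closure_subset_L2 by blast
  define e where "e = cmod (l2_inner f t) / (l2_norm t + 1)"
  have tp: "l2_norm t + 1 > 0" by (intro add_nonneg_pos) auto
  then have "e > 0" using nz by (simp add: e_def)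
  then obtain s where s: "s \<in> A" "l2_norm (\<lambda>x. f x - s x) < e" using l2_closureE[OF f] by blast
  then have sL: "s \<in> L2" using A by blast
  have "cmod (l2_inner f t) = cmod (l2_inner (\<lambda>x. f x - s x) t)"
    using fL sL t orth[OF s(1)] by (simp add: l2_inner_diff_left)
  also have "\<dots> \<le> l2_norm (\<lambda>x. f x - s x) * l2_norm t" using fL sL t by (intro l2_Cauchy_Schwarz L2_diff)
  also have "\<dots> \<le> e * l2_norm t" using s by (intro mult_right_mono) auto
  also have "\<dots> < e * (l2_norm t + 1)" using \<open>e > 0\<close> by simp
  also have "\<dots> = cmod (l2_inner f t)" using tp by (simp add: e_def)
  finally show False by simp
qed

lemma bandlimited_orthogonal:
  assumes "bounded E" "bounded F" "E \<inter> F = {}" "f \<in> bandlimited E" "g \<in> bandlimited F"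
  shows "l2_inner f g = 0"
proof -
  have EF: "inv_fourier ` L2on E \<subseteq> L2" "inv_fourier ` L2on F \<subseteq> L2"
    using assms L2on_L2c inv_fourier_L2 by blast+
  have 1: "l2_inner (inv_fourier h) (inv_fourier k) = 0" if "h \<in> L2on E" "k \<in> L2on F" for h k
  proof -
    have "h x * cnj (k x) = 0" for x using that assms(3) by (auto simp: L2on_def)
    then have "l2_inner h k = 0" by (simp only: l2_inner_def Bochner_Integration.integral_zero)
    moreover have "h \<in> L2c" "k \<in> L2c" using that assms L2on_L2c by blast+
    ultimately show ?thesis by (simp add: inv_fourier_inner)
  qed
  have gL: "g \<in> L2" using assms(5) bandlimited_L2 by blast
  show ?thesis
  proof (rule orthogonal_to_closure[OF assms(4)[unfolded bandlimited_def] EF(1) gL])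
    fix s assume s: "s \<in> inv_fourier ` L2on E"
    have "l2_inner g s = 0"
    proof (rule orthogonal_to_closure[OF assms(5)[unfolded bandlimited_def] EF(2)])
      show "s \<in> L2" using s EF(1) by blast
      fix t assume "t \<in> inv_fourier ` L2on F"
      then have "l2_inner s t = 0" using s 1 by auto
      then show "l2_inner t s = 0" by (subst l2_inner_cnj) simp
    qed
    then show "l2_inner s g = 0" by (subst l2_inner_cnj) simp
  qed
qed

section \<open>Wavelets from scaling sets\<close>

text \<open>
  The hypotheses under which the functions living on \<open>2\<^sup>j S\<close> form a multiresolution analysis: translates
  give a basis because \<open>S\<close> is a tile, the spaces are nested because \<open>S \<subseteq> 2S\<close>, and they exhaust \<open>L\<^sup>2\<close>
  because \<open>S\<close> is a neighbourhood of \<open>0\<close>.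
\<close>

locale scaling_set =
  fixes S :: "real set" and \<delta> :: real
  assumes S_tile: "integer_tile S"
    and half: "\<And>\<xi>. \<xi> \<in> S \<Longrightarrow> \<xi> / 2 \<in> S"
    and delta_pos: "\<delta> > 0" and near_zero: "\<And>\<xi>. \<bar>\<xi>\<bar> < \<delta> \<Longrightarrow> \<xi> \<in> S"
begin

definition K :: "real set" where
  "K = {\<xi>. \<xi> / 2 \<in> S \<and> \<xi> \<notin> S}"

lemma S_sets: "scaled j S \<in> sets lebesgue"
  using S_tile by (intro scaled_sets integer_tileD)

lemma S_bounded: "bounded (scaled j S)"
  using S_tile by (intro scaled_bounded integer_tileD)

lemma scaled_Suc: "scaled j S \<subseteq> scaled (j + 1) S"
proof
  fix \<xi> assume "\<xi> \<in> scaled j S"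
  then show "\<xi> \<in> scaled (j + 1) S"
    using half[of "2 powi (- j) * \<xi>"] by (simp add: scaled_Suc_iff) (simp add: scaled_def)
qed

lemma scaled_mono: "i \<le> j \<Longrightarrow> scaled i S \<subseteq> scaled j S"
proof (induction j rule: int_ge_induct)
  case (step j)
  then show ?case using scaled_Suc[of j] by blast
qed simp

lemma scaled_K: "scaled j K = scaled (j + 1) S - scaled j S"
proof -
  have "\<xi> \<in> scaled j K \<longleftrightarrow> \<xi> \<in> scaled (j + 1) S \<and> \<xi> \<notin> scaled j S" for \<xi>
    unfolding scaled_Suc_iff by (simp add: scaled_def K_def)
  then show ?thesis by blast
qed

lemma K_scaled_1: "K = scaled 1 S - S"
  using scaled_K[of 0] by simp

lemma K_sets: "K \<in> sets lebesgue"
  unfolding K_scaled_1 using S_sets[of 0] S_sets[of 1] by auto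

lemma K_bounded: "bounded K"
  unfolding K_scaled_1 using S_bounded[of 1] by (rule bounded_subset) auto

lemma scaled_K_disjoint: assumes "i \<noteq> j" shows "scaled i K \<inter> scaled j K = {}"
proof -
  have "scaled i K \<inter> scaled j K = {}" if "i < j" for i j
    using scaled_mono[of "i + 1" j] that unfolding scaled_K by auto
  then show ?thesis using assms by (cases i j rule: linorder_cases) blast+
qed

lemma L2c_in_scaled: assumes "h \<in> L2c" obtains i where "h \<in> L2on (scaled i S)"
proof -
  obtain M where M: "\<And>\<xi>. h \<xi> \<noteq> 0 \<Longrightarrow> \<bar>\<xi>\<bar> \<le> M" using L2cE[OF assms] by metis
  obtain n where n: "M / \<delta> < 2 ^ n" using real_arch_pow[of 2 "M / \<delta>"] by auto
  have "\<xi> \<in> scaled (int n) S" if "h \<xi> \<noteq> 0" for \<xi>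
  proof -
    have "\<bar>\<xi>\<bar> < \<delta> * 2 ^ n" using M[OF that] n delta_pos by (simp add: pos_divide_less_eq mult.commute)
    then have "\<bar>2 powi (- int n) * \<xi>\<bar> < \<delta>" by (simp add: abs_mult power_int_minus field_simps)
    then show ?thesis unfolding scaled_def using near_zero by blast
  qed
  then have "h \<in> L2on (scaled (int n) S)" using assms by (auto simp: L2on_def dest: L2c_L2)
  then show thesis by (rule that)
qed

text \<open>
  The sets \<open>2\<^sup>j S\<close> shrink to a null set as \<open>j \<rightarrow> -\<infinity>\<close>, since \<open>S\<close> is bounded.
\<close>

lemma low_pass_vanishes:
  assumes h: "h \<in> L2"
  shows "(\<lambda>n. l2_norm (\<lambda>\<xi>. indicator (scaled (i - int n) S) \<xi> * h \<xi>)) \<longlonglongrightarrow> 0"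
proof -
  have [measurable]: "h \<in> borel_measurable lebesgue" using h by (rule L2_measurable)
  note [measurable] = S_sets
  obtain B where B: "\<And>x. x \<in> S \<Longrightarrow> \<bar>x\<bar> \<le> B" using integer_tileD(2)[OF S_tile] by (auto simp: bounded_real)
  have "(\<lambda>n. l2_norm (\<lambda>\<xi>. indicator (scaled (i - int n) S) \<xi> * h \<xi> - 0)) \<longlonglongrightarrow> 0"
  proof (rule l2_dominated_convergence[OF _ _ L2_integrable[OF h]])
    show "AE \<xi> in lebesgue. (cmod (indicator (scaled (i - int n) S) \<xi> * h \<xi> - 0))\<^sup>2 \<le> (cmod (h \<xi>))\<^sup>2" for n
      by (auto simp: indicator_def)
    have "AE \<xi> in lebesgue. \<xi> \<noteq> (0::real)" by (rule AE_completion) (rule AE_lborel_singleton)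
    then show "AE \<xi> in lebesgue. (\<lambda>n. indicator (scaled (i - int n) S) \<xi> * h \<xi>) \<longlonglongrightarrow> 0"
    proof eventually_elim
      case (elim \<xi>)
      define c where "c = 2 powi (- i) * \<bar>\<xi>\<bar>"
      have c: "c > 0" using elim by (simp add: c_def)
      obtain N where N: "B / c < 2 ^ N" using real_arch_pow[of 2 "B / c"] by auto
      have "\<xi> \<notin> scaled (i - int n) S" if "n \<ge> N" for n
      proof
        assume "\<xi> \<in> scaled (i - int n) S"
        then have "\<bar>2 powi (- (i - int n)) * \<xi>\<bar> \<le> B" using B by (simp add: scaled_def)
        moreover have "2 powi (- (i - int n)) = (2::real) ^ n * 2 powi (- i)"
          by (simp add: power_int_diff power_int_minus divide_inverse)
        ultimately have "2 ^ n * c \<le> B" by (simp add: abs_mult c_def mult.assoc)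
        moreover have "(2::real) ^ N \<le> 2 ^ n" using that by (intro power_increasing) auto
        then have "2 ^ N * c \<le> 2 ^ n * c" using c by (intro mult_right_mono) auto
        moreover have "B < 2 ^ N * c" using N c by (simp add: pos_divide_less_eq)
        ultimately show False by linarith
      qed
      then have "\<forall>\<^sub>F n in sequentially. indicator (scaled (i - int n) S) \<xi> * h \<xi> = 0"
        by (auto simp: eventually_sequentially intro!: exI[of _ N])
      then show ?case by (rule tendsto_eventually)
    qed
  qed measurable
  then show ?thesis by simp
qed

text \<open>
  The dilates of \<open>K = 2S \<setminus> S\<close> exhaust the line by telescoping: those of order \<open>i - n, \<dots>, i - 1\<close> fill
  \<open>2\<^sup>i S\<close> up to the low-frequency part \<open>2\<^sup>i\<^sup>-\<^sup>n S\<close>.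
\<close>

lemma scaled_K_span_dense:
  assumes W: "l2_subspace W" and band: "\<And>j. L2on (scaled j K) \<subseteq> l2_closure W"
  shows "L2c \<subseteq> l2_closure W"
proof
  fix h assume h: "h \<in> L2c"
  then have hL: "h \<in> L2" by (rule L2c_L2)
  obtain i where i: "h \<in> L2on (scaled i S)" using L2c_in_scaled[OF h] .
  have WL: "W \<subseteq> L2" using W by (simp add: l2_subspace_def)
  note cl = l2_subspace_closure[OF W]
  define p where "p n \<xi> = h \<xi> - indicator (scaled (i - int n) S) \<xi> * h \<xi>" for n \<xi>
  have "p n \<in> l2_closure W" for n
  proof (induction n)
    case 0
    have "p 0 = (\<lambda>\<xi>. 0)" using i by (auto simp: p_def L2on_def indicator_def fun_eq_iff)
    then show ?case using cl by (simp add: l2_subspace_def)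
  next
    case (Suc n)
    have "(\<lambda>\<xi>. indicator (scaled (i - int (Suc n)) K) \<xi> * h \<xi>) \<in> l2_closure W"
      using band L2on_restrict[OF hL scaled_sets[OF K_sets]] by blast
    then have "(\<lambda>\<xi>. p n \<xi> + indicator (scaled (i - int (Suc n)) K) \<xi> * h \<xi>) \<in> l2_closure W"
      using Suc cl by (simp add: l2_subspace_def)
    moreover have "(\<lambda>\<xi>. p n \<xi> + indicator (scaled (i - int (Suc n)) K) \<xi> * h \<xi>) = p (Suc n)"
      using scaled_K[of "i - int (Suc n)"] scaled_Suc[of "i - int (Suc n)"]
      by (auto simp: p_def indicator_def fun_eq_iff)
    ultimately show ?case by simp
  qed
  moreover have "l2_norm (\<lambda>\<xi>. p n \<xi> - h \<xi>) = l2_norm (\<lambda>\<xi>. indicator (scaled (i - int n) S) \<xi> * h \<xi>)" for n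
    by (simp add: p_def l2_norm_def)
  then have "(\<lambda>n. l2_norm (\<lambda>\<xi>. p n \<xi> - h \<xi>)) \<longlonglongrightarrow> 0"
    using low_pass_vanishes[OF hL, of i] by simp
  ultimately show "h \<in> l2_closure W" by (rule l2_closure_limit[OF _ hL _ WL])
qed

definition mra :: "int \<Rightarrow> (real \<Rightarrow> complex) set" where
  "mra j = bandlimited (scaled j S)"

text \<open>
  Let \<open>f\<close> lie in every space of the sequence and be close to the inverse transform of \<open>h\<close>. Then \<open>h\<close> is
  nearly concentrated on each \<open>2\<^sup>-\<^sup>n S\<close>, where its norm tends to \<open>0\<close>. So \<open>h\<close> and hence \<open>f\<close> are small.
\<close>

lemma mra_intersection: "(\<Inter>j. mra j) = l2_null"
proof (intro equalityI subsetI)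
  fix f assume "f \<in> l2_null"
  then have ae: "AE x in lebesgue. f x = 0" by (simp add: l2_null_def)
  have "f \<in> mra j" for j
    unfolding mra_def bandlimited_def
  proof (rule l2_closure_AE)
    show TL: "inv_fourier ` L2on (scaled j S) \<subseteq> L2" using L2on_L2c[OF S_bounded] inv_fourier_L2 by blast
    show "(\<lambda>x. 0) \<in> l2_closure (inv_fourier ` L2on (scaled j S))"
      using l2_subspace_closure[OF inv_fourier_image_subspace[OF L2on_subspace L2on_L2c[OF S_bounded]]]
      by (simp add: l2_subspace_def)
    show "AE x in lebesgue. 0 = f x" using ae by eventually_elim simp
  qed
  then show "f \<in> (\<Inter>j. mra j)" by blast
next
  fix f assume f: "f \<in> (\<Inter>j. mra j)"
  then have fL: "f \<in> L2" using bandlimited_L2 by (auto simp: mra_def)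
  have small: "l2_norm f < 4 * e" if e: "e > 0" for e
  proof -
    obtain h where h: "h \<in> L2c" "l2_norm (\<lambda>x. f x - inv_fourier h x) < e"
      using l2_closureE[of f "inv_fourier ` L2c" e] fL e by (auto simp: inv_fourier_range_dense)
    note hL = L2c_L2[OF h(1)]
    obtain n where n: "l2_norm (\<lambda>\<xi>. indicator (scaled (0 - int n) S) \<xi> * h \<xi>) < e"
      using order_tendstoD(2)[OF low_pass_vanishes[OF hL, of 0] e] by (auto simp: eventually_sequentially)
    define T where "T = scaled (0 - int n) S"
    have T: "T \<in> sets lebesgue" by (simp add: T_def S_sets)
    have "f \<in> bandlimited T" using f by (auto simp: mra_def T_def)
    then obtain k where k: "k \<in> L2on T" "l2_norm (\<lambda>x. f x - inv_fourier k x) < e"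
      using l2_closureE[of f "inv_fourier ` L2on T" e] e by (auto simp: bandlimited_def)
    have kc: "k \<in> L2c" using k(1) L2on_L2c[OF S_bounded] by (auto simp: T_def)
    have "l2_norm (\<lambda>\<xi>. h \<xi> - k \<xi>) = l2_norm (\<lambda>x. inv_fourier h x - inv_fourier k x)"
      using inv_fourier_dist[OF h(1) kc] by simp
    also have "\<dots> < 2 * e"
      using l2_norm_triangle_diff[OF inv_fourier_L2[OF h(1)] fL inv_fourier_L2[OF kc]] h(2) k(2)
      by (simp add: l2_norm_minus_commute[of "inv_fourier h" f])
    finally have hk: "l2_norm (\<lambda>\<xi>. h \<xi> - k \<xi>) < 2 * e" .
    have tL: "(\<lambda>\<xi>. indicator T \<xi> * h \<xi>) \<in> L2" by (rule L2_restrict[OF hL T])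
    \<comment> \<open>Away from \<open>T\<close> the function \<open>k\<close> vanishes, so there \<open>h\<close> is as small as \<open>h - k\<close>.\<close>
    have "l2_norm (\<lambda>\<xi>. h \<xi> - indicator T \<xi> * h \<xi>) \<le> l2_norm (\<lambda>\<xi>. h \<xi> - k \<xi>)"
    proof (rule l2_norm_mono)
      show "cmod (h x - indicator T x * h x) \<le> cmod (h x - k x)" for x
        using k(1) by (auto simp: L2on_def indicator_def)
    qed (auto intro: L2_diff hL tL L2c_L2[OF kc])
    then have "l2_norm h < 3 * e"
      using l2_norm_triangle[OF L2_diff[OF hL tL] tL] hk n by (simp add: T_def)
    then show ?thesis
      using l2_norm_triangle[OF L2_diff[OF fL inv_fourier_L2[OF h(1)]] inv_fourier_L2[OF h(1)]] h
      by (simp add: inv_fourier_norm)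
  qed
  have "l2_norm f = 0"
    using small[of "l2_norm f / 8"] l2_norm_nonneg[of f] by (cases "l2_norm f = 0") auto
  then show "f \<in> l2_null" using l2_norm_eq_0_AE[OF fL] by (simp add: l2_null_def)
qed

lemma mra_multiresolution_analysis: "multiresolution_analysis mra"
  unfolding multiresolution_analysis_def
proof (intro conjI allI)
  show "l2_closed_subspace (mra j)" for j
    unfolding mra_def by (rule bandlimited_closed_subspace[OF S_bounded])
  show "mra j \<subseteq> mra (j + 1)" for j
    unfolding mra_def by (rule bandlimited_mono[OF scaled_Suc])
  show "f \<in> mra j \<longleftrightarrow> (\<lambda>x. f (2 * x)) \<in> mra (j + 1)" for j f
  proof
    assume "f \<in> mra j"
    then have "(\<lambda>x. f (2 * x)) \<in> bandlimited {\<xi>. \<xi> / 2 \<in> scaled j S}"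
      unfolding mra_def by (rule bandlimited_dilate[OF _ S_bounded]) simp
    moreover have "{\<xi>. \<xi> / 2 \<in> scaled j S} = scaled (j + 1) S"
      unfolding scaled_def powi_minus_Suc by simp
    ultimately show "(\<lambda>x. f (2 * x)) \<in> mra (j + 1)" by (simp add: mra_def)
  next
    assume "(\<lambda>x. f (2 * x)) \<in> mra (j + 1)"
    then have "(\<lambda>x. f (2 * (1 / 2 * x))) \<in> bandlimited {\<xi>. \<xi> / (1 / 2) \<in> scaled (j + 1) S}"
      unfolding mra_def by (rule bandlimited_dilate[OF _ S_bounded]) simp
    moreover have "{\<xi>. \<xi> / (1 / 2) \<in> scaled (j + 1) S} = scaled j S"
      unfolding scaled_def powi_minus_Suc by simp
    ultimately show "f \<in> mra j" by (simp add: mra_def)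
  qed
  show "(\<Inter>j. mra j) = l2_null" by (rule mra_intersection)
  show "l2_closure (\<Union>j. mra j) = L2"
  proof
    have "inv_fourier ` L2c \<subseteq> (\<Union>j. mra j)"
    proof
      fix f assume "f \<in> inv_fourier ` L2c"
      then obtain h where h: "h \<in> L2c" "f = inv_fourier h" by blast
      obtain i where "h \<in> L2on (scaled i S)" using L2c_in_scaled[OF h(1)] .
      then have "f \<in> mra i" unfolding h(2) mra_def by (rule inv_fourier_bandlimited[OF S_bounded])
      then show "f \<in> (\<Union>j. mra j)" by blast
    qed
    from l2_closure_mono[OF this] show "L2 \<subseteq> l2_closure (\<Union>j. mra j)" by (simp add: inv_fourier_range_dense)
  qed (rule l2_closure_subset_L2)
  interpret \<phi>: unimodular_on_tile S "indicator S"
    by standard (use S_tile integer_tileD(1)[OF S_tile] in \<open>auto simp: indicator_def\<close>)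
  have "indicator S \<in> L2c" using \<phi>.g_in L2on_L2c[OF integer_tileD(2)[OF S_tile]] by blast
  then have "inv_fourier (indicator S) \<in> L2" by (rule inv_fourier_L2)
  then have "l2_orthonormal_basis (integer_translates (inv_fourier (indicator S))) (mra 0)"
    using \<phi>.translates_basis[of "inv_fourier (indicator S)"] by (simp add: mra_def)
  moreover have "inv_fourier (indicator S) \<in> mra 0"
    unfolding mra_def using inv_fourier_bandlimited[OF integer_tileD(2)[OF S_tile] \<phi>.g_in] by simp
  ultimately show "\<exists>\<phi>\<in>mra 0. l2_orthonormal_basis (integer_translates \<phi>) (mra 0)" by blast
qed

text \<open>
  On the frequency side, the functions on \<open>2S\<close> that are orthogonal to those on \<open>S\<close> live on \<open>K\<close>. An element of \<open>V\<^sub>1\<close> orthogonal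
  to \<open>V\<^sub>0\<close> is approximated by some \<open>h\<close> on \<open>2S\<close>; by Pythagoras, discarding the part of \<open>h\<close> on \<open>S\<close> only
  improves the approximation.
\<close>

lemma mra_orthogonal_complement: "l2_orthogonal_complement (mra 1) (mra 0) = bandlimited K"
proof (intro equalityI subsetI)
  fix f assume f: "f \<in> bandlimited K"
  then have "f \<in> mra 1" using bandlimited_mono[of K "scaled 1 S"] by (auto simp: mra_def K_scaled_1)
  moreover have "l2_inner f g = 0" if "g \<in> mra 0" for g
    using that by (intro bandlimited_orthogonal[OF K_bounded S_bounded[of 0] _ f]) (auto simp: K_scaled_1 mra_def)
  ultimately show "f \<in> l2_orthogonal_complement (mra 1) (mra 0)" by (simp add: l2_orthogonal_complement_def)
next
  fix f assume "f \<in> l2_orthogonal_complement (mra 1) (mra 0)"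
  then have f: "f \<in> bandlimited (scaled 1 S)" and orth: "\<And>g. g \<in> bandlimited S \<Longrightarrow> l2_inner f g = 0"
    by (auto simp: l2_orthogonal_complement_def mra_def)
  then have fL: "f \<in> L2" using bandlimited_L2 by blast
  have Sb: "bounded S" using S_bounded[of 0] by simp
  show "f \<in> bandlimited K"
    unfolding bandlimited_def
  proof (rule l2_closureI[OF fL])
    fix r :: real assume "r > 0"
    then obtain h where h: "h \<in> L2on (scaled 1 S)" "l2_norm (\<lambda>x. f x - inv_fourier h x) < r"
      using l2_closureE[OF f[unfolded bandlimited_def]] by blast
    define hK where "hK \<xi> = indicator K \<xi> * h \<xi>" for \<xi>
    define hS where "hS \<xi> = indicator S \<xi> * h \<xi>" for \<xi>
    have hK: "hK \<in> L2on K" and hS: "hS \<in> L2on S"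
      unfolding hK_def[abs_def] hS_def[abs_def] using L2on_restrict[OF L2on_L2[OF h(1)]] K_sets S_sets[of 0] by auto
    then have c: "hK \<in> L2c" "hS \<in> L2c" using L2on_L2c[OF K_bounded] L2on_L2c[OF Sb] by blast+
    have "h = (\<lambda>\<xi>. hK \<xi> + hS \<xi>)"
      using h(1) by (auto simp: hK_def hS_def K_scaled_1 indicator_def L2on_def fun_eq_iff)
    then have sum: "inv_fourier h x = inv_fourier hK x + inv_fourier hS x" for x
      using c by (simp add: inv_fourier_add)
    define d where "d x = f x - inv_fourier hK x" for x
    have dL: "d \<in> L2" unfolding d_def[abs_def] using fL c by (intro L2_diff inv_fourier_L2)
    have "hK x * cnj (hS x) = 0" for x by (simp add: hK_def hS_def K_def indicator_def)
    then have "l2_inner hK hS = 0" by (simp only: l2_inner_def Bochner_Integration.integral_zero)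
    moreover have "l2_inner f (inv_fourier hS) = 0" by (rule orth[OF inv_fourier_bandlimited[OF Sb hS]])
    ultimately have "l2_inner d (inv_fourier hS) = 0"
      unfolding d_def[abs_def] using fL c by (simp add: l2_inner_diff_left inv_fourier_L2 inv_fourier_inner)
    then have "(l2_norm (\<lambda>x. d x - inv_fourier hS x))\<^sup>2 = (l2_norm d)\<^sup>2 + (l2_norm (inv_fourier hS))\<^sup>2"
      using dL c by (subst l2_norm_diff_sq) (simp_all add: inv_fourier_L2)
    moreover have "(\<lambda>x. d x - inv_fourier hS x) = (\<lambda>x. f x - inv_fourier h x)"
      by (simp add: d_def sum fun_eq_iff)
    ultimately have "(l2_norm d)\<^sup>2 \<le> (l2_norm (\<lambda>x. f x - inv_fourier h x))\<^sup>2" by simp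
    then have "l2_norm d < r" using h(2) power2_le_imp_le[OF _ l2_norm_nonneg] by (meson le_less_trans)
    then show "\<exists>g\<in>inv_fourier ` L2on K. l2_norm (\<lambda>x. f x - g x) < r"
      unfolding d_def[abs_def] using hK by (intro bexI[of _ "inv_fourier hK"]) auto
  qed
qed

end

text \<open>
  A wavelet is treated through an arbitrary representative \<open>\<psi>\<close> of the inverse transform of \<open>g\<close>, since the
  defining properties only see almost everywhere classes.
\<close>

locale scaling_set_wavelet = scaling_set S \<delta> + unimodular_on_tile "scaling_set.K S" g
  for S :: "real set" and \<delta> :: real and g :: "real \<Rightarrow> complex" +
  fixes \<psi> :: "real \<Rightarrow> complex"
  assumes psi_L2: "\<psi> \<in> L2" and psi_AE: "AE x in lebesgue. \<psi> x = inv_fourier g x"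
begin

definition wavelet_freq :: "int \<times> int \<Rightarrow> real \<Rightarrow> complex" where
  "wavelet_freq = (\<lambda>(j, k). dilate j (modulation g k))"

lemma wavelet_freq_L2c: "wavelet_freq i \<in> L2c"
proof -
  have "wavelet_freq i \<in> L2on (scaled (fst i) K)"
    unfolding wavelet_freq_def using dilate_L2on[OF modulation_in] by (simp add: split_beta)
  then show ?thesis using L2on_L2c[OF scaled_bounded[OF K_bounded]] by blast
qed

text \<open>
  Different dilates have disjoint supports; within one dilate, dilation is unitary and the modulations are
  orthonormal.
\<close>

lemma wavelet_freq_orthonormal: "l2_inner (wavelet_freq i) (wavelet_freq i') = (if i = i' then 1 else 0)"
proof -
  obtain j k j' k' where i: "i = (j, k)" "i' = (j', k')" by (cases i, cases i') auto
  show ?thesis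
  proof (cases "j = j'")
    case True
    then show ?thesis using i by (simp add: wavelet_freq_def dilate_inner modulation_orthonormal)
  next
    case False
    have in_K: "dilate j (modulation g k) \<in> L2on (scaled j K)" for j k
      using dilate_L2on[OF modulation_in] .
    have "dilate j (modulation g k) x * cnj (dilate j' (modulation g k') x) = 0" for x
      using in_K[of j k] in_K[of j' k'] scaled_K_disjoint[OF False] by (auto simp: L2on_def)
    then have "l2_inner (dilate j (modulation g k)) (dilate j' (modulation g k')) = 0"
      by (simp only: l2_inner_def Bochner_Integration.integral_zero)
    then show ?thesis using i False by (simp add: wavelet_freq_def)
  qed
qed

lemma wavelet_freq_dense: "L2c \<subseteq> l2_closure (l2_span wavelet_freq)"
proof (rule scaled_K_span_dense)
  show "l2_subspace (l2_span wavelet_freq)" using wavelet_freq_L2c by (intro l2_span_subspace L2c_L2)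
  fix j
  have "l2_span (\<lambda>k. dilate j (modulation g k)) \<subseteq> l2_span wavelet_freq"
  proof
    fix v assume "v \<in> l2_span (\<lambda>k. dilate j (modulation g k))"
    then show "v \<in> l2_span wavelet_freq"
    proof (induction rule: l2_span_induct)
      case (scale c k)
      show ?case using l2_span_scale[OF l2_span_base[of wavelet_freq "(j, k)"], of c] by (simp add: wavelet_freq_def)
    qed (auto intro: l2_span_zero l2_span_add)
  qed
  from l2_closure_mono[OF this] dilate_dense[OF modulation_dense]
  show "L2on (scaled j K) \<subseteq> l2_closure (l2_span wavelet_freq)" by blast
qed

lemma wavelet_family_AE: "AE x in lebesgue. wavelet_family \<psi> i x = inv_fourier (wavelet_freq i) x"
proof -
  obtain j k where i: "i = (j, k)" by (cases i) auto
  have "AE x in lebesgue. \<psi> (- of_int k + 2 powi j * x) = inv_fourier g (- of_int k + 2 powi j * x)"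
    by (rule AE_affine[OF psi_AE]) simp
  then show ?thesis
    by eventually_elim (simp add: i wavelet_family_def wavelet_freq_def inv_fourier_dilate_dyadic inv_fourier_modulation)
qed

lemma wavelet_family_L2: "wavelet_family \<psi> i \<in> L2"
  by (rule L2_cong_AE[OF inv_fourier_L2[OF wavelet_freq_L2c]])
    (use wavelet_family_AE[of i] in \<open>auto elim!: eventually_mono\<close>)

lemma orthonormal_wavelet: "orthonormal_wavelet \<psi>"
proof -
  have "l2_inner (wavelet_family \<psi> i) (wavelet_family \<psi> i') = (if i = i' then 1 else 0)" for i i'
  proof -
    have "l2_inner (wavelet_family \<psi> i) (wavelet_family \<psi> i')
        = l2_inner (inv_fourier (wavelet_freq i)) (inv_fourier (wavelet_freq i'))"
      by (rule l2_inner_cong_AE)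
        (auto intro: wavelet_family_L2 wavelet_family_AE inv_fourier_L2 wavelet_freq_L2c)
    then show ?thesis by (simp add: inv_fourier_inner wavelet_freq_L2c wavelet_freq_orthonormal)
  qed
  moreover have "l2_closure (l2_span (wavelet_family \<psi>)) = l2_closure (inv_fourier ` L2c)"
    by (rule closure_span_inv_fourier[OF L2c_subspace order.refl wavelet_freq_L2c wavelet_family_L2
          wavelet_family_AE wavelet_freq_dense])
  ultimately show ?thesis
    unfolding orthonormal_wavelet_def l2_orthonormal_basis_def
    by (simp add: psi_L2 wavelet_family_L2 inv_fourier_range_dense)
qed

lemma mra_wavelet: "mra_wavelet \<psi>"
  unfolding mra_wavelet_def
  using orthonormal_wavelet mra_multiresolution_analysis translates_basis[OF psi_L2 psi_AE]
  by (auto simp: mra_orthogonal_complement intro!: exI[of _ mra])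

end

section \<open>The sets \<open>K\<^sub>a\<close>\<close>

text \<open>
  The scaling set. For \<open>1/3 < a < 1/2\<close> it is the union of the sets \<open>2\<^sup>-\<^sup>j K\<^sub>a\<close> with \<open>j \<ge> 1\<close>, up to a null set.
\<close>

definition Sa :: "real \<Rightarrow> real set" where
  "Sa a = {\<xi>. \<bar>\<xi>\<bar> \<le> a \<or> 1 / 2 \<le> \<bar>\<xi>\<bar> \<and> \<bar>\<xi>\<bar> \<le> 1 - a}"

lemma AE_not_in_finite: "finite X \<Longrightarrow> AE x in lebesgue. (x::real) \<notin> X"
  by (intro AE_completion AE_not_in finite_imp_null_set_lborel)

lemma Sa_closed: "closed (Sa a)"
  unfolding Sa_def
  by (intro closed_Collect_disj closed_Collect_conj closed_Collect_le continuous_intros)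

lemma integer_tileI:
  assumes "E \<in> sets lebesgue" "bounded E" "finite X"
    and "\<And>\<xi>. \<bar>\<xi>\<bar> < 1 / 2 \<Longrightarrow> \<xi> \<notin> X \<Longrightarrow> \<exists>m. \<forall>k. \<xi> + of_int k \<in> E \<longleftrightarrow> k = m"
  shows "integer_tile E"
  unfolding integer_tile_def
proof (intro conjI assms(1,2))
  show "AE \<xi> in lebesgue. \<xi> \<in> unit_cell \<longrightarrow> (\<exists>!k. \<xi> + of_int k \<in> E)"
    \<comment> \<open>The cell is half-open, so its left end is excluded as well.\<close>
    using AE_not_in_finite[OF finite.insertI[OF assms(3), of "-1/2"]]
  proof eventually_elim
    fix \<xi> assume "\<xi> \<notin> insert (-1/2) X"
    then have X: "\<xi> \<noteq> -1/2" "\<xi> \<notin> X" by auto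
    show "\<xi> \<in> unit_cell \<longrightarrow> (\<exists>!k. \<xi> + of_int k \<in> E)"
    proof
      assume "\<xi> \<in> unit_cell"
      then have "\<bar>\<xi>\<bar> < 1 / 2" using X(1) by (auto simp: unit_cell_def abs_less_iff)
      then obtain m where "\<And>k. \<xi> + of_int k \<in> E \<longleftrightarrow> k = m" using assms(4) X(2) by blast
      then show "\<exists>!k. \<xi> + of_int k \<in> E" by simp
    qed
  qed
qed

lemma integer_shift_cases:
  fixes \<xi> :: real
  assumes "\<bar>\<xi>\<bar> < 1 / 2"
  obtains "\<bar>\<xi> + of_int k\<bar> > 3 / 2" "k \<notin> {-1, 0, 1}" | "k = -1" | "k = 0" | "k = 1"
proof (cases "k \<in> {-1, 0, 1}")
  case True then show thesis using that by auto
next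
  case False
  then have "2 \<le> k \<or> k \<le> -2" by auto
  then have "2 \<le> real_of_int k \<or> real_of_int k \<le> -2" by linarith
  then have "\<bar>\<xi> + of_int k\<bar> > 3 / 2" using assms by linarith
  then show thesis using that False by blast
qed

context
  fixes a :: real
  assumes a_gt: "1 / 3 < a" and a_lt: "a < 1 / 2"
begin

text \<open>
  The part \<open>[-a, a]\<close> stays in place, and the integers \<open>1\<close> and \<open>-1\<close> carry the ends of the unit cell to
  \<open>[1/2, 1 - a]\<close> and \<open>[a - 1, -1/2]\<close>.
\<close>

lemma Sa_tile: "integer_tile (Sa a)"
proof (rule integer_tileI[where X="{-a, a}"])
  show "Sa a \<in> sets lebesgue" using Sa_closed by (simp add: borel_closed sets_completionI_sets)
  show "bounded (Sa a)" unfolding bounded_real using a_gt a_lt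
    by (intro exI[of _ 1]) (auto simp: Sa_def)
  fix \<xi> :: real assume \<xi>: "\<bar>\<xi>\<bar> < 1 / 2" "\<xi> \<notin> {-a, a}"
  define m where "m = (if a < \<xi> then -1 else if \<xi> < - a then 1 else 0 :: int)"
  have "\<xi> + of_int k \<in> Sa a \<longleftrightarrow> k = m" for k
    using \<xi>(1)
  proof (cases rule: integer_shift_cases[where k=k])
    case 1
    then show ?thesis using a_gt a_lt by (auto simp: Sa_def m_def)
  qed (use \<xi> a_gt a_lt in \<open>auto simp: Sa_def m_def abs_if split: if_splits\<close>)
  then show "\<exists>m. \<forall>k. \<xi> + of_int k \<in> Sa a \<longleftrightarrow> k = m" by blast
qed simp

interpretation scaling_set "Sa a" a
proof
  show "\<xi> / 2 \<in> Sa a" if "\<xi> \<in> Sa a" for \<xi>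
    using that a_gt a_lt by (auto simp: Sa_def)
qed (use Sa_tile a_gt in \<open>auto simp: Sa_def\<close>)

lemma K_iff: "\<xi> \<in> K \<longleftrightarrow>
    a < \<bar>\<xi>\<bar> \<and> \<bar>\<xi>\<bar> < 1 / 2 \<or> 1 - a < \<bar>\<xi>\<bar> \<and> \<bar>\<xi>\<bar> \<le> 2 * a \<or> 1 \<le> \<bar>\<xi>\<bar> \<and> \<bar>\<xi>\<bar> \<le> 2 * (1 - a)"
  unfolding K_def mem_Collect_eq unfolding Sa_def mem_Collect_eq abs_divide using a_gt a_lt by simp linarith

text \<open>
  The positive half of the unit cell splits into \<open>(0, 1 - 2a)\<close>, \<open>(1 - 2a, a)\<close> and \<open>(a, 1/2)\<close>. They are carried
  by \<open>1\<close>, \<open>-1\<close> and \<open>0\<close> to \<open>(1, 2 - 2a)\<close>, \<open>(-2a, a - 1)\<close> and \<open>(a, 1/2)\<close>. The negative half is symmetric.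
  The order \<open>1 - 2a < a\<close> of the cutting points is the hypothesis \<open>a > 1/3\<close>.
\<close>

lemma K_tile: "integer_tile K"
proof (rule integer_tileI[OF K_sets K_bounded, where X="{-a, a, 1 - 2 * a, 2 * a - 1, 0}"])
  fix \<xi> :: real assume \<xi>: "\<bar>\<xi>\<bar> < 1 / 2" "\<xi> \<notin> {-a, a, 1 - 2 * a, 2 * a - 1, 0}"
  define m where "m = (if a < \<bar>\<xi>\<bar> then 0 else
    if \<bar>\<xi>\<bar> < 1 - 2 * a then (if 0 < \<xi> then 1 else -1) else (if 0 < \<xi> then -1 else 1 :: int))"
  have "\<xi> + of_int k \<in> K \<longleftrightarrow> k = m" for k
    using \<xi>(1)
  proof (cases rule: integer_shift_cases[where k=k])
    case 1
    then show ?thesis using a_gt a_lt by (auto simp: K_iff m_def)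
  qed (use \<xi> a_gt a_lt in \<open>auto simp: K_iff m_def abs_if split: if_splits\<close>)
  then show "\<exists>m. \<forall>k. \<xi> + of_int k \<in> K \<longleftrightarrow> k = m" by blast
qed simp

lemma Ka_iff: "\<xi> \<in> Ka a \<longleftrightarrow> \<bar>\<xi>\<bar> \<in> Ka_plus a"
proof -
  have "\<xi> \<in> uminus ` Ka_plus a \<longleftrightarrow> - \<xi> \<in> Ka_plus a" by (metis image_iff minus_minus)
  moreover have "x > 0" if "x \<in> Ka_plus a" for x using that a_gt a_lt by (auto simp: Ka_plus_def)
  ultimately show ?thesis unfolding Ka_def by (cases "\<xi> \<ge> 0") (fastforce simp: abs_if)+
qed

lemma Ka_AE_K: "AE \<xi> in lebesgue. \<xi> \<in> Ka a \<longleftrightarrow> \<xi> \<in> K"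
proof -
  have "AE \<xi> in lebesgue. \<xi> \<notin> {a, -a, 1/2, -1/2, 1 - a, a - 1}" by (rule AE_not_in_finite) simp
  then show ?thesis
  proof eventually_elim
    case (elim \<xi>)
    then show ?case unfolding Ka_iff K_iff by (auto simp: Ka_plus_def abs_if split: if_splits)
  qed
qed

lemma Ka_sets: "Ka a \<in> sets lebesgue"
proof -
  have "closed (Ka_plus a)" unfolding Ka_plus_def by (intro closed_Un closed_atLeastAtMost)
  then have "closed (Ka a)" unfolding Ka_def by (intro closed_Un closed_negations)
  then show ?thesis by (simp add: borel_closed sets_completionI_sets)
qed

lemma K_unimodular:
  assumes "g \<in> borel_measurable lebesgue" "\<And>\<xi>. cmod (g \<xi>) = indicator K \<xi>"
  shows "unimodular_on_tile K g"
  using assms K_tile by unfold_locales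

lemma wavelet_set_Ka: "wavelet_set (Ka a)"
  unfolding wavelet_set_def
proof (intro conjI Ka_sets exI)
  interpret unimodular_on_tile K "indicator K"
    by (rule K_unimodular) (use K_sets in \<open>auto simp: indicator_def\<close>)
  have c: "indicator K \<in> L2c" using g_in L2on_L2c[OF K_bounded] by blast
  interpret scaling_set_wavelet "Sa a" a "indicator K" "inv_fourier (indicator K)"
    by unfold_locales (use inv_fourier_L2[OF c] in auto)
  show "orthonormal_wavelet (inv_fourier (indicator K))" by (rule orthonormal_wavelet)
  have "AE \<xi> in lebesgue. cmod (indicator K \<xi>) = indicat_real (Ka a) \<xi>"
    using Ka_AE_K by eventually_elim (auto simp: indicator_def)
  then show "fourier_modulus_is_indicator (inv_fourier (indicator K)) (Ka a)"
    unfolding fourier_modulus_is_indicator_def using has_l2_fourier_inv_fourier[OF c] by blast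
qed

text \<open>
  The transform of \<open>\<psi>\<close> may be changed on a null set so that its modulus is
  \<open>indicator K\<close> everywhere; then \<open>\<psi>\<close> is almost everywhere the inverse transform of a function of bounded support.
\<close>

lemma mra_wavelet_Ka:
  assumes "fourier_modulus_is_indicator \<psi> (Ka a)"
  shows "mra_wavelet \<psi>"
proof -
  obtain g where g: "has_l2_fourier \<psi> g" "AE \<xi> in lebesgue. cmod (g \<xi>) = indicat_real (Ka a) \<xi>"
    using assms by (auto simp: fourier_modulus_is_indicator_def)
  \<comment> \<open>The inner default value \<open>1\<close> only has to have modulus one; it is taken on a null set.\<close>
  define g' where "g' \<xi> = (if \<xi> \<in> K then if cmod (g \<xi>) = 1 then g \<xi> else 1 else 0)" for \<xi>
  have ae: "AE \<xi> in lebesgue. g \<xi> = g' \<xi>"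
    using g(2) Ka_AE_K by eventually_elim (auto simp: g'_def indicator_def split: if_splits)
  have "g \<in> L2" "\<psi> \<in> L2" using g(1) by (auto simp: has_l2_fourier_def l2_tendsto_def)
  then have g': "g' \<in> L2" using L2_cong_AE ae by blast
  interpret unimodular_on_tile K g'
    by (rule K_unimodular) (use g' in \<open>auto simp: L2_measurable g'_def indicator_def\<close>)
  have c: "g' \<in> L2c" using g_in L2on_L2c[OF K_bounded] by blast
  interpret scaling_set_wavelet "Sa a" a g' \<psi>
    by unfold_locales (use \<open>\<psi> \<in> L2\<close> has_l2_fourier_unique[OF g(1) c ae] in auto)
  show ?thesis by (rule mra_wavelet)
qed

lemma symmetric_Ka: "symmetric_set (Ka a)"
  unfolding symmetric_set_def
proof (intro equalityI subsetI)
  fix \<xi> assume "\<xi> \<in> Ka a \<inter> {..0}"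
  then show "\<xi> \<in> uminus ` (Ka a \<inter> {0..})" by (intro image_eqI[of _ _ "- \<xi>"]) (auto simp: Ka_iff)
qed (auto simp: Ka_iff)

text \<open>
  The cutting points \<open>0 < 1 - 2a < a < 1/2\<close> are those of the tiling by integers. The exponents \<open>2\<close> and \<open>1\<close>
  bring the outer two intervals back to \<open>[1/4, (1 - a)/2]\<close> and \<open>[(1 - a)/2, a]\<close>, which together with
  \<open>[a, 1/2]\<close> fill the dyadic interval \<open>[1/4, 1/2]\<close>.
\<close>

lemma Ka_in_class: "Ka a \<in> wavelet_class 3 (\<lambda>j. [1, -1, 1] ! (j - 1)) id"
proof -
  let ?\<epsilon> = "\<lambda>j::nat. [1, -1, 1] ! (j - 1) :: int"
  let ?a = "\<lambda>j::nat. [0, 1 - 2 * a, a, 1 / 2] ! j"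
  let ?m = "\<lambda>j::nat. [1, 1, 0] ! (j - 1) :: nat"
  let ?l = "\<lambda>j::nat. [2, 1] ! (j - 1) :: int"
  let ?\<alpha> = "\<lambda>k::nat. [1 / 4, (1 - a) / 2, a] ! (k - 1)"
  let ?\<beta> = "\<lambda>k::nat. [(1 - a) / 2, a, 1 / 2] ! (k - 1)"
  let ?I = "\<lambda>j. (\<lambda>x. real_of_int (?\<epsilon> j) * x + real (?m j)) ` {?a (j - 1)..?a j}"
  have sets: "{1..3::nat} = {1, 2, 3}" "{1..3 - 1::nat} = {1, 2}" "{..<3::nat} = {0, 1, 2}" by auto
  have I: "?I 1 = {1..2 * (1 - a)}" "?I 2 = {1 - a..2 * a}" "?I 3 = {a..1 / 2}"
    using a_gt a_lt by (simp_all add: image_affinity_atLeastAtMost)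
  have lt3: "(\<forall>j<3. P j) \<longleftrightarrow> P 0 \<and> P 1 \<and> P 2" for P :: "nat \<Rightarrow> bool"
    by (auto simp: numeral_3_eq_3 less_Suc_eq numeral_2_eq_2)
  show ?thesis
    unfolding wavelet_class_def
  proof (rule CollectI, rule conjI[rotated], rule conjI[rotated], rule conjI[rotated], rule conjI[rotated],
      rule exI[of _ ?I], rule exI[of _ ?a], rule exI[of _ ?m], rule exI[of _ ?l], rule exI[of _ ?\<alpha>],
      rule exI[of _ ?\<beta>], intro conjI)
    show "wavelet_set (Ka a)" by (rule wavelet_set_Ka)
    show "symmetric_set (Ka a)" by (rule symmetric_Ka)
    show "id permutes {1..3 - 1::nat}" by (rule permutes_id)
    show "Ka a \<inter> {0..} = (\<Union>j\<in>{1..3}. ?I j)"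
      unfolding sets using a_gt a_lt by (simp only: UN_insert I) (auto simp: Ka_iff Ka_plus_def)
    show "{?\<alpha> 3..?\<beta> 3} = ?I 3" unfolding I by simp
    show "2 * ?\<alpha> 1 = ?\<beta> 3" by simp
    have "(\<lambda>x. 2 powi (- ?l 1) * x) ` ?I 1 = {?\<alpha> (id 1)..?\<beta> (id 1)}"
      unfolding I using a_gt a_lt by (simp add: image_mult_atLeastAtMost power_int_minus field_simps)
    moreover have "(\<lambda>x. 2 powi (- ?l 2) * x) ` ?I 2 = {?\<alpha> (id 2)..?\<beta> (id 2)}"
      unfolding I using a_gt a_lt by (simp add: image_mult_atLeastAtMost power_int_minus field_simps)
    ultimately show "\<forall>j\<in>{1..3 - 1}. {?\<alpha> (id j)..?\<beta> (id j)} = (\<lambda>x. 2 powi (- ?l j) * x) ` ?I j"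
      unfolding sets by blast
    show "\<forall>j<3. ?a j < ?a (Suc j)" unfolding lt3 using a_gt a_lt by simp
    show "\<forall>k\<in>{1..3 - 1}. ?\<beta> k = ?\<alpha> (k + 1)" unfolding sets by simp
    show "\<forall>j\<in>{1..3 - 1}. ?\<epsilon> j = ?\<epsilon> (j + 1) \<longrightarrow> ?m j \<noteq> ?m (j + 1)" unfolding sets by simp
    show "\<forall>j\<in>{1..3}. ?\<epsilon> j \<in> {-1, 1}" unfolding sets by simp
  qed simp_all
qed

end

theorem theorem14:
  fixes a :: real
  assumes "1 / 3 < a" and "a < 1 / 2"
  shows "symmetric_set (Ka a) \<and> wavelet_set (Ka a)
    \<and> Ka a \<in> wavelet_class 3 (\<lambda>j. [1, -1, 1] ! (j - 1)) id
    \<and> associated_to_mra_wavelet (Ka a)"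
  using symmetric_Ka[OF assms] wavelet_set_Ka[OF assms] Ka_in_class[OF assms] mra_wavelet_Ka[OF assms]
  by (auto simp: associated_to_mra_wavelet_def)

end
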